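(* The schematic theory $\mathsf{WF}^{-}$ of hereditarily finite multisets is mutually interpretable with the arithmetical theory $\mathsf{R}$; that is, $\mathsf{WF}^{-}$ is interpretable in $\mathsf{R}$ and $\mathsf{R}$ is interpretable in $\mathsf{WF}^{-}$.
   Context: **Interpretability.** Theories are first-order theories with equality, identified with their sets of non-logical axioms. A (relative) interpretation of a theory $V$ in a theory $U$ is given by a translation $\tau$ of the language of $V$ into that of $U$: a formula $\delta(x)$ (the domain) with $U\vdash\exists x\,\delta(x)$; for each $n$-ary relation symbol of $V$ a formula in $n$ free variables; for each $n$-ary function symbol a formula in $n+1$ free variables which $U$ proves to be total and functional on $\delta$. Translations commute with connectives, and quantifiers are relativized to $\delta$. $V$ is interpretable in $U$ if for some such $\tau$, $U\vdash\varphi^{\tau}$ for every axiom $\varphi$ of $V$. **Hereditarily finite multisets.** A multiset over a set $X$ is a function $X\to\mathbb{N}$ with finite support. $\mathrm{HFM}=\bigcup_n\mathcal{M}_n$, where $\mathcal{M}_0=\emptyset$ and $\mathcal{M}_{n+1}$ is the set of finite multisets over $\mathcal{M}_n$; the rank of $m$ is the least $n$ with $m\in\mathcal{M}_{n+1}$. $\emptyset$ is the empty multiset, $\langle x\rangle$ the singleton multiset containing $x$ once, $x\uplus y$ the multiset union (multiplicities add). Put $u\in_1 v$ iff $\exists w\,(v=w\uplus\langle u\rangle)$, and define $\sqsubseteq$ by recursion on rank: $x\sqsubseteq t$ iff $x=t$ or $\exists u\,(u\in_1 t\wedge x\sqsubseteq u)$. The intended model is $\mathbb{M}=(\mathrm{HFM};\emptyset,\langle\cdot\rangle,\uplus,\sqsubseteq)$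 for the language $L=\{\emptyset,\langle\cdot\rangle,\uplus,\sqsubseteq\}$ (constant, unary function, binary function, binary relation). **Normal forms.** Let $\preceq$ be the length-lexicographic order on closed $L$-terms viewed as strings over $\langle,\rangle,\uplus,\emptyset$ (for a fixed order of these symbols). Normal closed terms: $\emptyset$ is normal; if $t_1\preceq\dots\preceq t_k$ ($k\ge1$) are normal then $\langle t_1\rangle\uplus(\langle t_2\rangle\uplus(\dots\uplus\langle t_k\rangle))$ is normal. The normal form $\mathrm{nf}(s)$ of a closed term $s$ is computed by recursively normalizing arguments, flattening $\uplus$, deleting $\emptyset$-factors, and sorting. For a closed term $t$, $\mathrm{hull}(t)$ is the finite set of normal terms $s$ with $\mathbb{M}\models s\sqsubseteq t$. **The theory $\mathsf{WF}^{-}$** (language $L$) has the (universally quantified) axioms $\mathrm{F}_1$: $(x\uplus y)\uplus z=x\uplus(y\uplus z)$; $\mathrm{F}_2$: $x\uplus y=y\uplus x$; $\mathrm{F}_3$: $x\uplus\emptyset=x$; and the schemes $\mathrm{W}_1$: $\neg(s=t)$ for closed terms $s,t$ with $\mathrm{nf}(s)\not\equiv\mathrm{nf}(t)$ (syntactically different); $\mathrm{W}_2$: $\forall x\,(x\sqsubseteq t\leftrightarrow\bigvee_{s\in\mathrm{hull}(t)}x=s)$ for each closed term $t$. **The theory $\mathsf{R}$** (language $\{0,S,+,\cdot,\le\}$, numerals $\bar n=S^n0$) has, for all $n,m\in\mathbb{N}$, the axioms: $\bar n+\bar m=\overline{n+m}$; $\bar n\cdot\bar m=\overline{n\cdot m}$;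 $\bar n\ne\bar m$ for $n\ne m$; $\forall x\,(x\le\bar n\leftrightarrow x=\bar0\vee\dots\vee x=\bar n)$; $\forall x\,(x\le\bar n\vee\bar n\le x)$. *)

theory Defs
  imports "HOL-Library.Multiset" "HOL-Library.List_Lenlexorder"
begin

section \<open>First-order logic with equality\<close>

text \<open>
  Variables are de Bruijn indices.  A language is given by the arities of the elements of a type
  of function symbols and of a type of relation symbols; constants are function symbols of arity 0.
\<close>

record ('f, 'r) lang =
  farity :: "'f \<Rightarrow> nat"
  rarity :: "'r \<Rightarrow> nat"

datatype 'f tm = Var nat | Fn 'f "'f tm list"

datatype ('f, 'r) fm =
    Bot
  | Eq "'f tm" "'f tm"
  | Rel 'r "'f tm list"
  | Imp "('f, 'r) fm" "('f, 'r) fm"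
  | All "('f, 'r) fm"

abbreviation Neg :: "('f, 'r) fm \<Rightarrow> ('f, 'r) fm" where
  "Neg p \<equiv> Imp p Bot"

abbreviation Or :: "('f, 'r) fm \<Rightarrow> ('f, 'r) fm \<Rightarrow> ('f, 'r) fm" where
  "Or p q \<equiv> Imp (Neg p) q"

abbreviation And :: "('f, 'r) fm \<Rightarrow> ('f, 'r) fm \<Rightarrow> ('f, 'r) fm" where
  "And p q \<equiv> Neg (Imp p (Neg q))"

abbreviation Iff :: "('f, 'r) fm \<Rightarrow> ('f, 'r) fm \<Rightarrow> ('f, 'r) fm" where
  "Iff p q \<equiv> And (Imp p q) (Imp q p)"

abbreviation Ex :: "('f, 'r) fm \<Rightarrow> ('f, 'r) fm" where
  "Ex p \<equiv> Neg (All (Neg p))"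

definition Conj :: "('f, 'r) fm list \<Rightarrow> ('f, 'r) fm" where
  "Conj ps = foldr And ps (Neg Bot)"

definition Disj :: "('f, 'r) fm list \<Rightarrow> ('f, 'r) fm" where
  "Disj ps = foldr Or ps Bot"

definition AllN :: "nat \<Rightarrow> ('f, 'r) fm \<Rightarrow> ('f, 'r) fm" where
  "AllN n = All ^^ n"

definition ExN :: "nat \<Rightarrow> ('f, 'r) fm \<Rightarrow> ('f, 'r) fm" where
  "ExN n = (\<lambda>p. Ex p) ^^ n"

primrec wf_tm :: "('f, 'r) lang \<Rightarrow> 'f tm \<Rightarrow> bool" where
  "wf_tm L (Var x) \<longleftrightarrow> True"
| "wf_tm L (Fn f ts) \<longleftrightarrow> length ts = farity L f \<and> list_all (wf_tm L) ts"

primrec wf_fm :: "('f, 'r) lang \<Rightarrow> ('f, 'r) fm \<Rightarrow> bool" where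
  "wf_fm L Bot \<longleftrightarrow> True"
| "wf_fm L (Eq s t) \<longleftrightarrow> wf_tm L s \<and> wf_tm L t"
| "wf_fm L (Rel r ts) \<longleftrightarrow> length ts = rarity L r \<and> list_all (wf_tm L) ts"
| "wf_fm L (Imp p q) \<longleftrightarrow> wf_fm L p \<and> wf_fm L q"
| "wf_fm L (All p) \<longleftrightarrow> wf_fm L p"

primrec fv_tm :: "'f tm \<Rightarrow> nat set" where
  "fv_tm (Var x) = {x}"
| "fv_tm (Fn f ts) = \<Union> (set (map fv_tm ts))"

primrec fv_fm :: "('f, 'r) fm \<Rightarrow> nat set" where
  "fv_fm Bot = {}"
| "fv_fm (Eq s t) = fv_tm s \<union> fv_tm t"
| "fv_fm (Rel r ts) = \<Union> (set (map fv_tm ts))"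
| "fv_fm (Imp p q) = fv_fm p \<union> fv_fm q"
| "fv_fm (All p) = {x. Suc x \<in> fv_fm p}"

definition is_theory :: "('f, 'r) lang \<Rightarrow> ('f, 'r) fm set \<Rightarrow> bool" where
  "is_theory L T \<longleftrightarrow> (\<forall>p\<in>T. wf_fm L p \<and> fv_fm p = {})"

text \<open>Simultaneous capture-avoiding substitution.\<close>

primrec subst_tm :: "(nat \<Rightarrow> 'f tm) \<Rightarrow> 'f tm \<Rightarrow> 'f tm" where
  "subst_tm \<sigma> (Var x) = \<sigma> x"
| "subst_tm \<sigma> (Fn f ts) = Fn f (map (subst_tm \<sigma>) ts)"

definition up :: "(nat \<Rightarrow> 'f tm) \<Rightarrow> nat \<Rightarrow> 'f tm" where
  "up \<sigma> = case_nat (Var 0) (\<lambda>x. subst_tm (\<lambda>y. Var (Suc y)) (\<sigma> x))"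

primrec subst_fm :: "(nat \<Rightarrow> 'f tm) \<Rightarrow> ('f, 'r) fm \<Rightarrow> ('f, 'r) fm" where
  "subst_fm \<sigma> Bot = Bot"
| "subst_fm \<sigma> (Eq s t) = Eq (subst_tm \<sigma> s) (subst_tm \<sigma> t)"
| "subst_fm \<sigma> (Rel r ts) = Rel r (map (subst_tm \<sigma>) ts)"
| "subst_fm \<sigma> (Imp p q) = Imp (subst_fm \<sigma> p) (subst_fm \<sigma> q)"
| "subst_fm \<sigma> (All p) = All (subst_fm (up \<sigma>) p)"

definition lift_fm :: "('f, 'r) fm \<Rightarrow> ('f, 'r) fm" where
  "lift_fm = subst_fm (\<lambda>x. Var (Suc x))"

text \<open>Body of a quantifier instantiated with a term: index 0 is replaced, the others go down by 1.\<close>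

definition inst_fm :: "'f tm \<Rightarrow> ('f, 'r) fm \<Rightarrow> ('f, 'r) fm" where
  "inst_fm t = subst_fm (case_nat t Var)"

text \<open>Replaces the variables \<open>0, ..., n - 1\<close> by \<open>n\<close> given terms, as in \<open>p(t\<^sub>1, ..., t\<^sub>n)\<close>.\<close>

definition app_fm :: "('f, 'r) fm \<Rightarrow> 'f tm list \<Rightarrow> ('f, 'r) fm" where
  "app_fm p ts = subst_fm (\<lambda>x. if x < length ts then ts ! x else Var x) p"

text \<open>
  Classical natural deduction over the well-formed formulas of a language.  In \<open>all_intro\<close> the
  hypotheses are lifted, so that index 0 is a fresh eigenvariable.
\<close>

inductive deriv :: "('f, 'r) lang \<Rightarrow> ('f, 'r) fm set \<Rightarrow> ('f, 'r) fm \<Rightarrow> bool" for L where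
  assm: "p \<in> \<Gamma> \<Longrightarrow> wf_fm L p \<Longrightarrow> deriv L \<Gamma> p"
| imp_intro: "wf_fm L p \<Longrightarrow> deriv L (insert p \<Gamma>) q \<Longrightarrow> deriv L \<Gamma> (Imp p q)"
| imp_elim: "deriv L \<Gamma> (Imp p q) \<Longrightarrow> deriv L \<Gamma> p \<Longrightarrow> deriv L \<Gamma> q"
| classical: "wf_fm L p \<Longrightarrow> deriv L (insert (Neg p) \<Gamma>) Bot \<Longrightarrow> deriv L \<Gamma> p"
| all_intro: "deriv L (lift_fm ` \<Gamma>) p \<Longrightarrow> deriv L \<Gamma> (All p)"
| all_elim: "deriv L \<Gamma> (All p) \<Longrightarrow> wf_tm L t \<Longrightarrow> deriv L \<Gamma> (inst_fm t p)"
| eq_refl: "wf_tm L t \<Longrightarrow> deriv L \<Gamma> (Eq t t)"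
| eq_subst: "wf_fm L p \<Longrightarrow> deriv L \<Gamma> (Eq s t) \<Longrightarrow> deriv L \<Gamma> (inst_fm s p) \<Longrightarrow> deriv L \<Gamma> (inst_fm t p)"

record ('a, 'f, 'r) struct =
  fint :: "'f \<Rightarrow> 'a list \<Rightarrow> 'a"
  rint :: "'r \<Rightarrow> 'a list \<Rightarrow> bool"

primrec eval_tm :: "('a, 'f, 'r) struct \<Rightarrow> (nat \<Rightarrow> 'a) \<Rightarrow> 'f tm \<Rightarrow> 'a" where
  "eval_tm M e (Var x) = e x"
| "eval_tm M e (Fn f ts) = fint M f (map (eval_tm M e) ts)"

primrec sat :: "('a, 'f, 'r) struct \<Rightarrow> (nat \<Rightarrow> 'a) \<Rightarrow> ('f, 'r) fm \<Rightarrow> bool" where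
  "sat M e Bot \<longleftrightarrow> False"
| "sat M e (Eq s t) \<longleftrightarrow> eval_tm M e s = eval_tm M e t"
| "sat M e (Rel r ts) \<longleftrightarrow> rint M r (map (eval_tm M e) ts)"
| "sat M e (Imp p q) \<longleftrightarrow> (sat M e p \<longrightarrow> sat M e q)"
| "sat M e (All p) \<longleftrightarrow> (\<forall>a. sat M (case_nat a e) p)"

definition models :: "('a, 'f, 'r) struct \<Rightarrow> ('f, 'r) fm \<Rightarrow> bool" where
  "models M p \<longleftrightarrow> (\<forall>e. sat M e p)"


section \<open>Relative interpretations\<close>

text \<open>
  A translation of a language with symbols in \<open>'f\<close>, \<open>'r\<close> into one with symbols in \<open>'g\<close>, \<open>'s\<close>.
  The free variable of the domain formula is 0.  The formula for a relation symbol of arity \<open>n\<close>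
  has its arguments at \<open>0, ..., n - 1\<close>; the formula for a function symbol of arity \<open>n\<close> has in
  addition its value at \<open>n\<close>.  Equality is translated as equality.
\<close>

record ('f, 'r, 'g, 's) translation =
  dom_fm :: "('g, 's) fm"
  fun_fm :: "'f \<Rightarrow> ('g, 's) fm"
  rel_fm :: "'r \<Rightarrow> ('g, 's) fm"

definition is_translation ::
    "('f, 'r) lang \<Rightarrow> ('g, 's) lang \<Rightarrow> ('f, 'r, 'g, 's) translation \<Rightarrow> bool" where
  "is_translation LV LU \<tau> \<longleftrightarrow>
     wf_fm LU (dom_fm \<tau>) \<and> fv_fm (dom_fm \<tau>) \<subseteq> {0} \<and>
     (\<forall>f. wf_fm LU (fun_fm \<tau> f) \<and> fv_fm (fun_fm \<tau> f) \<subseteq> {..farity LV f}) \<and>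
     (\<forall>r. wf_fm LU (rel_fm \<tau> r) \<and> fv_fm (rel_fm \<tau> r) \<subseteq> {..<rarity LV r})"

text \<open>
  Nested terms are unravelled.  \<open>tr_tm \<tau> t k y\<close> says that the translated value of \<open>t\<close>, with the
  variables of \<open>t\<close> raised by \<open>k\<close>, is the variable \<open>y\<close>.  Given such formulas \<open>g k i\<close> for a list of
  \<open>n\<close> terms, \<open>bind_tms\<close> introduces names \<open>0, ..., n - 1\<close> in the domain for their values by
  existential quantifiers; the formula \<open>p\<close> lives under these quantifiers.
\<close>

definition bind_tms ::
    "('f, 'r, 'g, 's) translation \<Rightarrow> (nat \<Rightarrow> nat \<Rightarrow> ('g, 's) fm) list \<Rightarrow> nat \<Rightarrow> ('g, 's) fm \<Rightarrow> ('g, 's) fm"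
  where
  "bind_tms \<tau> gs k p =
     (let n = length gs in
      ExN n (And (Conj (map (\<lambda>i. And (app_fm (dom_fm \<tau>) [Var i]) ((gs ! i) (k + n) i)) [0..<n])) p))"

primrec tr_tm :: "('f, 'r, 'g, 's) translation \<Rightarrow> 'f tm \<Rightarrow> nat \<Rightarrow> nat \<Rightarrow> ('g, 's) fm" where
  "tr_tm \<tau> (Var x) = (\<lambda>k y. Eq (Var (x + k)) (Var y))"
| "tr_tm \<tau> (Fn f ts) = (\<lambda>k y.
     let n = length ts in
     bind_tms \<tau> (map (tr_tm \<tau>) ts) k (app_fm (fun_fm \<tau> f) (map Var [0..<n] @ [Var (y + n)])))"

primrec tr_fm :: "('f, 'r, 'g, 's) translation \<Rightarrow> ('f, 'r) fm \<Rightarrow> ('g, 's) fm" where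
  "tr_fm \<tau> Bot = Bot"
| "tr_fm \<tau> (Eq s t) = bind_tms \<tau> [tr_tm \<tau> s, tr_tm \<tau> t] 0 (Eq (Var 0) (Var 1))"
| "tr_fm \<tau> (Rel r ts) = bind_tms \<tau> (map (tr_tm \<tau>) ts) 0 (rel_fm \<tau> r)"
| "tr_fm \<tau> (Imp p q) = Imp (tr_fm \<tau> p) (tr_fm \<tau> q)"
| "tr_fm \<tau> (All p) = All (Imp (app_fm (dom_fm \<tau>) [Var 0]) (tr_fm \<tau> p))"

text \<open>For all arguments in the domain there is exactly one value in the domain.\<close>

definition fun_ok :: "('f, 'r) lang \<Rightarrow> ('f, 'r, 'g, 's) translation \<Rightarrow> 'f \<Rightarrow> ('g, 's) fm" where
  "fun_ok LV \<tau> f =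
     (let n = farity LV f;
          D = (\<lambda>x. app_fm (dom_fm \<tau>) [Var x]);
          F = (\<lambda>d y. app_fm (fun_fm \<tau> f) (map (\<lambda>i. Var (i + d)) [0..<n] @ [Var y]))
      in AllN n (Imp (Conj (map D [0..<n]))
           (Ex (And (And (D 0) (F 1 0))
                    (All (Imp (And (D 0) (F 2 0)) (Eq (Var 0) (Var 1))))))))"

definition is_interpretation ::
    "('f, 'r) lang \<Rightarrow> ('f, 'r) fm set \<Rightarrow> ('g, 's) lang \<Rightarrow> ('g, 's) fm set \<Rightarrow>
     ('f, 'r, 'g, 's) translation \<Rightarrow> bool" where
  "is_interpretation LV V LU U \<tau> \<longleftrightarrow>
     is_translation LV LU \<tau> \<and>
     deriv LU U (Ex (dom_fm \<tau>)) \<and>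
     (\<forall>f. deriv LU U (fun_ok LV \<tau> f)) \<and>
     (\<forall>p\<in>V. deriv LU U (tr_fm \<tau> p))"

text \<open>\<open>V\<close> is interpretable in \<open>U\<close>.\<close>

definition interpretable ::
    "('f, 'r) lang \<Rightarrow> ('f, 'r) fm set \<Rightarrow> ('g, 's) lang \<Rightarrow> ('g, 's) fm set \<Rightarrow> bool" where
  "interpretable LV V LU U \<longleftrightarrow> (\<exists>\<tau>. is_interpretation LV V LU U \<tau>)"


section \<open>Hereditarily finite multisets\<close>

text \<open>
  As an inductive datatype, \<open>hfm\<close> consists exactly of the multisets that occur at some finite
  level of the cumulative hierarchy; see \<open>Union_level\<close> below.
\<close>

datatype hfm = HFM (elems: "hfm multiset")

primrec level :: "nat \<Rightarrow> hfm set" where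
  "level 0 = {}"
| "level (Suc n) = {HFM A | A. set_mset A \<subseteq> level n}"

lemma level_mono: "m \<le> n \<Longrightarrow> level m \<subseteq> level n"
proof -
  have "level n \<subseteq> level (Suc n)" for n
    by (induction n) auto
  then show "m \<le> n \<Longrightarrow> level m \<subseteq> level n"
    by (rule lift_Suc_mono_le)
qed

lemma ex_level: "\<exists>n. x \<in> level (Suc n)"
proof (induction x)
  case (HFM A)
  then obtain l where l: "\<And>x. x \<in># A \<Longrightarrow> x \<in> level (Suc (l x))"
    by metis
  define N where "N = Max (insert 0 (l ` set_mset A))"
  have "set_mset A \<subseteq> level (Suc N)"
  proof
    fix x assume x: "x \<in># A"
    then have "l x \<le> N"
      unfolding N_def by (intro Max_ge) auto
    then show "x \<in> level (Suc N)"
      using l[OF x] level_mono[of "Suc (l x)" "Suc N"] by auto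
  qed
  then have "HFM A \<in> level (Suc (Suc N))"
    by auto
  then show ?case ..
qed

lemma Union_level: "(\<Union>n. level n) = UNIV"
  using ex_level by blast

definition rank :: "hfm \<Rightarrow> nat" where
  "rank m = (LEAST n. m \<in> level (Suc n))"

definition hempty :: hfm where
  "hempty = HFM {#}"

definition hsing :: "hfm \<Rightarrow> hfm" where
  "hsing x = HFM {#x#}"

definition hplus :: "hfm \<Rightarrow> hfm \<Rightarrow> hfm" where
  "hplus x y = HFM (elems x + elems y)"

definition hmem1 :: "hfm \<Rightarrow> hfm \<Rightarrow> bool" where
  "hmem1 u v \<longleftrightarrow> (\<exists>w. v = hplus w (hsing u))"

lemma hmem1_iff: "hmem1 u v \<longleftrightarrow> u \<in># elems v"
proof
  assume "u \<in># elems v"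
  then have "v = hplus (HFM (elems v - {#u#})) (hsing u)"
    by (cases v) (simp add: hplus_def hsing_def)
  then show "hmem1 u v"
    unfolding hmem1_def ..
qed (auto simp: hmem1_def hplus_def hsing_def)

lemma hmem1_rank:
  assumes "hmem1 u v"
  shows "rank u < rank v"
proof -
  have "v \<in> level (Suc (rank v))"
    unfolding rank_def by (rule LeastI_ex) (rule ex_level)
  then have u: "u \<in> level (rank v)"
    using assms by (auto simp: hmem1_iff)
  then obtain k where k: "rank v = Suc k"
    by (cases "rank v") auto
  then have "rank u \<le> k"
    using u unfolding rank_def by (intro Least_le) simp
  then show ?thesis
    using k by simp
qed

context
  notes conj_cong [fundef_cong]
begin

function hsub :: "hfm \<Rightarrow> hfm \<Rightarrow> bool" where
  "hsub x t \<longleftrightarrow> x = t \<or> (\<exists>u. hmem1 u t \<and> hsub x u)"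
  by auto
termination
  by (relation "Wellfounded.measure (\<lambda>(x, t). rank t)") (auto simp: hmem1_rank)

end

declare hsub.simps [simp del]

datatype hfun = Empty | Sing | Uplus
datatype hrel = Sub

primrec hfun_arity :: "hfun \<Rightarrow> nat" where
  "hfun_arity Empty = 0"
| "hfun_arity Sing = 1"
| "hfun_arity Uplus = 2"

definition L_hfm :: "(hfun, hrel) lang" where
  "L_hfm = \<lparr>farity = hfun_arity, rarity = (\<lambda>_. 2)\<rparr>"

text \<open>The cases for a wrong number of arguments are immaterial.\<close>

fun hfun_int :: "hfun \<Rightarrow> hfm list \<Rightarrow> hfm" where
  "hfun_int Empty [] = hempty"
| "hfun_int Sing [x] = hsing x"
| "hfun_int Uplus [x, y] = hplus x y"
| "hfun_int _ _ = undefined"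

fun hrel_int :: "hrel \<Rightarrow> hfm list \<Rightarrow> bool" where
  "hrel_int Sub [x, y] = hsub x y"
| "hrel_int _ _ = undefined"

definition M_hfm :: "(hfm, hfun, hrel) struct" where
  "M_hfm = \<lparr>fint = hfun_int, rint = hrel_int\<rparr>"


section \<open>Normal forms of closed terms\<close>

text \<open>\<open>cterm\<close> is the type of closed terms of the language; see \<open>range_tm_of\<close> below.\<close>

datatype cterm = CEmpty | CSing cterm | CUplus cterm cterm

primrec tm_of :: "cterm \<Rightarrow> hfun tm" where
  "tm_of CEmpty = Fn Empty []"
| "tm_of (CSing t) = Fn Sing [tm_of t]"
| "tm_of (CUplus s t) = Fn Uplus [tm_of s, tm_of t]"

lemma range_tm_of: "range tm_of = {t. wf_tm L_hfm t \<and> fv_tm t = {}}"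
proof -
  have "wf_tm L_hfm (tm_of c) \<and> fv_tm (tm_of c) = {}" for c
    by (induction c) (auto simp: L_hfm_def)
  moreover have "wf_tm L_hfm t \<Longrightarrow> fv_tm t = {} \<Longrightarrow> t \<in> range tm_of" for t
  proof (induction t)
    case (Fn f ts)
    then have ts: "\<And>t. t \<in> set ts \<Longrightarrow> t \<in> range tm_of"
      by (auto simp: list_all_iff)
    show ?case
    proof (cases f)
      case Empty
      with Fn.prems have "Fn f ts = tm_of CEmpty"
        by (simp add: L_hfm_def)
      then show ?thesis by (metis rangeI)
    next
      case Sing
      with Fn.prems obtain t where "ts = [t]"
        by (auto simp: L_hfm_def length_Suc_conv)
      moreover from this obtain c where "t = tm_of c"
        using ts by auto
      ultimately have "Fn f ts = tm_of (CSing c)"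
        using Sing by simp
      then show ?thesis by (metis rangeI)
    next
      case Uplus
      with Fn.prems obtain s t where "ts = [s, t]"
        by (auto simp: L_hfm_def length_Suc_conv numeral_2_eq_2)
      moreover from this obtain c d where "s = tm_of c" "t = tm_of d"
        using ts[of s] ts[of t] by auto
      ultimately have "Fn f ts = tm_of (CUplus c d)"
        using Uplus by simp
      then show ?thesis by (metis rangeI)
    qed
  qed simp
  ultimately show ?thesis
    by blast
qed

datatype symb = LAngle | RAngle | UplusS | EmptyS

primrec str :: "cterm \<Rightarrow> symb list" where
  "str CEmpty = [EmptyS]"
| "str (CSing t) = LAngle # str t @ [RAngle]"
| "str (CUplus s t) = str s @ UplusS # str t"

text \<open>
  The order of the symbols is the one of an injective numbering \<open>rk\<close>.  Lists of natural numbers are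
  ordered length-lexicographically by \<open>List_Lenlexorder\<close>, so that \<open>s\<close> precedes \<open>t\<close> iff
  \<open>key rk s \<le> key rk t\<close>.
\<close>

definition key :: "(symb \<Rightarrow> nat) \<Rightarrow> cterm \<Rightarrow> nat list" where
  "key rk t = map rk (str t)"

text \<open>\<open>\<langle>t\<^sub>1\<rangle> \<uplus> (\<langle>t\<^sub>2\<rangle> \<uplus> (... \<uplus> \<langle>t\<^sub>k\<rangle>))\<close>, and the empty multiset if \<open>k = 0\<close>.\<close>

fun build :: "cterm list \<Rightarrow> cterm" where
  "build [] = CEmpty"
| "build [t] = CSing t"
| "build (t # ts) = CUplus (CSing t) (build ts)"

inductive normal :: "(symb \<Rightarrow> nat) \<Rightarrow> cterm \<Rightarrow> bool" for rk where
  "normal rk CEmpty"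
| "ts \<noteq> [] \<Longrightarrow> (\<And>t. t \<in> set ts \<Longrightarrow> normal rk t) \<Longrightarrow> sorted (map (key rk) ts) \<Longrightarrow> normal rk (build ts)"

text \<open>The arguments \<open>t\<close> of the factors \<open>\<langle>t\<rangle>\<close> of a union, without the empty factors.\<close>

primrec factors :: "cterm \<Rightarrow> cterm list" where
  "factors CEmpty = []"
| "factors (CSing t) = [t]"
| "factors (CUplus s t) = factors s @ factors t"

primrec nf :: "(symb \<Rightarrow> nat) \<Rightarrow> cterm \<Rightarrow> cterm" where
  "nf rk CEmpty = CEmpty"
| "nf rk (CSing t) = CSing (nf rk t)"
| "nf rk (CUplus s t) = build (sort_key (key rk) (factors (nf rk s) @ factors (nf rk t)))"

definition hull :: "(symb \<Rightarrow> nat) \<Rightarrow> cterm \<Rightarrow> cterm set" where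
  "hull rk t = {s. normal rk s \<and> models M_hfm (Rel Sub [tm_of s, tm_of t])}"


text \<open>Normal terms have unambiguous strings, are determined by their values, and hulls are finite.\<close>

lemma str_build_Cons:
  "str (build (t # ts)) =
     LAngle # str t @ RAngle # (if ts = [] then [] else UplusS # str (build ts))"
  by (cases ts) auto

lemma normal_str_append_eq:
  assumes "normal rk s" "normal rk s'" "str s @ z = str s' @ z'"
    and "z = [] \<or> hd z = RAngle" "z' = [] \<or> hd z' = RAngle"
  shows "s = s' \<and> z = z'"
  using assms
proof (induction arbitrary: s' z z' rule: normal.induct)
  case 1
  from \<open>normal rk s'\<close> show ?case
  proof cases
    case (2 ts)
    then show ?thesis using 1 by (cases ts) (auto simp: str_build_Cons)
  qed (use 1 in auto)
next
  case (2 ts)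
  have P: "a = b \<and> w = w'"
    if "a \<in> set ts" "normal rk b" "str a @ RAngle # w = str b @ RAngle # w'" for a b w w'
    using "2.IH"[OF that(1,2), of "RAngle # w" "RAngle # w'"] that(3) by simp
  from \<open>normal rk s'\<close> show ?case
  proof cases
    case 1
    then show ?thesis using 2 by (cases ts) (auto simp: str_build_Cons)
  next
    case (2 ts')
    have "us = us' \<and> z = z'"
      if "set us \<subseteq> set ts" "\<And>b. b \<in> set us' \<Longrightarrow> normal rk b" "us \<noteq> []" "us' \<noteq> []"
        "str (build us) @ z = str (build us') @ z'" for us us'
      using that
    proof (induction us arbitrary: us')
      case (Cons a us)
      then obtain b vs where us': "us' = b # vs"
        by (cases us') auto
      let ?r = "\<lambda>us z. if us = [] then z else UplusS # str (build us) @ z"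
      have "str a @ RAngle # ?r us z = str b @ RAngle # ?r vs z'"
        using Cons.prems(5) us' by (auto simp: str_build_Cons split: if_splits)
      then have *: "a = b" "?r us z = ?r vs z'"
        using P[of a b "?r us z" "?r vs z'"] Cons.prems us' by auto
      show ?case
      proof (cases "us = [] \<or> vs = []")
        case True
        then show ?thesis
          using * us' \<open>z = [] \<or> hd z = RAngle\<close> \<open>z' = [] \<or> hd z' = RAngle\<close>
          by (auto split: if_splits)
      next
        case False
        then show ?thesis
          using * us' Cons.IH[of vs] Cons.prems by auto
      qed
    qed simp
    from this[of ts ts'] show ?thesis
      using 2 "2.prems" "2.hyps" \<open>ts \<noteq> []\<close> by auto
  qed
qed

lemma inj_on_key:
  assumes "inj rk"
  shows "inj_on (key rk) (Collect (normal rk))"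
proof (rule inj_onI)
  fix s t assume "s \<in> Collect (normal rk)" "t \<in> Collect (normal rk)" "key rk s = key rk t"
  then show "s = t"
    using normal_str_append_eq[of rk s t "[]" "[]"] assms by (simp add: key_def)
qed

lemma factors_build [simp]: "factors (build ts) = ts"
  by (induction ts rule: build.induct) auto

lemma normal_factors: "normal rk t \<Longrightarrow> s \<in> set (factors t) \<Longrightarrow> normal rk s"
  by (induction rule: normal.induct) auto

lemma normal_nf: "normal rk (nf rk t)"
proof (induction t)
  case CEmpty
  show ?case by (simp add: normal.intros)
next
  case (CSing t)
  then show ?case using normal.intros(2)[of "[nf rk t]" rk] by simp
next
  case (CUplus s t)
  let ?ts = "sort_key (key rk) (factors (nf rk s) @ factors (nf rk t))"
  show ?case
  proof (cases "?ts = []")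
    case True
    then show ?thesis by (simp add: normal.intros)
  next
    case False
    then have "normal rk (build ?ts)"
      using CUplus by (intro normal.intros(2)) (auto dest: normal_factors)
    then show ?thesis by simp
  qed
qed

definition hval :: "cterm \<Rightarrow> hfm" where
  "hval t = eval_tm M_hfm (\<lambda>_. hempty) (tm_of t)"

lemma eval_tm_of: "eval_tm M_hfm e (tm_of t) = hval t"
  by (induction t) (auto simp: M_hfm_def hval_def)

lemma hval_simps [simp]:
  "hval CEmpty = hempty" "hval (CSing t) = hsing (hval t)"
  "hval (CUplus s t) = hplus (hval s) (hval t)"
  by (auto simp: M_hfm_def hval_def)

lemma hval_build: "hval (build ts) = HFM (mset (map hval ts))"
  by (induction ts rule: build.induct) (auto simp: hempty_def hsing_def hplus_def)

lemma normal_hval_eq: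
  assumes "inj rk" "normal rk s" "normal rk s'" "hval s = hval s'"
  shows "s = s'"
  using assms(2-)
proof (induction arbitrary: s' rule: normal.induct)
  case 1
  from \<open>normal rk s'\<close> show ?case
    by cases (use 1 in \<open>auto simp: hval_build hempty_def\<close>)
next
  case (2 ts)
  from \<open>normal rk s'\<close> show ?case
  proof cases
    case 1
    then show ?thesis
      using 2 by (auto simp: hval_build hempty_def)
  next
    case (2 ts')
    have eq: "image_mset hval (mset ts) = image_mset hval (mset ts')"
      using \<open>hval (build ts) = hval s'\<close> 2 by (simp add: hval_build)
    then have im: "hval ` set ts = hval ` set ts'"
      by (metis set_image_mset set_mset_mset)
    have inj: "a = b" if "a \<in> set ts" "normal rk b" "hval a = hval b" for a b
      using "2.IH" that by blast
    define g where "g = inv_into (set ts) hval"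
    have g: "g (hval a) = a" if "a \<in> set ts" for a
      unfolding g_def using that inj "2.hyps" by (intro inv_into_f_f inj_onI) auto
    have sub: "set ts' \<subseteq> set ts"
    proof
      fix b assume b: "b \<in> set ts'"
      then obtain a where "a \<in> set ts" "hval a = hval b"
        using im by (metis imageE imageI)
      then show "b \<in> set ts" using inj b 2 by metis
    qed
    have "mset ts = image_mset g (image_mset hval (mset ts))"
      using g by (auto simp: multiset.map_comp intro!: multiset.map_ident_strong[symmetric])
    also have "\<dots> = image_mset g (image_mset hval (mset ts'))"
      by (simp only: eq)
    also have "\<dots> = mset ts'"
      using g sub by (auto simp: multiset.map_comp intro!: multiset.map_ident_strong)
    finally have "mset ts = mset ts'" .
    then have "map (key rk) ts = map (key rk) ts'"
      using 2 "2.hyps" by (metis mset_map properties_for_sort)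
    moreover have "set ts \<union> set ts' \<subseteq> Collect (normal rk)"
      using 2 "2.hyps" by auto
    ultimately have "ts = ts'"
      using inj_on_key[OF \<open>inj rk\<close>] by (metis inj_on_subset map_inj_on)
    then show ?thesis using 2 by simp
  qed
qed

lemma finite_hsub: "finite {x. hsub x t}"
proof (induction t rule: measure_induct_rule[where f = rank])
  case (less t)
  have "{x. hsub x t} = insert t (\<Union>u\<in>set_mset (elems t). {x. hsub x u})"
    by (subst hsub.simps) (auto simp: hmem1_iff)
  then show ?case
    using less by (auto simp: hmem1_iff hmem1_rank)
qed

lemma hull_altdef: "hull rk t = {s. normal rk s \<and> hsub (hval s) (hval t)}"
  by (simp add: hull_def models_def eval_tm_of M_hfm_def[THEN arg_cong[where f = rint]])

lemma finite_hull:
  assumes "inj rk"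
  shows "finite (hull rk t)"
proof (rule inj_on_finite[where f = hval])
  show "inj_on hval (hull rk t)"
    using normal_hval_eq[OF assms] by (auto simp: inj_on_def hull_altdef)
  show "hval ` hull rk t \<subseteq> {x. hsub x (hval t)}"
    by (auto simp: hull_altdef)
qed (rule finite_hsub)

lemma set_hull_list:
  assumes "inj rk"
  shows "set (sorted_key_list_of_set (key rk) (hull rk t)) = hull rk t"
proof -
  interpret H: folding_insort_key "(\<le>)" "(<)" "Collect (normal rk)" "key rk"
    by unfold_locales (rule inj_on_key[OF assms])
  have "hull rk t \<subseteq> Collect (normal rk)"
    by (auto simp: hull_altdef)
  note set_eq = H.set_sorted_key_list_of_set[OF this finite_hull[OF assms]]
  note lin = linorder_class.linorder_axioms
  have "linorder.insort_key (\<le>) f x xs = insort_key f x xs" for f :: "cterm \<Rightarrow> nat list" and x xs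
    by (induction xs) (simp_all add: linorder.insort_key.simps[OF lin])
  then have "linorder.insort_key (\<le>) f = insort_key f" for f :: "cterm \<Rightarrow> nat list"
    by blast
  with set_eq show ?thesis
    by (simp add: sorted_key_list_of_set_def linorder.sorted_key_list_of_set_def[OF lin])
qed


section \<open>The two theories\<close>

text \<open>The disjunction in \<open>W2\<close> lists the hull in length-lexicographic order.\<close>

definition F1 :: "(hfun, hrel) fm" where
  "F1 = AllN 3 (Eq (Fn Uplus [Fn Uplus [Var 2, Var 1], Var 0])
                   (Fn Uplus [Var 2, Fn Uplus [Var 1, Var 0]]))"

definition F2 :: "(hfun, hrel) fm" where
  "F2 = AllN 2 (Eq (Fn Uplus [Var 1, Var 0]) (Fn Uplus [Var 0, Var 1]))"

definition F3 :: "(hfun, hrel) fm" where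
  "F3 = All (Eq (Fn Uplus [Var 0, Fn Empty []]) (Var 0))"

definition W1 :: "cterm \<Rightarrow> cterm \<Rightarrow> (hfun, hrel) fm" where
  "W1 s t = Neg (Eq (tm_of s) (tm_of t))"

definition W2 :: "(symb \<Rightarrow> nat) \<Rightarrow> cterm \<Rightarrow> (hfun, hrel) fm" where
  "W2 rk t = All (Iff (Rel Sub [Var 0, tm_of t])
     (Disj (map (\<lambda>s. Eq (Var 0) (tm_of s)) (sorted_key_list_of_set (key rk) (hull rk t)))))"

definition WF_minus :: "(symb \<Rightarrow> nat) \<Rightarrow> (hfun, hrel) fm set" where
  "WF_minus rk = {F1, F2, F3} \<union> {W1 s t | s t. nf rk s \<noteq> nf rk t} \<union> range (W2 rk)"

datatype rfun = Zero | Succ | Plus | Times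
datatype rrel = Leq

primrec rfun_arity :: "rfun \<Rightarrow> nat" where
  "rfun_arity Zero = 0"
| "rfun_arity Succ = 1"
| "rfun_arity Plus = 2"
| "rfun_arity Times = 2"

definition L_R :: "(rfun, rrel) lang" where
  "L_R = \<lparr>farity = rfun_arity, rarity = (\<lambda>_. 2)\<rparr>"

primrec num :: "nat \<Rightarrow> rfun tm" where
  "num 0 = Fn Zero []"
| "num (Suc n) = Fn Succ [num n]"

definition theory_R :: "(rfun, rrel) fm set" where
  "theory_R =
     {Eq (Fn Plus [num n, num m]) (num (n + m)) | n m. True} \<union>
     {Eq (Fn Times [num n, num m]) (num (n * m)) | n m. True} \<union>
     {Neg (Eq (num n) (num m)) | n m. n \<noteq> m} \<union>
     {All (Iff (Rel Leq [Var 0, num n]) (Disj (map (\<lambda>i. Eq (Var 0) (num i)) [0..<Suc n]))) | n. True} \<union>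
     {All (Or (Rel Leq [Var 0, num n]) (Rel Leq [num n, Var 0])) | n. True}"

lemma tm_of_closed: "wf_tm L_hfm (tm_of t)" "fv_tm (tm_of t) = {}"
  using range_tm_of by blast+

lemma Disj_closure:
  "wf_fm L (Disj ps) \<longleftrightarrow> (\<forall>p\<in>set ps. wf_fm L p)" "fv_fm (Disj ps) = (\<Union>p\<in>set ps. fv_fm p)"
  by (induction ps) (auto simp: Disj_def)

lemma is_theory_WF_minus: "is_theory L_hfm (WF_minus rk)"
  by (auto simp: is_theory_def WF_minus_def F1_def F2_def F3_def W1_def W2_def AllN_def
      numeral_2_eq_2 numeral_3_eq_3 Disj_closure tm_of_closed)
    (auto simp: L_hfm_def split: if_splits)

lemma num_closed: "wf_tm L_R (num n)" "fv_tm (num n) = {}"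
  by (induction n) (auto simp: L_R_def)

lemma is_theory_R: "is_theory L_R theory_R"
  by (auto simp: is_theory_def theory_R_def Disj_closure num_closed)
    (auto simp: L_R_def split: if_splits)

end

theory Submission
  imports Defs "HOL-Library.Countable" "HOL-Computational_Algebra.Primes"
begin

text \<open>
  By the completeness theorem it suffices to check the translated axioms in every model of the
  interpreting theory, and functions may be made total by a default value wherever their graph does
  not define a unique value.

  A multiset is interpreted in arithmetic as the product of the Fermat numbers \<open>2^2^x + 1\<close> of the
  codes \<open>x\<close> of its elements.  Fermat numbers are pairwise coprime, so this is injective and turns
  multiset union into multiplication.  To make the latter a commutative monoid in every model
  of \<open>R\<close>, the domain is cut down to a definable initial segment on which multiplication behaves well,
  and products that leave it are replaced by the absorbing element \<open>0\<close>.  Singletons and the order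
  are only constrained at standard arguments; they are defined there by coded finite sets that are
  closed under the backward steps of a recursion.  As each step determines its predecessor up to
  finitely many standard numbers, even a nonstandard code yields the right value.

  Conversely, numbers are interpreted as iterated singletons, whose subterm order is the order of the
  numbers; addition and multiplication are defined by multisets of triples in the same way.
\<close>


section \<open>Completeness\<close>

text \<open>The obstacle is the nonstandard elements of models: each axiom that quantifies over the
  whole domain needs its own device. F1 to F3 must hold for products about which R is silent, and
  the standard numbers need not be definable; hence the laws are asked of the domain in a form that
  every numeral satisfies. In W2 the quantified variable is compared with a closed term, so it
  suffices to demand that it lies below a standard code, which leaves only numerals. In the other
  direction the comparability axiom of R has to hold at nonstandard elements, and the domain is
  chosen so that induction on the numeral, outside the theory, proves it.

  Fermat numbers are convenient because the towers below them arise by squaring alone, a recursion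
  that R can follow step by step at numerals. The empty multiset gets the empty product 1 and no
  multiset gets 0, so 0 is free as overflow value.\<close>

lemma subst_tm_cong: "(\<And>x. x \<in> fv_tm t \<Longrightarrow> \<sigma> x = \<rho> x) \<Longrightarrow> subst_tm \<sigma> t = subst_tm \<rho> t"
  by (induction t) auto

lemma subst_fm_cong: "(\<And>x. x \<in> fv_fm p \<Longrightarrow> \<sigma> x = \<rho> x) \<Longrightarrow> subst_fm \<sigma> p = subst_fm \<rho> p"
proof (induction p arbitrary: \<sigma> \<rho>)
  case (All p)
  have "subst_fm (up \<sigma>) p = subst_fm (up \<rho>) p"
    by (rule All.IH) (use All.prems in \<open>auto simp: up_def split: nat.split\<close>)
  then show ?case by simp
next
  case (Imp p q)
  then show ?case by (metis UnCI fv_fm.simps(4) subst_fm.simps(4))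
qed (auto intro!: subst_tm_cong)

lemma subst_tm_Var [simp]: "subst_tm Var t = t"
  by (induction t) (auto simp: map_idI)

lemma up_Var [simp]: "up Var = Var"
  by (auto simp: up_def fun_eq_iff split: nat.split)

lemma subst_fm_Var [simp]: "subst_fm Var p = p"
  by (induction p) (auto simp: map_idI)

lemma subst_tm_comp: "subst_tm \<sigma> (subst_tm \<rho> t) = subst_tm (\<lambda>x. subst_tm \<sigma> (\<rho> x)) t"
  by (induction t) auto

lemma up_comp: "(\<lambda>x. subst_tm (up \<sigma>) (up \<rho> x)) = up (\<lambda>x. subst_tm \<sigma> (\<rho> x))"
  by (auto simp: up_def fun_eq_iff subst_tm_comp split: nat.split)

lemma subst_fm_comp: "subst_fm \<sigma> (subst_fm \<rho> p) = subst_fm (\<lambda>x. subst_tm \<sigma> (\<rho> x)) p"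
  by (induction p arbitrary: \<sigma> \<rho>) (auto simp: subst_tm_comp up_comp)

lemma wf_subst_tm: "wf_tm L t \<Longrightarrow> (\<And>x. wf_tm L (\<sigma> x)) \<Longrightarrow> wf_tm L (subst_tm \<sigma> t)"
  by (induction t) (auto simp: list_all_iff)

lemma wf_up: "(\<And>x. wf_tm L (\<sigma> x)) \<Longrightarrow> wf_tm L (up \<sigma> x)"
  by (auto simp: up_def wf_subst_tm split: nat.split)

lemma wf_subst_fm: "wf_fm L p \<Longrightarrow> (\<And>x. wf_tm L (\<sigma> x)) \<Longrightarrow> wf_fm L (subst_fm \<sigma> p)"
  by (induction p arbitrary: \<sigma>) (auto simp: wf_subst_tm wf_up list_all_iff)

lemma wf_inst_fm: "wf_fm L p \<Longrightarrow> wf_tm L t \<Longrightarrow> wf_fm L (inst_fm t p)"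
  by (auto simp: inst_fm_def intro!: wf_subst_fm split: nat.split)

lemma wf_app_fm: "wf_fm L p \<Longrightarrow> (\<And>t. t \<in> set ts \<Longrightarrow> wf_tm L t) \<Longrightarrow> wf_fm L (app_fm p ts)"
  by (auto simp: app_fm_def intro!: wf_subst_fm)

lemma subst_inst_fm: "subst_fm \<sigma> (inst_fm t p) = inst_fm (subst_tm \<sigma> t) (subst_fm (up \<sigma>) p)"
  by (auto simp: inst_fm_def subst_fm_comp subst_tm_comp up_def intro!: subst_fm_cong split: nat.split)

lemma subst_up_lift_fm: "subst_fm (up \<sigma>) (lift_fm p) = lift_fm (subst_fm \<sigma> p)"
  by (auto simp: lift_fm_def subst_fm_comp up_def)

lemma inst_subst_up: "inst_fm t (subst_fm (up \<sigma>) p) = subst_fm (case_nat t \<sigma>) p"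
  by (auto simp: inst_fm_def subst_fm_comp subst_tm_comp up_def intro!: subst_fm_cong split: nat.split)

section \<open>Structural properties of the calculus\<close>

lemma deriv_wf: "deriv L \<Gamma> p \<Longrightarrow> wf_fm L p"
  by (induction rule: deriv.induct) (auto simp: wf_inst_fm)

lemma deriv_mono: "deriv L \<Gamma> p \<Longrightarrow> \<Gamma> \<subseteq> \<Delta> \<Longrightarrow> deriv L \<Delta> p"
proof (induction arbitrary: \<Delta> rule: deriv.induct)
  case (imp_intro p \<Gamma> q)
  then show ?case by (meson deriv.imp_intro insert_mono)
next
  case (classical p \<Gamma>)
  then show ?case by (meson deriv.classical insert_mono)
next
  case (all_intro \<Gamma> p)
  then show ?case by (meson deriv.all_intro image_mono)
next
  case (imp_elim \<Gamma> p q)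
  then show ?case by (meson deriv.imp_elim)
next
  case (all_elim \<Gamma> p t)
  then show ?case by (meson deriv.all_elim)
next
  case (eq_subst p \<Gamma> s t)
  then show ?case by (meson deriv.eq_subst)
qed (auto intro: deriv.assm deriv.eq_refl)

lemma deriv_subst:
  "deriv L \<Gamma> p \<Longrightarrow> (\<And>x. wf_tm L (\<sigma> x)) \<Longrightarrow> deriv L (subst_fm \<sigma> ` \<Gamma>) (subst_fm \<sigma> p)"
proof (induction arbitrary: \<sigma> rule: deriv.induct)
  case (all_intro \<Gamma> p)
  have "subst_fm (up \<sigma>) ` lift_fm ` \<Gamma> = lift_fm ` subst_fm \<sigma> ` \<Gamma>"
    by (simp add: image_image subst_up_lift_fm)
  with all_intro.IH[of "up \<sigma>"] all_intro.prems show ?case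
    by (auto intro!: deriv.all_intro wf_up)
next
  case (all_elim \<Gamma> p t)
  then have "deriv L (subst_fm \<sigma> ` \<Gamma>) (All (subst_fm (up \<sigma>) p))" by simp
  then show ?case
    unfolding subst_inst_fm by (rule deriv.all_elim) (use all_elim in \<open>auto intro: wf_subst_tm\<close>)
next
  case (eq_subst p \<Gamma> s t)
  have "deriv L (subst_fm \<sigma> ` \<Gamma>) (Eq (subst_tm \<sigma> s) (subst_tm \<sigma> t))"
    using eq_subst.IH(1)[of \<sigma>] eq_subst.prems by simp
  moreover have "deriv L (subst_fm \<sigma> ` \<Gamma>) (inst_fm (subst_tm \<sigma> s) (subst_fm (up \<sigma>) p))"
    using eq_subst.IH(2)[of \<sigma>] eq_subst.prems by (simp add: subst_inst_fm)
  ultimately show ?case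
    unfolding subst_inst_fm
    by (rule deriv.eq_subst[rotated]) (intro wf_subst_fm wf_up eq_subst)
next
  case (imp_elim \<Gamma> p q)
  then show ?case by (metis deriv.imp_elim subst_fm.simps(4))
next
  case (imp_intro p \<Gamma> q)
  then show ?case by (auto intro!: deriv.imp_intro wf_subst_fm)
next
  case (classical p \<Gamma>)
  then have "deriv L (insert (Neg (subst_fm \<sigma> p)) (subst_fm \<sigma> ` \<Gamma>)) Bot" by simp
  with classical show ?case by (metis deriv.classical wf_subst_fm)
qed (auto intro: deriv.assm deriv.eq_refl wf_subst_fm wf_subst_tm)

text \<open>Needed to pull a contradiction from the limit of the Henkin construction back to a
  single stage.\<close>

lemma deriv_finite: "deriv L \<Gamma> p \<Longrightarrow> \<exists>\<Delta>. finite \<Delta> \<and> \<Delta> \<subseteq> \<Gamma> \<and> deriv L \<Delta> p"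
proof (induction rule: deriv.induct)
  case (assm p \<Gamma>)
  then show ?case by (intro exI[of _ "{p}"]) (auto intro: deriv.assm)
next
  case (imp_intro p \<Gamma> q)
  then obtain \<Delta> where "finite \<Delta>" "\<Delta> \<subseteq> insert p \<Gamma>" "deriv L \<Delta> q" by blast
  moreover from this(3) have "deriv L (insert p (\<Delta> - {p})) q"
    by (rule deriv_mono) auto
  ultimately show ?case using imp_intro.hyps
    by (intro exI[of _ "\<Delta> - {p}"] conjI deriv.imp_intro) auto
next
  case (imp_elim \<Gamma> p q)
  then obtain \<Delta> \<Delta>' where "finite \<Delta>" "\<Delta> \<subseteq> \<Gamma>" "deriv L \<Delta> (Imp p q)"
    "finite \<Delta>'" "\<Delta>' \<subseteq> \<Gamma>" "deriv L \<Delta>' p" by blast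
  moreover from this have "deriv L (\<Delta> \<union> \<Delta>') q"
    by (meson deriv.imp_elim deriv_mono Un_upper1 Un_upper2)
  ultimately show ?case
    by (intro exI[of _ "\<Delta> \<union> \<Delta>'"]) auto
next
  case (classical p \<Gamma>)
  then obtain \<Delta> where "finite \<Delta>" "\<Delta> \<subseteq> insert (Neg p) \<Gamma>" "deriv L \<Delta> Bot" by blast
  moreover from this(3) have "deriv L (insert (Neg p) (\<Delta> - {Neg p})) Bot"
    by (rule deriv_mono) auto
  ultimately show ?case using deriv.classical[OF classical.hyps(1)]
    by (intro exI[of _ "\<Delta> - {Neg p}"]) auto
next
  case (all_intro \<Gamma> p)
  then obtain \<Delta> where "finite \<Delta>" "\<Delta> \<subseteq> lift_fm ` \<Gamma>" "deriv L \<Delta> p" by blast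
  then show ?case by (metis deriv.all_intro finite_subset_image)
next
  case (all_elim \<Gamma> p t)
  then show ?case by (meson deriv.all_elim)
next
  case (eq_refl t \<Gamma>)
  then show ?case by (intro exI[of _ "{}"]) (auto intro: deriv.eq_refl)
next
  case (eq_subst p \<Gamma> s t)
  then obtain \<Delta> \<Delta>' where "finite \<Delta>" "\<Delta> \<subseteq> \<Gamma>" "deriv L \<Delta> (Eq s t)"
    "finite \<Delta>'" "\<Delta>' \<subseteq> \<Gamma>" "deriv L \<Delta>' (inst_fm s p)" by blast
  moreover from this have "deriv L (\<Delta> \<union> \<Delta>') (inst_fm t p)"
    using eq_subst.hyps(1) by (meson deriv.eq_subst deriv_mono Un_upper1 Un_upper2)
  ultimately show ?case
    by (intro exI[of _ "\<Delta> \<union> \<Delta>'"]) auto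
qed

lemma finite_fv_tm: "finite (fv_tm t)"
  by (induction t) auto

lemma finite_fv_fm: "finite (fv_fm p)"
proof (induction p)
  case (All p)
  have "{x. Suc x \<in> fv_fm p} = Suc -` fv_fm p" by auto
  then show ?case using All by (simp add: finite_vimageI)
qed (auto simp: finite_fv_tm)

instance tm :: (countable) countable
  by countable_datatype

instance fm :: (countable, countable) countable
  by countable_datatype

lemma deriv_generalize:
  assumes "deriv L \<Gamma> (inst_fm (Var k) q)" "\<And>p. p \<in> \<Gamma> \<Longrightarrow> k \<notin> fv_fm p" "k \<notin> fv_fm (All q)"
  shows "deriv L \<Gamma> (All q)"
proof -
  define \<sigma> :: "nat \<Rightarrow> 'a tm" where "\<sigma> = (\<lambda>x. if x = k then Var 0 else Var (Suc x))"
  have "deriv L (subst_fm \<sigma> ` \<Gamma>) (subst_fm \<sigma> (inst_fm (Var k) q))"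
    by (intro deriv_subst assms(1)) (auto simp: \<sigma>_def)
  moreover have "subst_fm \<sigma> ` \<Gamma> = lift_fm ` \<Gamma>"
    unfolding lift_fm_def
    by (intro image_cong refl subst_fm_cong) (use assms(2) in \<open>auto simp: \<sigma>_def\<close>)
  moreover have "subst_fm \<sigma> (inst_fm (Var k) q) = subst_fm Var q"
    unfolding inst_fm_def subst_fm_comp
    by (intro subst_fm_cong) (use assms(3) in \<open>auto simp: \<sigma>_def split: nat.split\<close>)
  ultimately show ?thesis
    by (auto intro: deriv.all_intro)
qed

lemma deriv_Neg_elim: "deriv L \<Gamma> (Neg p) \<Longrightarrow> deriv L \<Gamma> p \<Longrightarrow> deriv L \<Gamma> Bot"
  by (rule deriv.imp_elim)

lemma consistent_witness:
  assumes "\<not> deriv L \<Gamma> Bot" "Neg (All q) \<in> \<Gamma>" "wf_fm L q" "\<And>p. p \<in> \<Gamma> \<Longrightarrow> k \<notin> fv_fm p"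
  shows "\<not> deriv L (insert (Neg (inst_fm (Var k) q)) \<Gamma>) Bot"
proof
  assume "deriv L (insert (Neg (inst_fm (Var k) q)) \<Gamma>) Bot"
  then have "deriv L \<Gamma> (inst_fm (Var k) q)"
    by (rule deriv.classical[rotated]) (simp add: wf_inst_fm assms(3))
  then have "deriv L \<Gamma> (All q)"
    by (rule deriv_generalize) (use assms(4) assms(4)[OF assms(2)] in auto)
  moreover have "deriv L \<Gamma> (Neg (All q))"
    using assms by (intro deriv.assm) auto
  ultimately show False
    using assms(1) deriv_Neg_elim by blast
qed

section \<open>Henkin extensions\<close>

definition fresh :: "('f, 'r) fm set \<Rightarrow> nat" where
  "fresh \<Gamma> = (SOME k. \<forall>p\<in>\<Gamma>. k \<notin> fv_fm p)"

lemma fresh: "finite \<Gamma> \<Longrightarrow> p \<in> \<Gamma> \<Longrightarrow> fresh \<Gamma> \<notin> fv_fm p"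
proof -
  assume "finite \<Gamma>" "p \<in> \<Gamma>"
  then have "finite (\<Union>p\<in>\<Gamma>. fv_fm p)"
    by (simp add: finite_fv_fm)
  then obtain k where "k \<notin> (\<Union>p\<in>\<Gamma>. fv_fm p)"
    using ex_new_if_finite infinite_UNIV_nat by blast
  then have "\<forall>p\<in>\<Gamma>. fresh \<Gamma> \<notin> fv_fm p"
    unfolding fresh_def by (intro someI[of "\<lambda>k. \<forall>p\<in>\<Gamma>. k \<notin> fv_fm p" k]) auto
  then show ?thesis
    using \<open>p \<in> \<Gamma>\<close> by blast
qed

definition henkin_step ::
    "('f, 'r) lang \<Rightarrow> ('f, 'r) fm set \<Rightarrow> ('f, 'r) fm \<Rightarrow> ('f, 'r) fm set \<Rightarrow> ('f, 'r) fm set" where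
  "henkin_step L T p G =
     (if wf_fm L p \<and> \<not> deriv L (insert p (T \<union> G)) Bot
      then {Neg (inst_fm (Var (fresh (insert p G))) q) | q. p = Neg (All q)} \<union> insert p G else G)"

primrec henkin_seq ::
    "('f::countable, 'r::countable) lang \<Rightarrow> ('f, 'r) fm set \<Rightarrow> ('f, 'r) fm set \<Rightarrow> nat \<Rightarrow> ('f, 'r) fm set" where
  "henkin_seq L T G 0 = G"
| "henkin_seq L T G (Suc n) = henkin_step L T (from_nat n) (henkin_seq L T G n)"

lemma henkin_step_consistent:
  assumes "is_theory L T" "finite G" "\<not> deriv L (T \<union> G) Bot"
  shows "finite (henkin_step L T p G) \<and> \<not> deriv L (T \<union> henkin_step L T p G) Bot"
proof (cases "wf_fm L p \<and> \<not> deriv L (insert p (T \<union> G)) Bot")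
  case True
  show ?thesis
  proof (cases "\<exists>q. p = Neg (All q)")
    case q: True
    then obtain q where q: "p = Neg (All q)" by blast
    let ?k = "fresh (insert p G)"
    have eq: "henkin_step L T p G = insert (Neg (inst_fm (Var ?k) q)) (insert p G)"
      using True q by (auto simp: henkin_step_def)
    have "\<not> deriv L (insert (Neg (inst_fm (Var ?k) q)) (insert p (T \<union> G))) Bot"
    proof (rule consistent_witness)
      fix r assume "r \<in> insert p (T \<union> G)"
      then consider "r \<in> T" | "r \<in> insert p G" by blast
      then show "?k \<notin> fv_fm r"
        using assms fresh[of "insert p G" r] by cases (auto simp: is_theory_def)
    qed (use True q in auto)
    then show ?thesis
      using assms by (simp add: eq)
  next
    case False
    then have "henkin_step L T p G = insert p G"
      using True by (auto simp: henkin_step_def)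
    then show ?thesis using True assms by auto
  qed
next
  case False
  then have "henkin_step L T p G = G" by (auto simp: henkin_step_def)
  then show ?thesis using assms by simp
qed

text \<open>Since the theory consists of sentences, the variables themselves serve as Henkin constants.\<close>

locale henkin =
  fixes L :: "('f, 'r) lang" and H :: "('f, 'r) fm set"
  assumes consistent: "\<not> deriv L H Bot"
    and complete: "wf_fm L p \<Longrightarrow> p \<in> H \<or> deriv L (insert p H) Bot"
    and witness: "wf_fm L q \<Longrightarrow> Neg (All q) \<in> H \<Longrightarrow> \<exists>k. Neg (inst_fm (Var k) q) \<in> H"

lemma henkin_extension:
  fixes L :: "('f::countable, 'r::countable) lang"
  assumes "is_theory L T" "finite G" "\<not> deriv L (T \<union> G) Bot"
  shows "\<exists>H. T \<union> G \<subseteq> H \<and> henkin L H"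
proof -
  let ?G = "henkin_seq L T G"
  define H where "H = (\<Union>n. T \<union> ?G n)"
  have cons: "finite (?G n) \<and> \<not> deriv L (T \<union> ?G n) Bot" for n
    using assms by (induction n) (auto simp: henkin_step_consistent)
  have "?G n \<subseteq> ?G (Suc n)" for n
    by (auto simp: henkin_step_def)
  then have mono: "?G m \<subseteq> ?G n" if "m \<le> n" for m n
    using that by (rule lift_Suc_mono_le)
  \<comment> \<open>The stages increase, so a finite subset of \<open>H\<close> lies in one of them;
    with \<open>deriv_finite\<close> this transfers consistency to the union.\<close>
  have fin: "\<exists>n. \<Delta> \<subseteq> T \<union> ?G n" if "finite \<Delta>" "\<Delta> \<subseteq> H" for \<Delta>
    using that
  proof (induction \<Delta>)
    case (insert p \<Delta>)
    then obtain m n where "\<Delta> \<subseteq> T \<union> ?G m" "p \<in> T \<union> ?G n"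
      by (auto simp: H_def)
    then have "insert p \<Delta> \<subseteq> T \<union> ?G (max m n)"
      using mono[of m "max m n"] mono[of n "max m n"] by auto
    then show ?case ..
  qed simp
  have cons_H: "\<not> deriv L H Bot"
  proof
    assume "deriv L H Bot"
    from deriv_finite[OF this]
    obtain \<Delta> where \<Delta>: "finite \<Delta>" "\<Delta> \<subseteq> H" "deriv L \<Delta> Bot" by blast
    obtain n where "\<Delta> \<subseteq> T \<union> ?G n"
      using fin[OF \<Delta>(1,2)] by blast
    from deriv_mono[OF \<Delta>(3) this] show False using cons by simp
  qed
  have "henkin L H"
  proof
    show "\<not> deriv L H Bot" by (fact cons_H)
  next
    fix p assume p: "wf_fm L p"
    show "p \<in> H \<or> deriv L (insert p H) Bot"
    proof (cases "deriv L (insert p (T \<union> ?G (to_nat p))) Bot")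
      case True
      then have "deriv L (insert p H) Bot"
        by (rule deriv_mono) (auto simp: H_def)
      then show ?thesis ..
    next
      case False
      then have "p \<in> ?G (Suc (to_nat p))"
        using p by (auto simp: henkin_step_def)
      then show ?thesis unfolding H_def by blast
    qed
  next
    fix q assume q: "wf_fm L q" "Neg (All q) \<in> H"
    let ?p = "Neg (All q)"
    \<comment> \<open>\<open>?p\<close> may have entered \<open>H\<close> through \<open>T\<close>
      or \<open>G\<close>, without a witness. Being in the consistent \<open>H\<close>, it still
      passes the test at its own stage, which supplies one.\<close>
    have "\<not> deriv L (insert ?p (T \<union> ?G (to_nat ?p))) Bot"
    proof
      assume "deriv L (insert ?p (T \<union> ?G (to_nat ?p))) Bot"
      then have "deriv L H Bot"
        by (rule deriv_mono) (use q in \<open>auto simp: H_def\<close>)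
      then show False using cons_H by blast
    qed
    moreover have "?G (Suc (to_nat ?p)) = henkin_step L T ?p (?G (to_nat ?p))"
      by (simp del: of_nat_Suc)
    ultimately have "Neg (inst_fm (Var (fresh (insert ?p (?G (to_nat ?p))))) q) \<in> ?G (Suc (to_nat ?p))"
      using q(1) unfolding henkin_step_def by simp
    then show "\<exists>k. Neg (inst_fm (Var k) q) \<in> H"
      unfolding H_def by blast
  qed
  moreover have "T \<union> G \<subseteq> H"
    unfolding H_def by (metis UNIV_I UN_upper henkin_seq.simps(1))
  ultimately show ?thesis by blast
qed

text \<open>\<open>sat\<close> quantifies over a whole type, whereas the carrier of the term model
  and the domain of an interpretation are only sets in a type.\<close>

primrec rsat :: "'a set \<Rightarrow> ('a, 'f, 'r) struct \<Rightarrow> (nat \<Rightarrow> 'a) \<Rightarrow> ('f, 'r) fm \<Rightarrow> bool" where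
  "rsat D M e Bot \<longleftrightarrow> False"
| "rsat D M e (Eq s t) \<longleftrightarrow> eval_tm M e s = eval_tm M e t"
| "rsat D M e (Rel r ts) \<longleftrightarrow> rint M r (map (eval_tm M e) ts)"
| "rsat D M e (Imp p q) \<longleftrightarrow> (rsat D M e p \<longrightarrow> rsat D M e q)"
| "rsat D M e (All p) \<longleftrightarrow> (\<forall>a\<in>D. rsat D M (case_nat a e) p)"

definition is_model ::
    "('f, 'r) lang \<Rightarrow> ('f, 'r) fm set \<Rightarrow> 'a set \<Rightarrow> ('a, 'f, 'r) struct \<Rightarrow> bool" where
  "is_model L T D M \<longleftrightarrow>
     D \<noteq> {} \<and>
     (\<forall>f as. length as = farity L f \<and> set as \<subseteq> D \<longrightarrow> fint M f as \<in> D) \<and>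
     (\<forall>p\<in>T. \<forall>e. range e \<subseteq> D \<longrightarrow> rsat D M e p)"

lemma inst_lift_tm [simp]: "subst_tm (case_nat t Var) (subst_tm (\<lambda>x. Var (Suc x)) s) = s"
  by (simp add: subst_tm_comp)

text \<open>Reduces congruence of a symbol in all its arguments to replacement in one place;
  \<open>us\<close> collects the entries already replaced.\<close>

lemma list_all2_replace:
  assumes "list_all2 R ss ts" "P (us @ ss)"
    and "\<And>us s t vs. R s t \<Longrightarrow> P (us @ s # vs) \<Longrightarrow> P (us @ t # vs)"
  shows "P (us @ ts)"
  using assms(1,2)
proof (induction arbitrary: us rule: list_all2_induct)
  case (Cons s ss t ts)
  then have "P ((us @ [t]) @ ss)"
    using assms(3)[of s t us ss] by simp
  then show ?case using Cons.IH[of "us @ [t]"] by simp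
qed simp

context henkin
begin

section \<open>Closure properties of Henkin sets\<close>

lemma in_H: "deriv L H p \<Longrightarrow> p \<in> H"
proof -
  assume p: "deriv L H p"
  have "\<not> deriv L (insert p H) Bot"
    using deriv.imp_elim[OF deriv.imp_intro p] consistent deriv_wf[OF p] by blast
  then show ?thesis
    using complete[OF deriv_wf[OF p]] by blast
qed

lemma deriv_H: "p \<in> H \<Longrightarrow> wf_fm L p \<Longrightarrow> deriv L H p"
  by (rule deriv.assm)

lemma Bot_notin: "Bot \<notin> H"
  using consistent deriv_H[of Bot] by auto

lemma Imp_iff:
  assumes "wf_fm L p" "wf_fm L q"
  shows "Imp p q \<in> H \<longleftrightarrow> (p \<in> H \<longrightarrow> q \<in> H)"
proof
  assume "Imp p q \<in> H"
  then have "deriv L H (Imp p q)"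
    by (rule deriv_H) (use assms in simp)
  then show "p \<in> H \<longrightarrow> q \<in> H"
    using deriv.imp_elim[of L H p q] deriv_H[of p] assms(1) in_H[of q] by blast
next
  assume *: "p \<in> H \<longrightarrow> q \<in> H"
  have "deriv L (insert p H) q"
  proof (cases "p \<in> H")
    case True
    then show ?thesis
      using * assms(2) by (intro deriv.assm) auto
  next
    case False
    then have "deriv L (insert p H) Bot"
      using complete[OF assms(1)] by blast
    then have "deriv L (insert (Neg q) (insert p H)) Bot"
      by (rule deriv_mono) auto
    then show ?thesis
      by (rule deriv.classical[OF assms(2)])
  qed
  then show "Imp p q \<in> H"
    by (intro in_H deriv.imp_intro assms(1))
qed

text \<open>If \<open>All q\<close> is missing, its negation is in \<open>H\<close>, and the Henkin
  witness is a variable at which the instance fails.\<close>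

lemma All_iff:
  assumes "wf_fm L q"
  shows "All q \<in> H \<longleftrightarrow> (\<forall>t. wf_tm L t \<longrightarrow> inst_fm t q \<in> H)"
proof
  assume "All q \<in> H"
  then have "deriv L H (All q)"
    by (rule deriv_H) (use assms in simp)
  then show "\<forall>t. wf_tm L t \<longrightarrow> inst_fm t q \<in> H"
    using deriv.all_elim[of L H q] in_H by blast
next
  assume *: "\<forall>t. wf_tm L t \<longrightarrow> inst_fm t q \<in> H"
  show "All q \<in> H"
  proof (rule ccontr)
    assume "All q \<notin> H"
    then have "Neg (All q) \<in> H"
      using Imp_iff[of "All q" Bot] assms by simp
    then obtain k where "Neg (inst_fm (Var k) q) \<in> H"
      using witness[OF assms] by blast
    then show False
      using Imp_iff[of "inst_fm (Var k) q" Bot] * Bot_notin assms by (simp add: wf_inst_fm)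
  qed
qed

lemma Eq_subst:
  assumes "Eq s t \<in> H" "wf_tm L s" "wf_tm L t" "wf_fm L p" "inst_fm s p \<in> H"
  shows "inst_fm t p \<in> H"
proof -
  have "deriv L H (Eq s t)" "deriv L H (inst_fm s p)"
    using assms by (auto intro!: deriv_H wf_inst_fm)
  then show ?thesis
    using deriv.eq_subst[OF assms(4)] in_H by blast
qed

lemma Eq_refl: "wf_tm L t \<Longrightarrow> Eq t t \<in> H"
  by (intro in_H deriv.eq_refl)

lemma wf_lift_tm: "wf_tm L t \<Longrightarrow> wf_tm L (subst_tm (\<lambda>x. Var (Suc x)) t)"
  by (rule wf_subst_tm) auto

text \<open>The context for a replacement has its hole at index 0, so terms that stay fixed are
  lifted past it.\<close>

lemma Eq_sym: "Eq s t \<in> H \<Longrightarrow> wf_tm L s \<Longrightarrow> wf_tm L t \<Longrightarrow> Eq t s \<in> H"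
  using Eq_subst[of s t "Eq (Var 0) (subst_tm (\<lambda>x. Var (Suc x)) s)"] Eq_refl[of s]
  by (simp add: inst_fm_def wf_lift_tm)

lemma Eq_trans:
  "Eq s t \<in> H \<Longrightarrow> Eq t u \<in> H \<Longrightarrow> wf_tm L s \<Longrightarrow> wf_tm L t \<Longrightarrow> wf_tm L u \<Longrightarrow> Eq s u \<in> H"
  using Eq_subst[of t u "Eq (subst_tm (\<lambda>x. Var (Suc x)) s) (Var 0)"]
  by (simp add: inst_fm_def wf_lift_tm)

abbreviation eqv :: "'f tm \<Rightarrow> 'f tm \<Rightarrow> bool" where
  "eqv s t \<equiv> wf_tm L s \<and> wf_tm L t \<and> Eq s t \<in> H"

lemma Eq_Fn:
  assumes "list_all2 eqv ss ts" "length ss = farity L f"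
  shows "Eq (Fn f ss) (Fn f ts) \<in> H"
proof -
  let ?l = "subst_tm (\<lambda>x. Var (Suc x))"
  define P where "P = (\<lambda>us. length us = farity L f \<and> list_all (wf_tm L) us \<and> Eq (Fn f ss) (Fn f us) \<in> H)"
  have ss: "list_all (wf_tm L) ss"
    using assms(1) by (auto simp: list_all2_conv_all_nth list_all_length)
  have "P ([] @ ts)"
  proof (rule list_all2_replace[OF assms(1)])
    show "P ([] @ ss)"
      using ss assms(2) by (auto simp: P_def intro!: Eq_refl)
  next
    fix us s t vs assume st: "eqv s t" "P (us @ s # vs)"
    let ?p = "Eq (?l (Fn f ss)) (Fn f (map ?l us @ Var 0 # map ?l vs))"
    have inst: "inst_fm u ?p = Eq (Fn f ss) (Fn f (us @ u # vs))" for u :: "'f tm"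
      by (simp add: inst_fm_def o_def)
    have "wf_fm L ?p"
      using st ss assms(2) by (auto simp: P_def list_all_iff wf_lift_tm)
    then have "inst_fm t ?p \<in> H"
      by (rule Eq_subst[of s t, rotated 3]) (use st in \<open>auto simp: P_def inst simp del: subst_tm.simps\<close>)
    then show "P (us @ t # vs)"
      using st unfolding inst by (auto simp: P_def)
  qed
  then show ?thesis by (simp add: P_def)
qed

lemma Rel_cong:
  assumes "list_all2 eqv ss ts" "length ss = rarity L r" "Rel r ss \<in> H"
  shows "Rel r ts \<in> H"
proof -
  let ?l = "subst_tm (\<lambda>x. Var (Suc x))"
  define P where "P = (\<lambda>us. length us = rarity L r \<and> list_all (wf_tm L) us \<and> Rel r us \<in> H)"
  have "P ([] @ ts)"
  proof (rule list_all2_replace[OF assms(1)])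
    show "P ([] @ ss)"
      using assms by (auto simp: P_def list_all2_conv_all_nth list_all_length)
  next
    fix us s t vs assume st: "eqv s t" "P (us @ s # vs)"
    let ?p = "Rel r (map ?l us @ Var 0 # map ?l vs)"
    have inst: "inst_fm u ?p = Rel r (us @ u # vs)" for u :: "'f tm"
      by (simp add: inst_fm_def o_def)
    have "wf_fm L ?p"
      using st by (auto simp: P_def list_all_iff wf_lift_tm)
    then have "inst_fm t ?p \<in> H"
      by (rule Eq_subst[of s t, rotated 3]) (use st in \<open>auto simp: P_def inst simp del: subst_tm.simps\<close>)
    then show "P (us @ t # vs)"
      using st unfolding inst by (auto simp: P_def)
  qed
  then show ?thesis by (simp add: P_def)
qed

section \<open>The term model\<close>

definition cls :: "'f tm \<Rightarrow> 'f tm set" where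
  "cls t = {s. eqv t s}"

definition rep :: "'f tm set \<Rightarrow> 'f tm" where
  "rep c = (SOME t. t \<in> c)"

definition tdom :: "'f tm set set" where
  "tdom = cls ` {t. wf_tm L t}"

text \<open>Arguments are classes, so a symbol acts on chosen representatives; \<open>Eq_Fn\<close>
  and \<open>Rel_cong\<close> make the choice immaterial.\<close>

definition tstruct :: "('f tm set, 'f, 'r) struct" where
  "tstruct = \<lparr>fint = \<lambda>f cs. cls (Fn f (map rep cs)), rint = \<lambda>r cs. Rel r (map rep cs) \<in> H\<rparr>"

lemma cls_eq: "wf_tm L s \<Longrightarrow> wf_tm L t \<Longrightarrow> cls s = cls t \<longleftrightarrow> Eq s t \<in> H"
  unfolding cls_def using Eq_refl Eq_sym Eq_trans by blast

lemma eqv_rep: "wf_tm L t \<Longrightarrow> eqv t (rep (cls t))"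
  unfolding cls_def rep_def using someI[of "\<lambda>s. s \<in> {s. eqv t s}" t] Eq_refl by simp

lemma eqv_rep': "wf_tm L t \<Longrightarrow> eqv (rep (cls t)) t"
  using eqv_rep Eq_sym by blast

lemma eval_tstruct:
  assumes "wf_tm L t" "\<And>x. wf_tm L (\<sigma> x)"
  shows "eval_tm tstruct (\<lambda>x. cls (\<sigma> x)) t = cls (subst_tm \<sigma> t)"
  using assms(1)
proof (induction t)
  case (Fn f ts)
  have wf: "wf_tm L (subst_tm \<sigma> t)" if "t \<in> set ts" for t
    using Fn.prems that assms(2) by (auto simp: list_all_iff intro: wf_subst_tm)
  have "eval_tm tstruct (\<lambda>x. cls (\<sigma> x)) (Fn f ts) = cls (Fn f (map (\<lambda>t. rep (cls (subst_tm \<sigma> t))) ts))"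
    using Fn by (auto simp: tstruct_def list_all_iff intro!: arg_cong[of _ _ cls])
  also have "\<dots> = cls (Fn f (map (subst_tm \<sigma>) ts))"
    using wf Fn.prems eqv_rep' eqv_rep
    by (subst cls_eq) (auto simp: list_all_iff list_all2_map1 list_all2_map2 list_all2_same intro!: Eq_Fn)
  finally show ?case by simp
qed simp

text \<open>Truth lemma: an environment of classes acts as a substitution of representatives, and a
  general \<open>\<sigma>\<close> is what the induction needs under a quantifier.\<close>

lemma rsat_tstruct:
  "wf_fm L p \<Longrightarrow> (\<And>x. wf_tm L (\<sigma> x)) \<Longrightarrow>
     rsat tdom tstruct (\<lambda>x. cls (\<sigma> x)) p \<longleftrightarrow> subst_fm \<sigma> p \<in> H"
proof (induction p arbitrary: \<sigma>)
  case Bot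
  then show ?case by (simp add: Bot_notin)
next
  case (Eq s t)
  then show ?case by (simp add: eval_tstruct cls_eq wf_subst_tm)
next
  case (Rel r ts)
  have wf: "wf_tm L (subst_tm \<sigma> t)" if "t \<in> set ts" for t
    using Rel that by (auto simp: list_all_iff intro: wf_subst_tm)
  have "map (eval_tm tstruct (\<lambda>x. cls (\<sigma> x))) ts = map (\<lambda>t. cls (subst_tm \<sigma> t)) ts"
    using Rel by (auto simp: list_all_iff eval_tstruct)
  then have "rsat tdom tstruct (\<lambda>x. cls (\<sigma> x)) (Rel r ts) \<longleftrightarrow>
      Rel r (map rep (map (\<lambda>t. cls (subst_tm \<sigma> t)) ts)) \<in> H"
    by (simp add: tstruct_def del: map_map map_eq_conv)
  also have "\<dots> \<longleftrightarrow> Rel r (map (subst_tm \<sigma>) ts) \<in> H"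
    using wf Rel.prems eqv_rep' eqv_rep
    by (auto simp: list_all2_map1 list_all2_map2 list_all2_same elim!: Rel_cong[rotated 2])
  finally show ?case by simp
next
  case (Imp p q)
  then show ?case by (simp add: Imp_iff wf_subst_fm)
next
  case (All p)
  have *: "rsat tdom tstruct (case_nat (cls t) (\<lambda>x. cls (\<sigma> x))) p \<longleftrightarrow>
      inst_fm t (subst_fm (up \<sigma>) p) \<in> H" if "wf_tm L t" for t
  proof -
    have "case_nat (cls t) (\<lambda>x. cls (\<sigma> x)) = (\<lambda>x. cls (case_nat t \<sigma> x))"
      by (auto simp: fun_eq_iff split: nat.split)
    then show ?thesis
      using All.IH[of "case_nat t \<sigma>"] All.prems that
      by (simp add: inst_subst_up split: nat.split)
  qed
  have "rsat tdom tstruct (\<lambda>x. cls (\<sigma> x)) (All p) \<longleftrightarrow>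
      (\<forall>t. wf_tm L t \<longrightarrow> inst_fm t (subst_fm (up \<sigma>) p) \<in> H)"
    using * by (auto simp: tdom_def)
  also have "\<dots> \<longleftrightarrow> All (subst_fm (up \<sigma>) p) \<in> H"
    using All.prems by (intro All_iff[symmetric] wf_subst_fm wf_up) auto
  finally show ?case by simp
qed

lemma tdom_env:
  fixes e :: "nat \<Rightarrow> 'f tm set"
  assumes "range e \<subseteq> tdom"
  shows "\<exists>\<sigma> :: nat \<Rightarrow> 'f tm. (\<forall>x. wf_tm L (\<sigma> x)) \<and> e = (\<lambda>x. cls (\<sigma> x))"
proof -
  have "\<forall>x. \<exists>t. wf_tm L t \<and> e x = cls t"
    using assms by (auto simp: tdom_def)
  from choice[OF this] show ?thesis by (auto simp: fun_eq_iff)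
qed

lemma tstruct_model:
  assumes "is_theory L T" "T \<subseteq> H"
  shows "is_model L T tdom tstruct"
  unfolding is_model_def
proof (intro conjI allI impI ballI)
  show "tdom \<noteq> {}"
    unfolding tdom_def using wf_tm.simps(1) by blast
next
  fix f as assume as: "length as = farity L f \<and> set as \<subseteq> tdom"
  then have "wf_tm L (rep a)" if "a \<in> set as" for a
    using that eqv_rep by (auto simp: tdom_def)
  then show "fint tstruct f as \<in> tdom"
    using as by (auto simp: tstruct_def tdom_def list_all_iff)
next
  fix p and e :: "nat \<Rightarrow> 'f tm set" assume p: "p \<in> T" and "range e \<subseteq> tdom"
  from tdom_env[OF this(2)]
  obtain \<sigma> where "\<And>x. wf_tm L (\<sigma> x)" "e = (\<lambda>x. cls (\<sigma> x))" by auto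
  moreover have "subst_fm \<sigma> p = subst_fm Var p"
    by (rule subst_fm_cong) (use assms p in \<open>auto simp: is_theory_def\<close>)
  ultimately show "rsat tdom tstruct e p"
    using assms p rsat_tstruct[of p \<sigma>] by (auto simp: is_theory_def)
qed

end

text \<open>Models on the single type \<open>'f tm set\<close> suffice, since the countermodel for
  \<open>T\<close> with \<open>Neg p\<close> is the term model.\<close>

theorem completeness:
  fixes L :: "('f::countable, 'r::countable) lang"
  assumes "is_theory L T" "wf_fm L p"
    and valid: "\<And>D (M :: ('f tm set, 'f, 'r) struct) e.
                  is_model L T D M \<Longrightarrow> range e \<subseteq> D \<Longrightarrow> rsat D M e p"
  shows "deriv L T p"
proof (rule ccontr)
  assume "\<not> deriv L T p"
  then have "\<not> deriv L (T \<union> {Neg p}) Bot"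
    using deriv.classical[OF assms(2), of T] by auto
  then obtain H where H: "T \<union> {Neg p} \<subseteq> H" "henkin L H"
    using henkin_extension[OF assms(1), of "{Neg p}"] by blast
  interpret henkin L H by fact
  have "is_model L T tdom tstruct"
    using H assms(1) by (intro tstruct_model) auto
  \<comment> \<open>At the environment of the classes of variables the truth lemma speaks about
    \<open>p\<close> itself.\<close>
  moreover have "range (\<lambda>x. cls (Var x)) \<subseteq> tdom"
    by (auto simp: tdom_def)
  ultimately have "rsat tdom tstruct (\<lambda>x. cls (Var x)) p"
    by (rule valid)
  then have "p \<in> H"
    using rsat_tstruct[OF assms(2), of Var] by simp
  moreover have "Neg p \<in> H" using H by blast
  ultimately show False
    using Imp_iff[of p Bot] assms(2) Bot_notin by simp
qed

section \<open>Satisfaction under substitutions and quantifier blocks\<close>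

lemma eval_tm_cong: "(\<And>x. x \<in> fv_tm t \<Longrightarrow> e x = e' x) \<Longrightarrow> eval_tm M e t = eval_tm M e' t"
proof (induction t)
  case (Fn f ts)
  then have "map (eval_tm M e) ts = map (eval_tm M e') ts"
    by (auto intro!: map_cong)
  then show ?case by (simp del: map_eq_conv)
qed simp

lemma rsat_cong: "(\<And>x. x \<in> fv_fm p \<Longrightarrow> e x = e' x) \<Longrightarrow> rsat D M e p \<longleftrightarrow> rsat D M e' p"
proof (induction p arbitrary: e e')
  case (Eq s t)
  have "eval_tm M e s = eval_tm M e' s" "eval_tm M e t = eval_tm M e' t"
    by (rule eval_tm_cong; use Eq in simp)+
  then show ?case by simp
next
  case (Rel r ts)
  then have "map (eval_tm M e) ts = map (eval_tm M e') ts"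
    by (auto intro!: map_cong eval_tm_cong)
  then show ?case by (simp del: map_eq_conv)
next
  case (Imp p q)
  from Imp.IH(1)[of e e'] Imp.IH(2)[of e e'] Imp.prems show ?case by simp
next
  case (All p)
  have "rsat D M (case_nat a e) p \<longleftrightarrow> rsat D M (case_nat a e') p" for a
    by (rule All.IH) (use All.prems in \<open>auto split: nat.split\<close>)
  then show ?case by simp
qed simp

lemma eval_subst_tm: "eval_tm M e (subst_tm \<sigma> t) = eval_tm M (\<lambda>x. eval_tm M e (\<sigma> x)) t"
proof (induction t)
  case (Fn f ts)
  then have "map (eval_tm M e) (map (subst_tm \<sigma>) ts) = map (eval_tm M (\<lambda>x. eval_tm M e (\<sigma> x))) ts"
    by simp
  then show ?case by (simp del: map_map map_eq_conv)
qed simp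

lemma rsat_subst_fm: "rsat D M e (subst_fm \<sigma> p) \<longleftrightarrow> rsat D M (\<lambda>x. eval_tm M e (\<sigma> x)) p"
proof (induction p arbitrary: e \<sigma>)
  case (Rel r ts)
  have "map (eval_tm M e) (map (subst_tm \<sigma>) ts) = map (eval_tm M (\<lambda>x. eval_tm M e (\<sigma> x))) ts"
    by (simp add: eval_subst_tm)
  then show ?case by (simp del: map_map map_eq_conv)
next
  case (All p)
  have "(\<lambda>x. eval_tm M (case_nat a e) (up \<sigma> x)) = case_nat a (\<lambda>x. eval_tm M e (\<sigma> x))" for a
    by (auto simp: fun_eq_iff up_def eval_subst_tm split: nat.split)
  then show ?case by (simp add: All.IH)
qed (auto simp: eval_subst_tm)

lemma rsat_app_fm:
  "rsat D M e (app_fm p ts) \<longleftrightarrow>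
     rsat D M (\<lambda>x. if x < length ts then eval_tm M e (ts ! x) else e x) p"
  unfolding app_fm_def rsat_subst_fm by (rule rsat_cong) auto

lemma rsat_Conj [simp]: "rsat D M e (Conj ps) \<longleftrightarrow> (\<forall>p\<in>set ps. rsat D M e p)"
  by (induction ps) (auto simp: Conj_def)

lemma rsat_Disj [simp]: "rsat D M e (Disj ps) \<longleftrightarrow> (\<exists>p\<in>set ps. rsat D M e p)"
  by (induction ps) (auto simp: Disj_def)

definition env_append :: "'a list \<Rightarrow> (nat \<Rightarrow> 'a) \<Rightarrow> nat \<Rightarrow> 'a" where
  "env_append as e x = (if x < length as then as ! x else e (x - length as))"

lemma env_append_nth [simp]: "x < length as \<Longrightarrow> env_append as e x = as ! x"
  by (simp add: env_append_def)

lemma env_append_add [simp]: "env_append as e (x + length as) = e x" "length as = n \<Longrightarrow> env_append as e (x + n) = e x"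
  by (auto simp: env_append_def)

lemma env_append_snoc: "env_append as (case_nat a e) = env_append (as @ [a]) e"
proof
  fix x
  show "env_append as (case_nat a e) x = env_append (as @ [a]) e x"
    by (cases "x < length as"; cases "x = length as")
      (auto simp: env_append_def nth_append not_less le_less split: nat.split
        intro!: arg_cong[of _ _ e])
qed

text \<open>The outermost of the \<open>n\<close> quantifiers binds the highest index, so its value
  is the last entry of the list.\<close>

lemma rsat_AllN:
  "rsat D M e (AllN n p) \<longleftrightarrow> (\<forall>as. length as = n \<and> set as \<subseteq> D \<longrightarrow> rsat D M (env_append as e) p)"
proof (induction n arbitrary: e)
  case 0
  have "env_append [] e = e" by (auto simp: env_append_def)
  then show ?case by (simp add: AllN_def)
next
  case (Suc n)
  have "rsat D M e (AllN (Suc n) p) \<longleftrightarrow> (\<forall>a\<in>D. rsat D M (case_nat a e) (AllN n p))"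
    by (simp add: AllN_def)
  also have "\<dots> \<longleftrightarrow> (\<forall>a\<in>D. \<forall>as. length as = n \<and> set as \<subseteq> D \<longrightarrow> rsat D M (env_append (as @ [a]) e) p)"
    by (simp add: Suc.IH env_append_snoc)
  also have "\<dots> \<longleftrightarrow> (\<forall>as. length as = Suc n \<and> set as \<subseteq> D \<longrightarrow> rsat D M (env_append as e) p)"
    by (auto simp: length_Suc_conv_rev)
  finally show ?case .
qed

lemma ExN_eq: "rsat D M e (ExN n p) \<longleftrightarrow> \<not> rsat D M e (AllN n (Neg p))"
proof (induction n arbitrary: e)
  case 0
  then show ?case by (simp add: ExN_def AllN_def)
next
  case (Suc n)
  then show ?case unfolding ExN_def AllN_def by simp
qed

lemma rsat_ExN:
  "rsat D M e (ExN n p) \<longleftrightarrow> (\<exists>as. length as = n \<and> set as \<subseteq> D \<and> rsat D M (env_append as e) p)"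
  by (auto simp: ExN_eq rsat_AllN)

lemma wf_AllN [simp]: "wf_fm L (AllN n p) \<longleftrightarrow> wf_fm L p"
  by (induction n) (auto simp: AllN_def)

lemma wf_ExN [simp]: "wf_fm L (ExN n p) \<longleftrightarrow> wf_fm L p"
  by (induction n) (auto simp: ExN_def)

lemma wf_Conj [simp]: "wf_fm L (Conj ps) \<longleftrightarrow> (\<forall>p\<in>set ps. wf_fm L p)"
  by (induction ps) (auto simp: Conj_def)

lemma fv_subst_tm: "y \<in> fv_tm (subst_tm \<sigma> t) \<Longrightarrow> \<exists>x\<in>fv_tm t. y \<in> fv_tm (\<sigma> x)"
  by (induction t) fastforce+

lemma fv_subst_fm: "y \<in> fv_fm (subst_fm \<sigma> p) \<Longrightarrow> \<exists>x\<in>fv_fm p. y \<in> fv_tm (\<sigma> x)"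
proof (induction p arbitrary: y \<sigma>)
  case (All p)
  then obtain x where x: "x \<in> fv_fm p" "Suc y \<in> fv_tm (up \<sigma> x)"
    by auto
  then obtain z where "x = Suc z" "y \<in> fv_tm (\<sigma> z)"
    by (auto simp: up_def split: nat.splits dest!: fv_subst_tm)
  with x show ?case by auto
next
  case (Imp p q)
  from Imp.IH(1)[of y \<sigma>] Imp.IH(2)[of y \<sigma>] Imp.prems show ?case by auto
qed (fastforce dest: fv_subst_tm)+


section \<open>Interpreted structures\<close>

definition interp_dom ::
    "'a set \<Rightarrow> ('a, 'g, 's) struct \<Rightarrow> ('f, 'r, 'g, 's) translation \<Rightarrow> 'a set" where
  "interp_dom D M \<tau> = {a \<in> D. rsat D M (\<lambda>_. a) (dom_fm \<tau>)}"

text \<open>Functions are read off their graphs by \<open>THE\<close>; the locale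
  \<open>interp_model\<close> supplies the uniqueness that this needs.\<close>

definition interp_struct ::
    "'a set \<Rightarrow> ('a, 'g, 's) struct \<Rightarrow> ('f, 'r, 'g, 's) translation \<Rightarrow> ('a, 'f, 'r) struct" where
  "interp_struct D M \<tau> =
     \<lparr>fint = \<lambda>f as. THE b. b \<in> interp_dom D M \<tau> \<and> rsat D M ((!) (as @ [b])) (fun_fm \<tau> f),
      rint = \<lambda>r as. rsat D M ((!) as) (rel_fm \<tau> r)\<rparr>"

locale interp_model =
  fixes LV :: "('f, 'r) lang" and LU :: "('g, 's) lang" and \<tau> :: "('f, 'r, 'g, 's) translation"
    and D :: "'a set" and M :: "('a, 'g, 's) struct"
  assumes tr: "is_translation LV LU \<tau>"
    and fun_ex1: "length as = farity LV f \<Longrightarrow> set as \<subseteq> interp_dom D M \<tau> \<Longrightarrow>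
                 \<exists>!b. b \<in> interp_dom D M \<tau> \<and> rsat D M ((!) (as @ [b])) (fun_fm \<tau> f)"
begin

abbreviation "E \<equiv> interp_dom D M \<tau>"
abbreviation "N \<equiv> interp_struct D M \<tau>"

lemma rsat_dom: "e 0 \<in> D \<Longrightarrow> rsat D M e (dom_fm \<tau>) \<longleftrightarrow> e 0 \<in> E"
  using tr unfolding interp_dom_def is_translation_def
  by (auto elim!: rsat_cong[THEN iffD1, rotated])

lemma rsat_app_dom: "e x \<in> D \<Longrightarrow> rsat D M e (app_fm (dom_fm \<tau>) [Var x]) \<longleftrightarrow> e x \<in> E"
  by (simp add: rsat_app_fm rsat_dom)

lemma E_sub: "E \<subseteq> D"
  by (auto simp: interp_dom_def)

lemma fint_iff:
  assumes "length as = farity LV f" "set as \<subseteq> E" "b \<in> E"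
  shows "rsat D M ((!) (as @ [b])) (fun_fm \<tau> f) \<longleftrightarrow> b = fint N f as"
  using theI'[OF fun_ex1[OF assms(1,2)]] the1_equality[OF fun_ex1[OF assms(1,2)], of b] assms(3)
  unfolding interp_struct_def by auto

lemma fint_in:
  assumes "length as = farity LV f" "set as \<subseteq> E"
  shows "fint N f as \<in> E"
  using theI'[OF fun_ex1[OF assms]] unfolding interp_struct_def by simp

lemma eval_in: "wf_tm LV t \<Longrightarrow> (\<And>x. x \<in> fv_tm t \<Longrightarrow> e x \<in> E) \<Longrightarrow> eval_tm N e t \<in> E"
proof (induction t)
  case (Fn f ts)
  then have "eval_tm N e t \<in> E" if "t \<in> set ts" for t
    using that by (auto simp: list_all_iff)
  then show ?case using Fn.prems by (auto intro!: fint_in)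
qed simp

lemma rsat_app_dom_env:
  "i < length as \<Longrightarrow> set as \<subseteq> D \<Longrightarrow>
     rsat D M (env_append as e) (app_fm (dom_fm \<tau>) [Var i]) \<longleftrightarrow> as ! i \<in> E"
  by (subst rsat_app_dom) (auto simp: subset_iff)

text \<open>The conjuncts tie each new name to the value of its term, and these values lie in the
  domain, so the existential block has exactly one witness list. The assumption on \<open>gs\<close>
  is made for every offset because the formulas are used under the new quantifiers, where variables
  are raised by \<open>k + n\<close>.\<close>

lemma rsat_bind_tms:
  assumes len: "length gs = length ts"
    and wf: "list_all (wf_tm LV) ts"
    and fv: "\<And>t x. t \<in> set ts \<Longrightarrow> x \<in> fv_tm t \<Longrightarrow> e (x + k) \<in> E"
    and g: "\<And>i e k. i < length ts \<Longrightarrow> e i \<in> E \<Longrightarrow> (\<And>x. x \<in> fv_tm (ts ! i) \<Longrightarrow> e (x + k) \<in> E) \<Longrightarrow>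
      rsat D M e ((gs ! i) k i) \<longleftrightarrow> e i = eval_tm N (\<lambda>x. e (x + k)) (ts ! i)"
  shows "rsat D M e (bind_tms \<tau> gs k p) \<longleftrightarrow>
    rsat D M (env_append (map (eval_tm N (\<lambda>x. e (x + k))) ts) e) p"
proof -
  let ?n = "length ts" and ?v = "eval_tm N (\<lambda>x. e (x + k))"
  have g': "rsat D M (env_append as e) ((gs ! i) (k + ?n) i) \<longleftrightarrow> as ! i = ?v (ts ! i)"
    if "i < ?n" "as ! i \<in> E" "length as = ?n" for as i
  proof -
    have *: "env_append as e (x + (k + ?n)) = e (x + k)" for x
      using that(3) env_append_add(2)[of as ?n e "x + k"] by (simp add: add.assoc)
    show ?thesis
      using g[of i "env_append as e" "k + ?n"] that fv[of "ts ! i"] by (simp add: *)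
  qed
  have v_in: "?v t \<in> E" if "t \<in> set ts" for t
    using that wf fv by (intro eval_in) (auto simp: list_all_iff)
  have "rsat D M e (bind_tms \<tau> gs k p) \<longleftrightarrow>
    (\<exists>as. length as = ?n \<and> set as \<subseteq> D \<and> (\<forall>i<?n. as ! i \<in> E \<and> as ! i = ?v (ts ! i)) \<and>
        rsat D M (env_append as e) p)"
    unfolding bind_tms_def Let_def rsat_ExN len
  proof (intro ex_cong1 conj_cong refl)
    fix as assume as: "length as = ?n" "set as \<subseteq> D"
    have "rsat D M (env_append as e) (And (app_fm (dom_fm \<tau>) [Var i]) ((gs ! i) (k + ?n) i)) \<longleftrightarrow>
        as ! i \<in> E \<and> as ! i = ?v (ts ! i)" if "i < ?n" for i
      using that as g'[of i as] rsat_app_dom_env[of i as e] by auto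
    then have "rsat D M (env_append as e)
        (Conj (map (\<lambda>i. And (app_fm (dom_fm \<tau>) [Var i]) ((gs ! i) (k + ?n) i)) [0..<?n])) \<longleftrightarrow>
        (\<forall>i<?n. as ! i \<in> E \<and> as ! i = ?v (ts ! i))"
      by (auto simp del: rsat.simps)
    then show "rsat D M (env_append as e)
        (And (Conj (map (\<lambda>i. And (app_fm (dom_fm \<tau>) [Var i]) ((gs ! i) (k + ?n) i)) [0..<?n])) p) \<longleftrightarrow>
        (\<forall>i<?n. as ! i \<in> E \<and> as ! i = ?v (ts ! i)) \<and> rsat D M (env_append as e) p"
      by simp
  qed
  also have "\<dots> \<longleftrightarrow> (\<exists>as. as = map ?v ts \<and> rsat D M (env_append as e) p)"
  proof (intro ex_cong1 iffI; elim conjE)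
    fix as assume "length as = ?n" "\<forall>i<?n. as ! i \<in> E \<and> as ! i = ?v (ts ! i)" "rsat D M (env_append as e) p"
    then show "as = map ?v ts \<and> rsat D M (env_append as e) p"
      by (auto simp: list_eq_iff_nth_eq)
  next
    fix as assume "as = map ?v ts" "rsat D M (env_append as e) p"
    then show "length as = ?n \<and> set as \<subseteq> D \<and> (\<forall>i<?n. as ! i \<in> E \<and> as ! i = ?v (ts ! i)) \<and>
        rsat D M (env_append as e) p"
      using v_in E_sub by auto
  qed
  finally show ?thesis by simp
qed

lemma rsat_tr_tm:
  "wf_tm LV t \<Longrightarrow> e y \<in> E \<Longrightarrow> (\<And>x. x \<in> fv_tm t \<Longrightarrow> e (x + k) \<in> E) \<Longrightarrow>
     rsat D M e (tr_tm \<tau> t k y) \<longleftrightarrow> e y = eval_tm N (\<lambda>x. e (x + k)) t"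
proof (induction t arbitrary: e k y)
  case (Var x)
  then show ?case by auto
next
  case (Fn f ts)
  let ?as = "map (eval_tm N (\<lambda>x. e (x + k))) ts" and ?n = "length ts"
  have n: "?n = farity LV f"
    using Fn.prems by simp
  have in_E: "set ?as \<subseteq> E"
    using Fn.prems by (auto simp: list_all_iff intro!: eval_in)
  have fv: "x \<le> ?n" if "x \<in> fv_fm (fun_fm \<tau> f)" for x
    using that tr n by (auto simp: is_translation_def)
  have "rsat D M e (tr_tm \<tau> (Fn f ts) k y) \<longleftrightarrow>
      rsat D M (env_append ?as e) (app_fm (fun_fm \<tau> f) (map Var [0..<?n] @ [Var (y + ?n)]))"
    unfolding tr_tm.simps Let_def
  proof (rule rsat_bind_tms)
    fix i e k
    assume "i < length ts" "e i \<in> E" "\<And>x. x \<in> fv_tm (ts ! i) \<Longrightarrow> e (x + k) \<in> E"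
    then show "rsat D M e ((map (tr_tm \<tau>) ts ! i) k i) \<longleftrightarrow> e i = eval_tm N (\<lambda>x. e (x + k)) (ts ! i)"
      using Fn.IH[of "ts ! i" e i k] Fn.prems(1) by (auto simp: list_all_iff)
  qed (use Fn.prems in \<open>auto simp: list_all_iff\<close>)
  also have "\<dots> \<longleftrightarrow> rsat D M ((!) (?as @ [e y])) (fun_fm \<tau> f)"
    unfolding rsat_app_fm
  proof (rule rsat_cong)
    fix x assume "x \<in> fv_fm (fun_fm \<tau> f)"
    then consider "x < ?n" | "x = ?n" using fv[of x] by linarith
    then show "(if x < length (map Var [0..<?n] @ [Var (y + ?n)])
        then eval_tm M (env_append ?as e) ((map Var [0..<?n] @ [Var (y + ?n)]) ! x)
        else env_append ?as e x) = (?as @ [e y]) ! x"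
      by cases (auto simp: nth_append)
  qed
  also have "\<dots> \<longleftrightarrow> e y = eval_tm N (\<lambda>x. e (x + k)) (Fn f ts)"
    using fint_iff[of ?as f "e y"] n in_E Fn.prems by simp
  finally show ?case .
qed

text \<open>Through completeness this replaces deriving a translated axiom by checking the axiom in
  \<open>N\<close>.\<close>

lemma rsat_tr_fm:
  "wf_fm LV p \<Longrightarrow> (\<And>x. x \<in> fv_fm p \<Longrightarrow> e x \<in> E) \<Longrightarrow> rsat D M e (tr_fm \<tau> p) \<longleftrightarrow> rsat E N e p"
proof (induction p arbitrary: e)
  case (Eq s t)
  have "rsat D M e (tr_fm \<tau> (Eq s t)) \<longleftrightarrow>
      rsat D M (env_append (map (eval_tm N (\<lambda>x. e (x + 0))) [s, t]) e) (Eq (Var 0) (Var 1))"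
    unfolding tr_fm.simps
  proof (rule rsat_bind_tms)
    fix i e k
    assume "i < length [s, t]" "e i \<in> E" "\<And>x. x \<in> fv_tm ([s, t] ! i) \<Longrightarrow> e (x + k) \<in> E"
    then show "rsat D M e (([tr_tm \<tau> s, tr_tm \<tau> t] ! i) k i) \<longleftrightarrow> e i = eval_tm N (\<lambda>x. e (x + k)) ([s, t] ! i)"
      using Eq.prems by (auto simp: less_Suc_eq rsat_tr_tm)
  qed (use Eq.prems in auto)
  then show ?case by simp
next
  case (Rel r ts)
  have fv: "x < length ts" if "x \<in> fv_fm (rel_fm \<tau> r)" for x
    using that tr Rel.prems by (auto simp: is_translation_def)
  have "rsat D M e (tr_fm \<tau> (Rel r ts)) \<longleftrightarrow>
      rsat D M (env_append (map (eval_tm N (\<lambda>x. e (x + 0))) ts) e) (rel_fm \<tau> r)"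
    unfolding tr_fm.simps
  proof (rule rsat_bind_tms)
    fix i e k
    assume "i < length ts" "e i \<in> E" "\<And>x. x \<in> fv_tm (ts ! i) \<Longrightarrow> e (x + k) \<in> E"
    then show "rsat D M e ((map (tr_tm \<tau>) ts ! i) k i) \<longleftrightarrow> e i = eval_tm N (\<lambda>x. e (x + k)) (ts ! i)"
      using Rel.prems by (auto simp: rsat_tr_tm list_all_iff)
  qed (use Rel.prems in \<open>auto simp: list_all_iff\<close>)
  also have "\<dots> \<longleftrightarrow> rsat D M ((!) (map (eval_tm N e) ts)) (rel_fm \<tau> r)"
    by (rule rsat_cong) (use fv in auto)
  finally show ?case by (simp add: interp_struct_def)
next
  case (All p)
  have "rsat D M (case_nat a e) (tr_fm \<tau> p) \<longleftrightarrow> rsat E N (case_nat a e) p" if "a \<in> E" for a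
    by (rule All.IH) (use All.prems that in \<open>auto split: nat.split\<close>)
  then show ?case
    using E_sub by (auto simp: rsat_app_dom)
next
  case (Imp p q)
  from Imp.IH(1)[of e] Imp.IH(2)[of e] Imp.prems show ?case by simp
qed simp

lemma rsat_fun_ok:
  "rsat D M e (fun_ok LV \<tau> f)"
proof -
  let ?n = "farity LV f"
  \<comment> \<open>\<open>d\<close> is 1 below the existence quantifier of \<open>fun_ok\<close>
    and 2 below its uniqueness quantifier.\<close>
  have *: "rsat D M e' (app_fm (fun_fm \<tau> f) (map (\<lambda>i. Var (i + d)) [0..<?n] @ [Var y])) \<longleftrightarrow>
      e' y = fint N f as"
    if "\<And>i. i < ?n \<Longrightarrow> e' (i + d) = as ! i" "e' y \<in> E" "length as = ?n" "set as \<subseteq> E" for e' d y as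
  proof -
    have "rsat D M e' (app_fm (fun_fm \<tau> f) (map (\<lambda>i. Var (i + d)) [0..<?n] @ [Var y])) \<longleftrightarrow>
        rsat D M ((!) (as @ [e' y])) (fun_fm \<tau> f)"
      unfolding rsat_app_fm
    proof (rule rsat_cong)
      fix x assume "x \<in> fv_fm (fun_fm \<tau> f)"
      then have "x \<le> ?n" using tr by (auto simp: is_translation_def)
      then consider "x < ?n" | "x = ?n" by linarith
      then show "(if x < length (map (\<lambda>i. Var (i + d)) [0..<?n] @ [Var y])
          then eval_tm M e' ((map (\<lambda>i. Var (i + d)) [0..<?n] @ [Var y]) ! x) else e' x) =
          (as @ [e' y]) ! x"
        using that by cases (auto simp: nth_append)
    qed
    then show ?thesis using fint_iff that by simp
  qed
  show ?thesis
    unfolding fun_ok_def Let_def rsat_AllN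
  proof (intro allI impI, elim conjE)
    fix as :: "'a list" assume as: "length as = ?n" "set as \<subseteq> D"
    have "rsat D M (env_append as e) (Conj (map (\<lambda>x. app_fm (dom_fm \<tau>) [Var x]) [0..<?n])) \<longleftrightarrow> set as \<subseteq> E"
      using as by (auto simp: rsat_app_dom_env subset_eq all_set_conv_all_nth)
    moreover have "rsat D M (env_append as e)
        (Ex (And (And (app_fm (dom_fm \<tau>) [Var 0])
               (app_fm (fun_fm \<tau> f) (map (\<lambda>i. Var (i + 1)) [0..<?n] @ [Var 0])))
          (All (Imp (And (app_fm (dom_fm \<tau>) [Var 0])
               (app_fm (fun_fm \<tau> f) (map (\<lambda>i. Var (i + 2)) [0..<?n] @ [Var 0])))
            (Eq (Var 0) (Var 1))))))" (is "rsat _ _ _ (Ex (And (And ?d ?F1) (All (Imp (And ?d ?F2) _))))")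
      if "set as \<subseteq> E"
    proof -
      define b where "b = fint N f as"
      have b: "b \<in> E" "b \<in> D"
        unfolding b_def using fint_in[OF as(1) that] E_sub by auto
      have "rsat D M (case_nat b (env_append as e)) ?F1"
        by (subst *[of _ _ as]) (use as that b in \<open>auto simp: b_def\<close>)
      moreover have "c = b" if "c \<in> E" "rsat D M (case_nat c (case_nat b (env_append as e))) ?F2" for c
        using that(2) unfolding b_def
        by (subst (asm) *[of _ _ as]) (use as that \<open>set as \<subseteq> E\<close> in \<open>auto simp: numeral_2_eq_2\<close>)
      moreover have dom: "c \<in> D \<Longrightarrow> rsat D M (case_nat c e) ?d \<longleftrightarrow> c \<in> E" for c e
        by (simp add: rsat_app_dom)
      ultimately have "\<exists>b\<in>D. (rsat D M (case_nat b (env_append as e)) ?d \<and>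
          rsat D M (case_nat b (env_append as e)) ?F1) \<and>
          (\<forall>c\<in>D. rsat D M (case_nat c (case_nat b (env_append as e))) ?d \<and>
             rsat D M (case_nat c (case_nat b (env_append as e))) ?F2 \<longrightarrow> c = b)"
        using b by (intro bexI[of _ b]) auto
      then show ?thesis by simp blast
    qed
    ultimately show "rsat D M (env_append as e)
      (Imp (Conj (map (\<lambda>x. app_fm (dom_fm \<tau>) [Var x]) [0..<?n]))
        (Ex (And (And (app_fm (dom_fm \<tau>) [Var 0])
               (app_fm (fun_fm \<tau> f) (map (\<lambda>i. Var (i + 1)) [0..<?n] @ [Var 0])))
          (All (Imp (And (app_fm (dom_fm \<tau>) [Var 0])
               (app_fm (fun_fm \<tau> f) (map (\<lambda>i. Var (i + 2)) [0..<?n] @ [Var 0])))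
            (Eq (Var 0) (Var 1)))))))"
      by (subst rsat.simps(4)) blast
  qed
qed

end

section \<open>Well-formedness of translations and a semantic criterion for interpretability\<close>

lemma wf_bind_tms:
  assumes "is_translation LV LU \<tau>" "\<And>g k i. g \<in> set gs \<Longrightarrow> wf_fm LU (g k i)" "wf_fm LU p"
  shows "wf_fm LU (bind_tms \<tau> gs k p)"
  using assms by (auto simp: bind_tms_def Let_def is_translation_def intro!: wf_app_fm)

lemma wf_tr_tm: "is_translation LV LU \<tau> \<Longrightarrow> wf_fm LU (tr_tm \<tau> t k y)"
proof (induction t arbitrary: k y)
  case (Fn f ts)
  then show ?case
    by (auto simp: Let_def is_translation_def intro!: wf_bind_tms[OF Fn.prems] wf_app_fm)
qed simp

lemma wf_tr_fm: "is_translation LV LU \<tau> \<Longrightarrow> wf_fm LU (tr_fm \<tau> p)"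
proof (induction p)
  case (All p)
  then show ?case by (auto simp: is_translation_def intro!: wf_app_fm)
next
  case (Eq s t)
  show ?case
    unfolding tr_fm.simps by (rule wf_bind_tms[OF Eq]) (auto simp: wf_tr_tm[OF Eq])
next
  case (Rel r ts)
  then have "wf_fm LU (rel_fm \<tau> r)" by (simp add: is_translation_def)
  then show ?case
    unfolding tr_fm.simps by (intro wf_bind_tms[OF Rel]) (auto simp: wf_tr_tm[OF Rel])
qed auto

lemma wf_fun_ok: "is_translation LV LU \<tau> \<Longrightarrow> wf_fm LU (fun_ok LV \<tau> f)"
  by (auto simp: fun_ok_def Let_def is_translation_def intro!: wf_app_fm)

theorem interpretableI:
  fixes LU :: "('g::countable, 's::countable) lang"
  assumes "is_theory LU U" "is_theory LV V" and tr: "is_translation LV LU \<tau>"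
    and nonempty: "\<And>D (M :: ('g tm set, 'g, 's) struct). is_model LU U D M \<Longrightarrow> interp_dom D M \<tau> \<noteq> {}"
    and total: "\<And>D (M :: ('g tm set, 'g, 's) struct) f as.
      is_model LU U D M \<Longrightarrow> length as = farity LV f \<Longrightarrow> set as \<subseteq> interp_dom D M \<tau> \<Longrightarrow>
      \<exists>!b. b \<in> interp_dom D M \<tau> \<and> rsat D M ((!) (as @ [b])) (fun_fm \<tau> f)"
    and axioms: "\<And>D (M :: ('g tm set, 'g, 's) struct) p e.
      is_model LU U D M \<Longrightarrow> p \<in> V \<Longrightarrow> rsat (interp_dom D M \<tau>) (interp_struct D M \<tau>) e p"
  shows "interpretable LV V LU U"
  unfolding interpretable_def is_interpretation_def
proof (intro exI[of _ \<tau>] conjI allI ballI)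
  have im: "interp_model LV LU \<tau> D M" if "is_model LU U D M" for D and M :: "('g tm set, 'g, 's) struct"
  proof
  qed (use tr total[OF that] in auto)
  show "deriv LU U (Ex (dom_fm \<tau>))"
  proof (rule completeness)
    show "wf_fm LU (Ex (dom_fm \<tau>))"
      using tr by (simp add: is_translation_def)
  next
    fix D and M :: "('g tm set, 'g, 's) struct" and e
    assume M: "is_model LU U D M"
    interpret interp_model LV LU \<tau> D M by (rule im[OF M])
    show "rsat D M e (Ex (dom_fm \<tau>))"
      using nonempty[OF M] E_sub by (auto simp: rsat_dom)
  qed fact
  show "deriv LU U (fun_ok LV \<tau> f)" for f
    using assms(1) wf_fun_ok[OF tr] interp_model.rsat_fun_ok[OF im] by (rule completeness)
  show "deriv LU U (tr_fm \<tau> p)" if p: "p \<in> V" for p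
  proof (rule completeness[OF assms(1) wf_tr_fm[OF tr]])
    fix D and M :: "('g tm set, 'g, 's) struct" and e
    assume M: "is_model LU U D M"
    show "rsat D M e (tr_fm \<tau> p)"
      using axioms[OF M p, of e] assms(2) p interp_model.rsat_tr_fm[OF im[OF M], of p e]
      by (auto simp: is_theory_def)
  qed
qed (fact tr)


section \<open>Totalized function formulas\<close>

text \<open>
  \<open>total_fm \<delta> k n p\<close> makes the formula \<open>p\<close> with arguments \<open>0, ..., n - 1\<close> and value \<open>n\<close> total and
  functional: where the value in the domain is not unique, it is replaced by the constant \<open>k\<close>.
\<close>

definition at_new :: "nat \<Rightarrow> ('f, 'r) fm \<Rightarrow> ('f, 'r) fm" where
  "at_new n = subst_fm (\<lambda>i. if i = n then Var 0 else Var (Suc i))"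

definition only_fm :: "('f, 'r) fm \<Rightarrow> nat \<Rightarrow> ('f, 'r) fm \<Rightarrow> ('f, 'r) fm" where
  "only_fm \<delta> n p = And p (All (Imp (And \<delta> (at_new n p)) (Eq (Var 0) (Var (Suc n)))))"

definition total_fm :: "('f, 'r) fm \<Rightarrow> 'f \<Rightarrow> nat \<Rightarrow> ('f, 'r) fm \<Rightarrow> ('f, 'r) fm" where
  "total_fm \<delta> k n p = Or (only_fm \<delta> n p)
     (And (Eq (Var n) (Fn k [])) (Neg (Ex (And \<delta> (at_new n (only_fm \<delta> n p))))))"

lemma wf_at_new: "wf_fm L p \<Longrightarrow> wf_fm L (at_new n p)"
  unfolding at_new_def by (rule wf_subst_fm) auto

lemma wf_total_fm: "wf_fm L \<delta> \<Longrightarrow> wf_fm L p \<Longrightarrow> farity L k = 0 \<Longrightarrow> wf_fm L (total_fm \<delta> k n p)"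
  by (auto simp: total_fm_def only_fm_def intro!: wf_at_new)

lemma fv_at_new: "fv_fm p \<subseteq> {..n} \<Longrightarrow> fv_fm (at_new n p) \<subseteq> {..n}"
proof
  fix y assume "fv_fm p \<subseteq> {..n}" "y \<in> fv_fm (at_new n p)"
  then show "y \<in> {..n}"
    unfolding at_new_def by (force dest!: fv_subst_fm split: if_splits)
qed

lemma fv_only_fm: "fv_fm \<delta> \<subseteq> {0} \<Longrightarrow> fv_fm p \<subseteq> {..n} \<Longrightarrow> fv_fm (only_fm \<delta> n p) \<subseteq> {..n}"
  using fv_at_new[of p n] unfolding only_fm_def by auto

lemma fv_total_fm: "fv_fm \<delta> \<subseteq> {0} \<Longrightarrow> fv_fm p \<subseteq> {..n} \<Longrightarrow> fv_fm (total_fm \<delta> k n p) \<subseteq> {..n}"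
  using fv_only_fm[of \<delta> p n] fv_at_new[of "only_fm \<delta> n p" n] unfolding total_fm_def by auto

lemma unique_or_default:
  assumes "b \<in> E"
  shows "P b \<and> (\<forall>c\<in>E. P c \<longrightarrow> c = b) \<or> b = k \<and> \<not> (\<exists>b\<in>E. P b \<and> (\<forall>c\<in>E. P c \<longrightarrow> c = b)) \<longleftrightarrow>
    b = (if \<exists>!b. b \<in> E \<and> P b then THE b. b \<in> E \<and> P b else k)"
proof -
  have ex1: "(\<exists>b\<in>E. P b \<and> (\<forall>c\<in>E. P c \<longrightarrow> c = b)) \<longleftrightarrow> (\<exists>!b. b \<in> E \<and> P b)"
    by blast
  show ?thesis
  proof (cases "\<exists>!b. b \<in> E \<and> P b")
    case True
    then obtain c where c: "c \<in> E" "P c" "\<forall>d\<in>E. P d \<longrightarrow> d = c" by blast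
    then have "(THE b. b \<in> E \<and> P b) = c"
      by (intro the_equality conjI) blast+
    moreover have "P b \<and> (\<forall>d\<in>E. P d \<longrightarrow> d = b) \<longleftrightarrow> b = c"
      using c assms by blast
    ultimately show ?thesis
      unfolding ex1 using True by (simp only: not_True_eq_False simp_thms if_True)
  next
    case False
    moreover from this have "\<not> (P b \<and> (\<forall>d\<in>E. P d \<longrightarrow> d = b))"
      using assms by blast
    ultimately show ?thesis
      unfolding ex1 by (simp only: not_False_eq_True simp_thms if_False)
  qed
qed

lemma rsat_total_fm:
  assumes "fv_fm \<delta> \<subseteq> {0}" "fv_fm p \<subseteq> {..n}" "length as = n"
    and E: "E = {a \<in> D. rsat D M (\<lambda>_. a) \<delta>}" and "fint M k [] \<in> E" "b \<in> E"
  shows "rsat D M ((!) (as @ [b])) (total_fm \<delta> k n p) \<longleftrightarrow>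
    b = (if \<exists>!b. b \<in> E \<and> rsat D M ((!) (as @ [b])) p
         then THE b. b \<in> E \<and> rsat D M ((!) (as @ [b])) p else fint M k [])"
proof -
  let ?P = "\<lambda>b. rsat D M ((!) (as @ [b])) p"
  have dom: "rsat D M e \<delta> \<longleftrightarrow> e 0 \<in> E" if "e 0 \<in> D" for e
    using that assms(1) unfolding E by (auto elim!: rsat_cong[THEN iffD1, rotated])
  have ED: "a \<in> D" if "a \<in> E" for a
    using that E by simp
  have at_new: "rsat D M (case_nat c ((!) (as @ [b]))) (at_new n q) \<longleftrightarrow> rsat D M ((!) (as @ [c])) q"
    if "fv_fm q \<subseteq> {..n}" for q b c
    unfolding at_new_def rsat_subst_fm
    by (rule rsat_cong) (use that assms(3) in \<open>auto simp: nth_append\<close>)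
  have only: "rsat D M ((!) (as @ [b])) (only_fm \<delta> n p) \<longleftrightarrow> ?P b \<and> (\<forall>c\<in>E. ?P c \<longrightarrow> c = b)" for b
    using assms(2,3) ED by (auto simp: only_fm_def dom at_new)
  have dom': "c \<in> D \<and> rsat D M (case_nat c e) \<delta> \<longleftrightarrow> c \<in> E" for c e
    using dom[of "case_nat c e"] ED by auto
  have E_ex: "(\<exists>c\<in>D. rsat D M (case_nat c e) \<delta> \<and> Q c) \<longleftrightarrow> (\<exists>c\<in>E. Q c)" for e Q
    using dom' by blast
  have nth: "(as @ [b]) ! n = b"
    using assms(3) by (simp add: nth_append)
  have "rsat D M ((!) (as @ [b])) (total_fm \<delta> k n p) \<longleftrightarrow>
      rsat D M ((!) (as @ [b])) (only_fm \<delta> n p) \<or>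
      b = fint M k [] \<and> \<not> (\<exists>c\<in>D. rsat D M (case_nat c ((!) (as @ [b]))) \<delta> \<and>
        rsat D M (case_nat c ((!) (as @ [b]))) (at_new n (only_fm \<delta> n p)))"
    by (auto simp: total_fm_def nth)
  also have "\<dots> \<longleftrightarrow> ?P b \<and> (\<forall>c\<in>E. ?P c \<longrightarrow> c = b) \<or>
      b = fint M k [] \<and> \<not> (\<exists>b\<in>E. ?P b \<and> (\<forall>c\<in>E. ?P c \<longrightarrow> c = b))"
    unfolding at_new[OF fv_only_fm[OF assms(1,2)]] only
    by (simp only: E_ex)
  also have "\<dots> \<longleftrightarrow> b = (if \<exists>!b. b \<in> E \<and> ?P b then THE b. b \<in> E \<and> ?P b else fint M k [])"
    by (rule unique_or_default) fact
  finally show ?thesis .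
qed

text \<open>After totalization the only remaining debt besides the axioms is that the default lies
  in the domain. A function then has to be computed only where an axiom needs its value, so its
  graph may be arbitrary at other nonstandard arguments.\<close>

theorem interpretable_totalI:
  fixes LU :: "('g::countable, 's::countable) lang"
  assumes "is_theory LU U" "is_theory LV V"
    and k: "farity LU k = 0"
    and \<delta>: "wf_fm LU \<delta>" "fv_fm \<delta> \<subseteq> {0}"
    and F: "\<And>f. wf_fm LU (F f)" "\<And>f. fv_fm (F f) \<subseteq> {..farity LV f}"
    and R: "\<And>r. wf_fm LU (R r)" "\<And>r. fv_fm (R r) \<subseteq> {..<rarity LV r}"
    and default: "\<And>D (M :: ('g tm set, 'g, 's) struct). is_model LU U D M \<Longrightarrow>
      fint M k [] \<in> {a \<in> D. rsat D M (\<lambda>_. a) \<delta>}"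
    and axioms: "\<And>D (M :: ('g tm set, 'g, 's) struct) E N p e.
      is_model LU U D M \<Longrightarrow> E = {a \<in> D. rsat D M (\<lambda>_. a) \<delta>} \<Longrightarrow>
      (\<And>f as. length as = farity LV f \<Longrightarrow> set as \<subseteq> E \<Longrightarrow> fint N f as =
         (if \<exists>!b. b \<in> E \<and> rsat D M ((!) (as @ [b])) (F f)
          then THE b. b \<in> E \<and> rsat D M ((!) (as @ [b])) (F f) else fint M k [])) \<Longrightarrow>
      (\<And>r as. rint N r as \<longleftrightarrow> rsat D M ((!) as) (R r)) \<Longrightarrow>
      p \<in> V \<Longrightarrow> rsat E N e p"
  shows "interpretable LV V LU U"
proof -
  define \<tau> where "\<tau> = \<lparr>dom_fm = \<delta>, fun_fm = \<lambda>f. total_fm \<delta> k (farity LV f) (F f), rel_fm = R\<rparr>"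
  let ?E = "\<lambda>D (M :: ('g tm set, 'g, 's) struct). {a \<in> D. rsat D M (\<lambda>_. a) \<delta>}"
  have E: "interp_dom D M \<tau> = ?E D M" for D M
    by (simp add: interp_dom_def \<tau>_def)
  let ?v = "\<lambda>D M f as. if \<exists>!b. b \<in> ?E D M \<and> rsat D M ((!) (as @ [b])) (F f)
          then THE b. b \<in> ?E D M \<and> rsat D M ((!) (as @ [b])) (F f) else fint M k []"
  have v: "rsat D M ((!) (as @ [b])) (fun_fm \<tau> f) \<longleftrightarrow> b = ?v D M f as"
    if "is_model LU U D M" "length as = farity LV f" "b \<in> ?E D M" for D M f as b
    using rsat_total_fm[OF \<delta>(2) F(2) that(2) refl default[OF that(1)] that(3)]
    by (simp add: \<tau>_def)
  have v_in: "?v D M f as \<in> ?E D M" if "is_model LU U D M" for D M f as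
    using default[OF that] theI'[of "\<lambda>b. b \<in> ?E D M \<and> rsat D M ((!) (as @ [b])) (F f)"] by auto
  show ?thesis
  proof (rule interpretableI[where \<tau> = \<tau>])
    show "is_translation LV LU \<tau>"
      using \<delta> F R k by (simp add: is_translation_def \<tau>_def wf_total_fm fv_total_fm)
  next
    fix D and M :: "('g tm set, 'g, 's) struct" assume M: "is_model LU U D M"
    show "interp_dom D M \<tau> \<noteq> {}"
      using default[OF M] E by blast
    fix f and as :: "'g tm set list" assume as: "length as = farity LV f"
    then show ex1: "\<exists>!b. b \<in> interp_dom D M \<tau> \<and> rsat D M ((!) (as @ [b])) (fun_fm \<tau> f)"
      unfolding E using v[OF M as] v_in[OF M, of as f]
      by (intro ex1I[of _ "?v D M f as"]) blast+
  next
    fix D and M :: "('g tm set, 'g, 's) struct" and p e assume M: "is_model LU U D M" and p: "p \<in> V"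
    have "fint (interp_struct D M \<tau>) f as = ?v D M f as" if "length as = farity LV f" for f as
    proof -
      have "(THE b. b \<in> ?E D M \<and> rsat D M ((!) (as @ [b])) (fun_fm \<tau> f)) = ?v D M f as"
        using v[OF M that] v_in[OF M, of as f] by (intro the_equality) blast+
      then show ?thesis
        by (simp only: interp_struct_def E struct.simps)
    qed
    moreover have "rint (interp_struct D M \<tau>) r as \<longleftrightarrow> rsat D M ((!) as) (R r)" for r as
      by (simp add: interp_struct_def \<tau>_def)
    ultimately show "rsat (interp_dom D M \<tau>) (interp_struct D M \<tau>) e p"
      using axioms[OF M E _ _ p] by (simp add: E)
  qed fact+
qed

lemma fv_app_fm:
  assumes "x \<in> fv_fm (app_fm p ts)" "fv_fm p \<subseteq> {..<length ts}"
  shows "\<exists>t\<in>set ts. x \<in> fv_tm t"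
  using assms by (force simp: app_fm_def dest!: fv_subst_fm split: if_splits)

lemma if_ex1_eq: "b \<in> E \<Longrightarrow> (\<And>c. c \<in> E \<Longrightarrow> P c \<longleftrightarrow> c = b) \<Longrightarrow>
    (if \<exists>!c. c \<in> E \<and> P c then THE c. c \<in> E \<and> P c else k) = b"
proof -
  assume *: "b \<in> E" "\<And>c. c \<in> E \<Longrightarrow> P c \<longleftrightarrow> c = b"
  then have "c \<in> E \<and> P c \<longleftrightarrow> c = b" for c by blast
  then show ?thesis by simp
qed

lemma if_ex1_default: "(\<And>c. c \<in> E \<Longrightarrow> \<not> P c) \<Longrightarrow>
    (if \<exists>!c. c \<in> E \<and> P c then THE c. c \<in> E \<and> P c else k) = k"
  by (rule if_not_P) blast

text \<open>Connectives other than \<open>Imp\<close> and \<open>All\<close> are abbreviations.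
  Rewriting implications as disjunctions sends the satisfaction of a long formula and the predicate
  it should express to a common normal form.\<close>

lemmas rsat_unfold = rsat.simps eval_tm.simps list.map nat.case eval_nat_numeral BitM.simps
  One_nat_def simp_thms not_not ball_simps(10) bex_simps(8) de_Morgan_conj de_Morgan_disj
  imp_conv_disj disj_assoc conj_assoc

instance hfun :: countable
  by countable_datatype

instance hrel :: countable
  by countable_datatype

instance rfun :: countable
  by countable_datatype

instance rrel :: countable
  by countable_datatype


section \<open>Closed terms and their values\<close>

lemma hval_factors: "hval t = HFM (image_mset hval (mset (factors t)))"
  by (induction t) (auto simp: hempty_def hsing_def hplus_def)

lemma hval_nf: "hval (nf rk t) = hval t"
proof (induction t)
  case (CUplus s t)
  have elems: "elems (hval t) = image_mset hval (mset (factors t))" for t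
    by (subst hval_factors) simp
  have "hval (nf rk (CUplus s t)) =
      HFM (image_mset hval (mset (factors (nf rk s))) + image_mset hval (mset (factors (nf rk t))))"
    by (simp add: hval_build)
  also have "\<dots> = hplus (hval (nf rk s)) (hval (nf rk t))"
    by (simp only: hplus_def elems)
  finally show ?case using CUplus by simp
qed auto

text \<open>Turns the syntactic side condition of W1 into one about multisets: normalization keeps
  the value, and a normal term is determined by its value.\<close>

lemma nf_eq_iff:
  assumes "inj rk"
  shows "nf rk s = nf rk t \<longleftrightarrow> hval s = hval t"
  using normal_hval_eq[OF assms normal_nf normal_nf] hval_nf by metis

lemma ex_hval: "\<exists>t. hval t = m"
proof (induction m)
  case (HFM A)
  then obtain f where f: "\<And>x. x \<in># A \<Longrightarrow> hval (f x) = x" by metis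
  obtain xs where xs: "mset xs = A" using ex_mset by blast
  then have "map (\<lambda>x. hval (f x)) xs = xs"
    using f by (auto intro: map_idI)
  then have "hval (build (map f xs)) = HFM A"
    using xs by (simp add: hval_build o_def)
  then show ?case ..
qed

text \<open>Lets the disjunction in W2 be read as running over multisets; each of them is named by
  the normal form of any term for it.\<close>

lemma hval_hull: "hval ` hull rk t = {x. hsub x (hval t)}"
proof
  show "{x. hsub x (hval t)} \<subseteq> hval ` hull rk t"
  proof
    fix x assume x: "x \<in> {x. hsub x (hval t)}"
    obtain s where "hval s = x" using ex_hval by blast
    then show "x \<in> hval ` hull rk t"
      using x normal_nf[of rk s] hval_nf[of rk s] by (auto simp: hull_altdef intro!: image_eqI[of _ _ "nf rk s"])
  qed
qed (auto simp: hull_altdef)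

lemma hsub_HFM: "hsub x (HFM A) \<longleftrightarrow> x = HFM A \<or> (\<exists>u\<in>#A. hsub x u)"
  by (subst hsub.simps) (auto simp: hmem1_iff)

lemma hsub_refl [simp]: "hsub x x"
  by (subst hsub.simps) simp


section \<open>Multisets as products of Fermat numbers\<close>

text \<open>Kept apart from \<open>fermat\<close> because the towers, not the Fermat numbers, obey a
  recursion by squaring alone, which is what arithmetic has to define.\<close>

definition tower :: "nat \<Rightarrow> nat" where
  "tower n = 2 ^ 2 ^ n"

definition fermat :: "nat \<Rightarrow> nat" where
  "fermat n = Suc (tower n)"

lemma tower_0 [simp]: "tower 0 = 2" and tower_Suc: "tower (Suc n) = tower n * tower n"
  by (auto simp: tower_def power_mult power2_eq_square mult.commute[of 2])

lemma less_tower: "n < tower n"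
proof -
  have "n < 2 ^ n" by simp
  also have "\<dots> < tower n" unfolding tower_def by simp
  finally show ?thesis .
qed

text \<open>The square of \<open>tower m\<close> minus 1 is \<open>fermat m\<close> times
  \<open>tower m - 1\<close>, which gives remainder 1; further squarings preserve it.\<close>

lemma tower_fermat:
  assumes "m < n"
  shows "\<exists>q. tower n = fermat m * q + 1"
  using assms
proof (induction n)
  case (Suc n)
  show ?case
  proof (cases "m = n")
    case True
    obtain k where "tower n = Suc k"
      using less_tower[of n] by (cases "tower n") auto
    then have "tower (Suc n) = fermat n * k + 1"
      by (simp add: tower_Suc fermat_def algebra_simps)
    then show ?thesis using True by blast
  next
    case False
    then obtain q where "tower n = fermat m * q + 1" using Suc by auto
    then have "tower (Suc n) = fermat m * (fermat m * q * q + 2 * q) + 1"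
      by (simp add: tower_Suc algebra_simps)
    then show ?thesis by blast
  qed
qed simp

text \<open>\<open>fermat n\<close> is 2 more than a multiple of \<open>fermat m\<close>, so a
  common divisor divides 2, and Fermat numbers are odd.\<close>

lemma coprime_fermat_less:
  assumes "m < n"
  shows "coprime (fermat m) (fermat n)"
proof (rule coprimeI)
  fix c assume c: "c dvd fermat m" "c dvd fermat n"
  obtain q where "tower n = fermat m * q + 1"
    using tower_fermat[OF assms] by blast
  then have "c dvd fermat m * q + 2"
    using c(2) by (simp add: fermat_def)
  then have "c dvd 2"
    using c(1) by (meson dvd_add_right_iff dvd_mult2)
  then have "c = 1 \<or> c = 2"
    by (meson two_is_prime_nat prime_nat_iff)
  moreover have "odd (fermat m)"
    by (simp add: fermat_def tower_def)
  ultimately show "is_unit c"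
    using c(1) by auto
qed

lemma coprime_fermat: "m \<noteq> n \<Longrightarrow> coprime (fermat m) (fermat n)"
  by (metis coprime_commute coprime_fermat_less linorder_neq_iff)

lemma fermat_gt_1: "1 < fermat n"
  using less_tower[of n] by (simp add: fermat_def)

primrec code :: "hfm \<Rightarrow> nat" where
  "code (HFM A) = prod_mset (image_mset fermat (image_mset code A))"

lemma code_hempty [simp]: "code hempty = 1"
  by (simp add: hempty_def)

lemma code_hsing [simp]: "code (hsing x) = fermat (code x)"
  by (simp add: hsing_def)

lemma code_hplus [simp]: "code (hplus x y) = code x * code y"
  by (cases x; cases y) (simp add: hplus_def)

lemma code_pos: "0 < code x"
  by (cases x) (auto simp: prod_mset_zero_iff fermat_def intro!: gr0I)

lemma fermat_dvd_prod: "fermat u dvd prod_mset (image_mset fermat B) \<longleftrightarrow> u \<in># B"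
proof
  assume dvd: "fermat u dvd prod_mset (image_mset fermat B)"
  show "u \<in># B"
  proof (rule ccontr)
    assume "u \<notin># B"
    then have "coprime (fermat u) (prod_mset (image_mset fermat B))"
      by (induction B) (auto simp: coprime_fermat)
    then have "is_unit (fermat u)"
      using dvd coprime_absorb_left by blast
    then show False using fermat_gt_1[of u] by simp
  qed
qed (auto intro: dvd_prod_mset)

lemma fermat_dvd_code: "fermat u dvd code x \<longleftrightarrow> (\<exists>y\<in>#elems x. u = code y)"
  by (cases x) (auto simp: fermat_dvd_prod)

text \<open>Passing from an element to a multiset raises the code, which makes the chains of the
  interpreted order finite below a standard bound.\<close>

lemma fermat_dvd_imp_less: "fermat u dvd v \<Longrightarrow> 0 < v \<Longrightarrow> u < v"
  using dvd_imp_le[of "fermat u" v] less_tower[of u] by (simp add: fermat_def)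

text \<open>\<open>fermat_dvd_prod\<close> finds each factor of one product among the factors of the
  other, and it cancels because Fermat numbers are positive.\<close>

lemma inj_prod_fermat:
  "prod_mset (image_mset fermat A) = prod_mset (image_mset fermat B) \<Longrightarrow> A = B"
proof (induction A arbitrary: B)
  case empty
  then have "prod_mset (image_mset fermat B) = 1" by simp
  then have "u \<notin># B" for u
    using fermat_dvd_prod[of u B] fermat_gt_1[of u] by auto
  then show ?case by (metis multiset_nonemptyE)
next
  case (add x A)
  have "x \<in># B"
    using fermat_dvd_prod[of x B] fermat_dvd_prod[of x "add_mset x A"] unfolding add.prems by simp
  then obtain C where C: "B = add_mset x C" by (metis multi_member_split)
  moreover have "fermat x \<noteq> 0" by (simp add: fermat_def)
  ultimately have "A = C"
    using add by simp
  then show ?case using C by simp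
qed

lemma code_inj: "code x = code y \<Longrightarrow> x = y"
proof (induction x arbitrary: y)
  case (HFM A)
  obtain B where y: "y = HFM B" by (cases y)
  have eq: "image_mset code A = image_mset code B"
    using HFM.prems y inj_prod_fermat by simp
  \<comment> \<open>The induction hypothesis gives injectivity only at elements of \<open>A\<close>,
    so the two multisets are matched element by element.\<close>
  have "A = B" using eq HFM.IH
  proof (induction A arbitrary: B)
    case (add x A)
    have "code x \<in># image_mset code B"
      using add.prems(1)[symmetric] by simp
    then obtain z where "z \<in># B" "code z = code x" by auto
    then have "x \<in># B" using add.prems(2)[of x z] by auto
    then obtain C where C: "B = add_mset x C" by (metis multi_member_split)
    then have "A = C"
      using add.prems by (intro add.IH) auto
    then show ?case using C by simp
  qed auto
  then show ?case using y by simp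
qed


section \<open>Goedel's coding of finite sets\<close>

text \<open>A common prime factor of the moduli divides \<open>(j - i) * d\<close>, hence
  \<open>d\<close> because \<open>j - i\<close> divides \<open>d\<close>, and then it divides
  1.\<close>

lemma coprime_moduli:
  assumes "i < j" "j - i dvd d"
  shows "coprime (Suc (Suc i * d)) (Suc (Suc j * d))"
proof (rule ccontr)
  assume "\<not> coprime (Suc (Suc i * d)) (Suc (Suc j * d))"
  then have "gcd (Suc (Suc i * d)) (Suc (Suc j * d)) \<noteq> 1"
    by (simp only: coprime_iff_gcd_eq_1 not_False_eq_True)
  from prime_factor_nat[OF this]
  obtain p where p: "prime p" "p dvd Suc (Suc i * d)" "p dvd Suc (Suc j * d)"
    by (auto simp only: gcd_greatest_iff)
  have "p dvd Suc (Suc j * d) - Suc (Suc i * d)"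
    using p(3,2) by (rule dvd_diff_nat)
  also have "Suc (Suc j * d) - Suc (Suc i * d) = (j - i) * d"
    by (simp add: diff_mult_distrib)
  finally have "p dvd d"
    using p(1) assms(2) by (auto simp: prime_dvd_mult_iff intro: dvd_trans)
  then have "p dvd Suc i * d" by simp
  with p(2) have "p dvd 1"
    by (metis dvd_add_right_iff Suc_eq_plus1)
  then show False using p(1) by auto
qed

text \<open>For sets, unlike sequences, the product of the moduli of the members is already a code,
  without Chinese remainders. With \<open>d = fact k\<close> all differences of indices up to
  \<open>k\<close> divide \<open>d\<close>; the factor \<open>Suc u\<close> instead of
  \<open>u\<close> keeps the modulus of 0 above 1.\<close>

lemma finite_set_code:
  fixes F :: "nat set"
  shows "\<exists>a d. \<forall>u\<le>k. Suc (Suc u * d) dvd a \<longleftrightarrow> u \<in> F"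
proof (intro exI allI impI)
  let ?d = "fact k :: nat" and ?G = "F \<inter> {..k}"
  let ?m = "\<lambda>u. Suc (Suc u * ?d)"
  fix u assume u: "u \<le> k"
  show "?m u dvd (\<Prod>i\<in>?G. ?m i) \<longleftrightarrow> u \<in> F"
  proof
    assume dvd: "?m u dvd (\<Prod>i\<in>?G. ?m i)"
    show "u \<in> F"
    proof (rule ccontr)
      assume "u \<notin> F"
      have "coprime (?m u) (?m i)" if "i \<in> ?G" for i
      proof (cases "u < i")
        case True
        then show ?thesis using that by (intro coprime_moduli dvd_fact) auto
      next
        case False
        then have "i < u" using that \<open>u \<notin> F\<close> by (cases "u = i") auto
        then have "coprime (?m i) (?m u)" using u by (intro coprime_moduli dvd_fact) auto
        then show ?thesis by (simp only: coprime_commute)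
      qed
      then have "coprime (?m u) (\<Prod>i\<in>?G. ?m i)"
        by (rule prod_coprime_right)
      then have "is_unit (?m u)"
        using dvd coprime_absorb_left by blast
      then show False by simp
    qed
  next
    assume "u \<in> F"
    then show "?m u dvd (\<Prod>i\<in>?G. ?m i)"
      using u by (intro dvd_prodI) auto
  qed
qed


section \<open>Interpretation of multisets in arithmetic\<close>

text \<open>The sum \<open>i + v\<close> can be recovered because adding
  \<open>i \<le> i + v\<close> to its square stays below the next square.\<close>

lemma pair_inj:
  fixes i v j w :: nat
  assumes "(i + v) * (i + v) + i = (j + w) * (j + w) + j"
  shows "i = j \<and> v = w"
proof -
  have *: "a * a + i < b * b + j" if "a < b" "i \<le> a" for a b i j :: nat
  proof -
    have "a * a + i < Suc a * Suc a" using that by simp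
    also have "\<dots> \<le> b * b" using that by (intro mult_le_mono) auto
    finally show ?thesis by simp
  qed
  have "i + v = j + w"
    using *[of "i + v" "j + w" i j] *[of "j + w" "i + v" j i] assms
    by (cases "i + v" "j + w" rule: linorder_cases) auto
  then show ?thesis using assms by simp
qed

lemma hsub_elem: "y \<in># elems x \<Longrightarrow> hsub x m \<Longrightarrow> hsub y m"
proof (induction m arbitrary: x)
  case (HFM A)
  then show ?case by (auto simp: hsub_HFM intro: hsub_refl)
qed

text \<open>\<open>hsub\<close> descends from \<open>m\<close>; here it is unfolded at
  \<open>x\<close> instead, the direction in which the coded chains of \<open>sub_fm\<close>
  climb.\<close>

lemma hsub_cases_top: "hsub x m \<Longrightarrow> x = m \<or> (\<exists>y. x \<in># elems y \<and> hsub y m)"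
proof (induction m)
  case (HFM A)
  then consider "x = HFM A" | u where "u \<in># A" "hsub x u"
    by (auto simp: hsub_HFM)
  then show ?case
  proof cases
    case 2
    from HFM.IH[OF this] show ?thesis
    proof
      assume "x = u"
      then show ?thesis using 2 by (intro disjI2 exI[of _ "HFM A"]) simp
    next
      assume "\<exists>y. x \<in># elems y \<and> hsub y u"
      then show ?thesis using 2 by (auto simp: hsub_HFM)
    qed
  qed simp
qed

text \<open>Keeps all subterms of \<open>m\<close> within reach of quantifiers bounded by
  \<open>code m\<close>.\<close>

lemma code_mono: "hsub x m \<Longrightarrow> code x \<le> code m"
proof (induction m)
  case (HFM A)
  then consider "x = HFM A" | u where "u \<in># A" "hsub x u"
    by (auto simp: hsub_HFM)
  then show ?case
  proof cases
    case 2
    then have "code u < code (HFM A)"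
      by (intro fermat_dvd_imp_less[OF _ code_pos]) (auto simp only: fermat_dvd_code hfm.sel)
    then show ?thesis using HFM.IH[OF 2] by simp
  qed simp
qed

section \<open>Arithmetical formulas for the interpretation\<close>

abbreviation "r0 \<equiv> Fn Zero []"
abbreviation "rS t \<equiv> Fn Succ [t]"
abbreviation "rplus s t \<equiv> Fn Plus [s, t]"
abbreviation "rtimes s t \<equiv> Fn Times [s, t]"
abbreviation "rle s t \<equiv> Rel Leq [s, t]"

definition pair_tm :: "rfun tm \<Rightarrow> rfun tm \<Rightarrow> rfun tm" where
  "pair_tm s t = rplus (rtimes (rplus s t) (rplus s t)) s"

text \<open>
  A number \<open>b\<close> is good if it is comparable with every number and multiplication below \<open>b\<close> behaves
  like that of a commutative monoid with zero.  All numerals are good, and good numbers are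
  linearly ordered, so that the numbers below good ones form a definable initial segment on which
  truncated multiplication is a commutative monoid.
\<close>

definition good_fm :: "(rfun, rrel) fm" where
  "good_fm =
     And (All (Or (rle (Var 0) (Var 1)) (rle (Var 1) (Var 0))))
    (And (All (All (Imp (rle (Var 1) (Var 2)) (Imp (rle (Var 0) (Var 1)) (rle (Var 0) (Var 2))))))
    (And (All (Imp (rle (Var 0) (Var 1))
           (And (Eq (rtimes r0 (Var 0)) r0) (Eq (rtimes (Var 0) (rS r0)) (Var 0)))))
         (All (All (All (Imp (rle (Var 2) (Var 3)) (Imp (rle (Var 1) (Var 3)) (Imp (rle (Var 0) (Var 3))
           (Imp (rle (rtimes (Var 2) (Var 1)) (Var 3))
             (And (Eq (rtimes (Var 2) (Var 1)) (rtimes (Var 1) (Var 2)))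
               (Imp (rle (rtimes (rtimes (Var 2) (Var 1)) (Var 0)) (Var 3))
                 (Imp (Neg (Eq (rtimes (rtimes (Var 2) (Var 1)) (Var 0)) r0))
                   (And (rle (rtimes (Var 1) (Var 0)) (Var 3))
                     (Eq (rtimes (Var 2) (rtimes (Var 1) (Var 0)))
                         (rtimes (rtimes (Var 2) (Var 1)) (Var 0))))))))))))))))"

definition dom_R :: "(rfun, rrel) fm" where
  "dom_R = Ex (And good_fm (rle (Var 1) (Var 0)))"

text \<open>Goedel's membership: \<open>1 + (u + 1) * d\<close> divides \<open>a\<close>, with
  \<open>u\<close>, \<open>a\<close>, \<open>d\<close> at the indices 0, 1, 2. The quotient is
  bounded by \<open>a\<close>, so that for a standard \<open>a\<close> only numerals are
  candidates.\<close>

definition mem_fm :: "(rfun, rrel) fm" where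
  "mem_fm = Ex (And (rle (Var 0) (Var 2))
     (Eq (rtimes (Var 0) (rS (rtimes (rS (Var 1)) (Var 3)))) (Var 2)))"

text \<open>
  The singleton of \<open>x\<close> is the \<open>x\<close>-th Fermat number: some coded set consists of pairs \<open>(i, v)\<close> that
  are \<open>(0, 2)\<close> or arise from a pair \<open>(j, t)\<close> in the set as \<open>(j + 1, t\<^sup>2)\<close>, and it contains \<open>(x, w)\<close>
  where \<open>w + 1\<close> is the value.
\<close>

definition sing_fm :: "(rfun, rrel) fm" where
  "sing_fm = Ex (Ex (Ex (And (rle (Var 3) (Var 2)) (And
     (Ex (And (rle (Var 0) (Var 3)) (And (Eq (Var 5) (rS (Var 0)))
       (app_fm mem_fm [pair_tm (Var 4) (Var 0), Var 2, Var 1]))))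
     (All (All (Imp (rle (Var 1) (Var 4)) (Imp (rle (Var 0) (Var 4))
       (Imp (app_fm mem_fm [pair_tm (Var 1) (Var 0), Var 3, Var 2])
         (Or (And (Eq (Var 1) r0) (Eq (Var 0) (rS (rS r0))))
           (Ex (Ex (And (rle (Var 1) (Var 3)) (And (rle (Var 1) (Var 6)) (And (rle (Var 0) (Var 6))
             (And (Eq (Var 3) (rS (Var 1))) (And (Eq (Var 2) (rtimes (Var 0) (Var 0)))
               (app_fm mem_fm [pair_tm (Var 1) (Var 0), Var 5, Var 4]))))))))))))))))))"

text \<open>
  \<open>x\<close> is below \<open>y\<close> if it belongs to a coded set each of whose elements is \<open>y\<close> or an element, in the
  sense of multisets, of another member of the set.
\<close>

definition sub_fm :: "(rfun, rrel) fm" where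
  "sub_fm = And (rle (Var 0) (Var 1)) (Ex (Ex (And (app_fm mem_fm [Var 2, Var 1, Var 0])
     (All (Imp (rle (Var 0) (Var 4)) (Imp (app_fm mem_fm [Var 0, Var 2, Var 1])
       (Or (Eq (Var 0) (Var 4))
         (Ex (Ex (Ex (And (rle (Var 2) (Var 7)) (And (app_fm mem_fm [Var 2, Var 5, Var 4])
           (And (rle (Var 1) (Var 2)) (And (rle (Var 0) (Var 2)) (And (app_fm sing_fm [Var 3, Var 1])
             (Eq (rtimes (Var 1) (Var 0)) (Var 2)))))))))))))))))"

lemma wf_R [simp]:
  "wf_fm L_R good_fm" "wf_fm L_R dom_R" "wf_fm L_R mem_fm" "wf_fm L_R sing_fm" "wf_fm L_R sub_fm"
proof -
  show good: "wf_fm L_R good_fm"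
    by (simp add: good_fm_def L_R_def)
  then show "wf_fm L_R dom_R"
    by (simp add: dom_R_def) (simp add: L_R_def)
  show mem: "wf_fm L_R mem_fm"
    by (simp add: mem_fm_def L_R_def)
  have app: "wf_fm L_R (app_fm p ts)" if "wf_fm L_R p" "list_all (wf_tm L_R) ts" for p ts
    using that by (intro wf_app_fm) (auto simp: list_all_iff)
  show sing: "wf_fm L_R sing_fm"
    using app[OF mem] by (simp add: sing_fm_def pair_tm_def) (simp add: L_R_def)
  show "wf_fm L_R sub_fm"
    using app[OF mem] app[OF sing] by (simp add: sub_fm_def) (simp add: L_R_def)
qed

lemma fv_dom_R: "fv_fm dom_R \<subseteq> {0}"
  by (auto simp: dom_R_def good_fm_def)

lemma fv_mem_fm: "fv_fm mem_fm \<subseteq> {..<3}"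
  by (auto simp: mem_fm_def)

lemma fv_app_mem: "x \<in> fv_fm (app_fm mem_fm [s, t, u]) \<Longrightarrow> x \<in> fv_tm s \<or> x \<in> fv_tm t \<or> x \<in> fv_tm u"
  using fv_app_fm[of x mem_fm "[s, t, u]"] fv_mem_fm by (auto simp: numeral_3_eq_3)

lemma fv_sing_fm: "fv_fm sing_fm \<subseteq> {..<2}"
  by (auto simp: sing_fm_def pair_tm_def dest!: fv_app_mem)

lemma fv_app_sing: "x \<in> fv_fm (app_fm sing_fm [s, t]) \<Longrightarrow> x \<in> fv_tm s \<or> x \<in> fv_tm t"
  using fv_app_fm[of x sing_fm "[s, t]"] fv_sing_fm by (auto simp: numeral_2_eq_2)

lemma fv_sub_fm: "fv_fm sub_fm \<subseteq> {..<2}"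
  by (auto simp: sub_fm_def dest!: fv_app_mem fv_app_sing)

section \<open>Models of R\<close>

locale R_model =
  fixes D :: "'a set" and M :: "('a, rfun, rrel) struct"
  assumes model: "is_model L_R theory_R D M"
begin

abbreviation "Z \<equiv> fint M Zero []"
abbreviation "S x \<equiv> fint M Succ [x]"
abbreviation "pl x y \<equiv> fint M Plus [x, y]"
abbreviation "tm x y \<equiv> fint M Times [x, y]"
abbreviation "le x y \<equiv> rint M Leq [x, y]"

primrec nv :: "nat \<Rightarrow> 'a" where
  "nv 0 = Z"
| "nv (Suc n) = S (nv n)"

lemma eval_num: "eval_tm M e (num n) = nv n"
  by (induction n) auto

lemma closed: "length as = rfun_arity f \<Longrightarrow> set as \<subseteq> D \<Longrightarrow> fint M f as \<in> D"
  using model by (simp add: is_model_def L_R_def)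

lemma closed_simps [simp]:
  "Z \<in> D" "x \<in> D \<Longrightarrow> S x \<in> D" "x \<in> D \<Longrightarrow> y \<in> D \<Longrightarrow> pl x y \<in> D" "x \<in> D \<Longrightarrow> y \<in> D \<Longrightarrow> tm x y \<in> D"
  using closed[of "[]" Zero] closed[of "[x]" Succ] closed[of "[x, y]" Plus] closed[of "[x, y]" Times]
  by auto

lemma nv_in [simp]: "nv n \<in> D"
  by (induction n) auto

lemma axiom: "p \<in> theory_R \<Longrightarrow> rsat D M (\<lambda>_. Z) p"
  using model by (auto simp: is_model_def)

lemma nv_plus [simp]: "pl (nv n) (nv m) = nv (n + m)"
  using axiom[of "Eq (Fn Plus [num n, num m]) (num (n + m))"]
  by (auto simp: theory_R_def eval_num)

lemma nv_times [simp]: "tm (nv n) (nv m) = nv (n * m)"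
  using axiom[of "Eq (Fn Times [num n, num m]) (num (n * m))"]
  by (auto simp: theory_R_def eval_num)

lemma nv_eq_iff [simp]: "nv n = nv m \<longleftrightarrow> n = m"
  using axiom[of "Neg (Eq (num n) (num m))"]
  by (auto simp: theory_R_def eval_num)

lemma le_nv: "x \<in> D \<Longrightarrow> le x (nv n) \<longleftrightarrow> (\<exists>i\<le>n. x = nv i)"
  using axiom[of "All (Iff (Rel Leq [Var 0, num n]) (Disj (map (\<lambda>i. Eq (Var 0) (num i)) [0..<Suc n])))"]
  by (force simp: theory_R_def eval_num less_Suc_eq_le simp del: upt_Suc)

lemma le_nv_nv [simp]: "le (nv m) (nv n) \<longleftrightarrow> m \<le> n"
  by (auto simp: le_nv)

lemma le_nv_or: "x \<in> D \<Longrightarrow> le x (nv n) \<or> le (nv n) x"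
  using axiom[of "All (Or (Rel Leq [Var 0, num n]) (Rel Leq [num n, Var 0]))"]
  by (force simp: theory_R_def eval_num)

lemma nv_folds: "Z = nv 0" "S (nv n) = nv (Suc n)"
  by auto

text \<open>Evaluates bounded quantifiers at standard bounds: R leaves nothing but numerals below a
  numeral.\<close>

lemma ex_le_nv: "(\<exists>x\<in>D. le x (nv n) \<and> P x) \<longleftrightarrow> (\<exists>i\<le>n. P (nv i))"
  using nv_in by (auto simp: le_nv)

section \<open>Good numbers and truncated multiplication\<close>

definition good :: "'a \<Rightarrow> bool" where
  "good b \<longleftrightarrow>
     (\<forall>c\<in>D. le c b \<or> le b c) \<and>
     (\<forall>c\<in>D. \<forall>d\<in>D. le c b \<longrightarrow> le d c \<longrightarrow> le d b) \<and>
     (\<forall>x\<in>D. le x b \<longrightarrow> tm Z x = Z \<and> tm x (S Z) = x) \<and>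
     (\<forall>x\<in>D. \<forall>y\<in>D. \<forall>z\<in>D. le x b \<longrightarrow> le y b \<longrightarrow> le z b \<longrightarrow> le (tm x y) b \<longrightarrow>
        tm x y = tm y x \<and>
        (le (tm (tm x y) z) b \<longrightarrow> tm (tm x y) z \<noteq> Z \<longrightarrow>
           le (tm y z) b \<and> tm x (tm y z) = tm (tm x y) z))"

lemma rsat_good: "rsat D M e good_fm \<longleftrightarrow> good (e 0)"
  unfolding good_fm_def good_def by (simp only: rsat_unfold)

lemma goodD:
  assumes "good b"
  shows good_linear: "c \<in> D \<Longrightarrow> le c b \<or> le b c"
    and good_trans: "c \<in> D \<Longrightarrow> d \<in> D \<Longrightarrow> le c b \<Longrightarrow> le d c \<Longrightarrow> le d b"
    and good_zero: "x \<in> D \<Longrightarrow> le x b \<Longrightarrow> tm Z x = Z"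
    and good_unit: "x \<in> D \<Longrightarrow> le x b \<Longrightarrow> tm x (S Z) = x"
    and good_comm: "x \<in> D \<Longrightarrow> y \<in> D \<Longrightarrow> le x b \<Longrightarrow> le y b \<Longrightarrow> le (tm x y) b \<Longrightarrow> tm x y = tm y x"
    and good_assoc: "x \<in> D \<Longrightarrow> y \<in> D \<Longrightarrow> z \<in> D \<Longrightarrow> le x b \<Longrightarrow> le y b \<Longrightarrow> le z b \<Longrightarrow>
      le (tm x y) b \<Longrightarrow> le (tm (tm x y) z) b \<Longrightarrow> tm (tm x y) z \<noteq> Z \<Longrightarrow>
      le (tm y z) b \<and> tm x (tm y z) = tm (tm x y) z"
proof -
  have a: "\<forall>c\<in>D. le c b \<or> le b c"
    and b: "\<forall>c\<in>D. \<forall>d\<in>D. le c b \<longrightarrow> le d c \<longrightarrow> le d b"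
    and c: "\<forall>x\<in>D. le x b \<longrightarrow> tm Z x = Z \<and> tm x (S Z) = x"
    and d: "\<forall>x\<in>D. \<forall>y\<in>D. \<forall>z\<in>D. le x b \<longrightarrow> le y b \<longrightarrow> le z b \<longrightarrow> le (tm x y) b \<longrightarrow>
        tm x y = tm y x \<and>
        (le (tm (tm x y) z) b \<longrightarrow> tm (tm x y) z \<noteq> Z \<longrightarrow>
           le (tm y z) b \<and> tm x (tm y z) = tm (tm x y) z)"
    using assms unfolding good_def by - (elim conjE, assumption)+
  show "c \<in> D \<Longrightarrow> le c b \<or> le b c" using a by (rule bspec)
  show "c \<in> D \<Longrightarrow> d \<in> D \<Longrightarrow> le c b \<Longrightarrow> le d c \<Longrightarrow> le d b"
    by (rule b[rule_format])
  show "x \<in> D \<Longrightarrow> le x b \<Longrightarrow> tm Z x = Z" "x \<in> D \<Longrightarrow> le x b \<Longrightarrow> tm x (S Z) = x"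
    using c by simp_all
  show "x \<in> D \<Longrightarrow> y \<in> D \<Longrightarrow> le x b \<Longrightarrow> le y b \<Longrightarrow> le (tm x y) b \<Longrightarrow> tm x y = tm y x"
    by (rule d[rule_format, of x y x, THEN conjunct1])
  show "x \<in> D \<Longrightarrow> y \<in> D \<Longrightarrow> z \<in> D \<Longrightarrow> le x b \<Longrightarrow> le y b \<Longrightarrow> le z b \<Longrightarrow>
      le (tm x y) b \<Longrightarrow> le (tm (tm x y) z) b \<Longrightarrow> tm (tm x y) z \<noteq> Z \<Longrightarrow>
      le (tm y z) b \<and> tm x (tm y z) = tm (tm x y) z"
    using d[rule_format, of x y z] by simp
qed

definition bounded :: "'a set" where
  "bounded = {x \<in> D. \<exists>b\<in>D. good b \<and> le x b}"

lemma rsat_dom_R: "{a \<in> D. rsat D M (\<lambda>_. a) dom_R} = bounded"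
  by (simp add: dom_R_def bounded_def rsat_good)

lemma good_nv: "good (nv n)"
  unfolding good_def
proof (intro conjI)
  show "\<forall>c\<in>D. le c (nv n) \<or> le (nv n) c"
    using le_nv_or by blast
  show "\<forall>c\<in>D. \<forall>d\<in>D. le c (nv n) \<longrightarrow> le d c \<longrightarrow> le d (nv n)"
    by (auto simp: le_nv)
  show "\<forall>x\<in>D. le x (nv n) \<longrightarrow> tm Z x = Z \<and> tm x (S Z) = x"
  proof (intro ballI impI)
    fix x assume "x \<in> D" "le x (nv n)"
    then obtain i where "x = nv i" by (auto simp: le_nv)
    then show "tm Z x = Z \<and> tm x (S Z) = x"
      using nv_times[of 0 i] nv_times[of i 1] by simp
  qed
  show "\<forall>x\<in>D. \<forall>y\<in>D. \<forall>z\<in>D. le x (nv n) \<longrightarrow> le y (nv n) \<longrightarrow> le z (nv n) \<longrightarrow> le (tm x y) (nv n) \<longrightarrow>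
        tm x y = tm y x \<and>
        (le (tm (tm x y) z) (nv n) \<longrightarrow> tm (tm x y) z \<noteq> Z \<longrightarrow>
           le (tm y z) (nv n) \<and> tm x (tm y z) = tm (tm x y) z)"
  proof (intro ballI impI)
    fix x y z assume "x \<in> D" "y \<in> D" "z \<in> D" "le x (nv n)" "le y (nv n)" "le z (nv n)"
    then obtain i j k where [simp]: "x = nv i" "y = nv j" "z = nv k" by (auto simp: le_nv)
    \<comment> \<open>For \<open>i = 0\<close> the product \<open>j * k\<close> may exceed
      \<open>n\<close>; this is why goodness asks for associativity only at nonzero
      products.\<close>
    have "j * k \<le> n" if "i * j * k \<le> n" "i * j * k \<noteq> 0"
    proof -
      have "j * k \<le> i * (j * k)" using that by (cases i) auto
      from this that(1)[unfolded mult.assoc] show ?thesis by (rule order_trans)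
    qed
    then show "tm x y = tm y x \<and> (le (tm (tm x y) z) (nv n) \<longrightarrow> tm (tm x y) z \<noteq> Z \<longrightarrow>
           le (tm y z) (nv n) \<and> tm x (tm y z) = tm (tm x y) z)"
      unfolding nv_folds by (simp add: ac_simps del: nv.simps)
  qed
qed

lemma nv_bounded [simp]: "nv n \<in> bounded"
  unfolding bounded_def using good_nv[of n] le_nv_nv[of n n] nv_in[of n] by blast

text \<open>Good numbers are comparable, so the larger of two good bounds serves both by
  transitivity; the laws can then be applied at one common bound.\<close>

lemma bounded_common:
  assumes "set xs \<subseteq> bounded"
  shows "\<exists>b\<in>D. good b \<and> (\<forall>x\<in>set xs. le x b)"
  using assms
proof (induction xs)
  case Nil
  then show ?case using good_nv[of 0] nv_in[of 0] by auto
next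
  case (Cons x xs)
  then obtain b where b: "b \<in> D" "good b" "\<forall>x\<in>set xs. le x b" by auto
  obtain c where c: "c \<in> D" "good c" "le x c" and x: "x \<in> D"
    using Cons.prems by (auto simp: bounded_def)
  have xs: "set xs \<subseteq> D"
    using Cons.prems by (auto simp: bounded_def)
  have "le b c \<or> le c b"
    using good_linear[OF b(2) c(1)] by blast
  then show ?case
  proof
    assume "le b c"
    then have "\<forall>y\<in>set xs. le y c"
      using b good_trans[OF c(2) b(1)] xs by blast
    then show ?thesis using c by auto
  next
    assume "le c b"
    then have "le x b"
      using good_trans[OF b(2) c(1) x] c by blast
    then show ?thesis using b by auto
  qed
qed

definition trunc :: "'a \<Rightarrow> 'a \<Rightarrow> 'a" where
  "trunc x y = (if tm x y \<in> bounded then tm x y else Z)"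

lemma Z_bounded [simp]: "Z \<in> bounded"
  using nv_bounded[of 0] by simp

lemma trunc_in [simp]: "trunc x y \<in> bounded"
  by (simp add: trunc_def)

text \<open>Goodness gives commutativity only for a product already in the segment; if neither order
  is, both truncate to \<open>Z\<close>.\<close>

lemma trunc_comm:
  assumes "x \<in> bounded" "y \<in> bounded"
  shows "trunc x y = trunc y x"
proof -
  have D: "x \<in> D" "y \<in> D" using assms by (auto simp: bounded_def)
  have *: "tm x y = tm y x" if xy: "x \<in> bounded" "y \<in> bounded" "tm x y \<in> bounded" for x y
  proof -
    obtain b where "b \<in> D" "good b" "le x b" "le y b" "le (tm x y) b"
      using bounded_common[of "[x, y, tm x y]"] xy by auto
    moreover have "x \<in> D" "y \<in> D" using xy by (auto simp: bounded_def)
    ultimately show ?thesis using good_comm by blast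
  qed
  show ?thesis
  proof (cases "tm x y \<in> bounded \<or> tm y x \<in> bounded")
    case True
    then have "tm x y = tm y x"
      by (elim disjE) (rule *[OF assms], assumption, rule *[OF assms(2,1), symmetric])
    then show ?thesis by (simp only: trunc_def)
  next
    case False
    then show ?thesis by (simp add: trunc_def)
  qed
qed

lemma trunc_unit: "x \<in> bounded \<Longrightarrow> trunc x (S Z) = x"
proof -
  assume x: "x \<in> bounded"
  then obtain b where "x \<in> D" "good b" "le x b" by (auto simp: bounded_def)
  then show ?thesis using good_unit[of b x] x by (simp add: trunc_def)
qed

lemma trunc_zero: "x \<in> bounded \<Longrightarrow> trunc Z x = Z"
proof -
  assume "x \<in> bounded"
  then obtain b where "x \<in> D" "good b" "le x b" by (auto simp: bounded_def)
  then show ?thesis using good_zero[of b x] by (simp add: trunc_def)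
qed

text \<open>A nonzero result shows that neither product on the left was truncated, since
  \<open>Z\<close> is absorbing; hence one good bound lies above all the numbers that
  \<open>good_assoc\<close> needs.\<close>

lemma trunc_assoc_nonzero:
  assumes xyz: "x \<in> bounded" "y \<in> bounded" "z \<in> bounded" and nz: "trunc (trunc x y) z \<noteq> Z"
  shows "trunc x (trunc y z) = trunc (trunc x y) z"
proof -
  have xy: "tm x y \<in> bounded" "trunc x y = tm x y"
    using nz trunc_zero[OF xyz(3)] by (auto simp: trunc_def split: if_splits)
  then have xy_z: "tm (tm x y) z \<in> bounded" "trunc (trunc x y) z = tm (tm x y) z"
    using nz by (auto simp: trunc_def split: if_splits)
  obtain b where b: "b \<in> D" "good b" "le x b" "le y b" "le z b" "le (tm x y) b" "le (tm (tm x y) z) b"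
    using bounded_common[of "[x, y, z, tm x y, tm (tm x y) z]"] xyz xy xy_z by auto
  have D: "x \<in> D" "y \<in> D" "z \<in> D" using xyz by (auto simp: bounded_def)
  have yz: "le (tm y z) b" "tm x (tm y z) = tm (tm x y) z"
    using good_assoc[OF b(2) D b(3-)] nz xy_z by auto
  then have "tm y z \<in> bounded"
    using b D by (auto simp: bounded_def)
  then show ?thesis
    using yz xy_z by (simp add: trunc_def)
qed

lemma trunc_assoc:
  assumes xyz: "x \<in> bounded" "y \<in> bounded" "z \<in> bounded"
  shows "trunc (trunc x y) z = trunc x (trunc y z)"
proof -
  have eq: "trunc (trunc z y) x = trunc x (trunc y z)" "trunc z (trunc y x) = trunc (trunc x y) z"
    using xyz by (auto simp: trunc_comm[of z y] trunc_comm[of y x] trunc_comm[of z "trunc x y"]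
      trunc_comm[of "trunc y z" x])
  show ?thesis
  proof (cases "trunc (trunc x y) z = Z")
    case False
    then show ?thesis using trunc_assoc_nonzero[OF xyz] by simp
  next
    \<comment> \<open>If the right side were nonzero, the mirrored instance at \<open>z\<close>,
      \<open>y\<close>, \<open>x\<close> would equate it with the left side by
      commutativity.\<close>
    case True
    then show ?thesis
      using trunc_assoc_nonzero[of z y x] xyz eq by metis
  qed
qed

lemma trunc_nv [simp]: "trunc (nv m) (nv n) = nv (m * n)"
  by (simp add: trunc_def)

section \<open>Coded sets, singletons and the subterm order in models of R\<close>

definition mem :: "'a \<Rightarrow> 'a \<Rightarrow> 'a \<Rightarrow> bool" where
  "mem u a d \<longleftrightarrow> (\<exists>q\<in>D. le q a \<and> tm q (S (tm (S u) d)) = a)"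

lemma rsat_mem [simp]:
  "rsat D M e (app_fm mem_fm [s, t, u]) \<longleftrightarrow> mem (eval_tm M e s) (eval_tm M e t) (eval_tm M e u)"
  by (simp add: rsat_app_fm mem_fm_def mem_def numeral_2_eq_2 numeral_3_eq_3)

lemma ex_factor: "(\<exists>q\<le>a. q * Suc m = a) \<longleftrightarrow> Suc m dvd a"
proof
  assume "Suc m dvd a"
  then obtain q where "a = Suc m * q" by blast
  then show "\<exists>q\<le>a. q * Suc m = a"
    by (intro exI[of _ q]) simp
qed (metis dvd_triv_right)

lemma mem_nv [simp]: "mem (nv u) (nv a) (nv d) \<longleftrightarrow> Suc (Suc u * d) dvd a"
proof -
  have "mem (nv u) (nv a) (nv d) \<longleftrightarrow> (\<exists>q\<le>a. q * Suc (Suc u * d) = a)"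
    unfolding mem_def ex_le_nv nv_folds nv_times nv_eq_iff ..
  also have "\<dots> \<longleftrightarrow> Suc (Suc u * d) dvd a"
    by (rule ex_factor)
  finally show ?thesis .
qed

definition pr :: "'a \<Rightarrow> 'a \<Rightarrow> 'a" where
  "pr x y = pl (tm (pl x y) (pl x y)) x"

lemma pr_nv [simp]: "pr (nv m) (nv n) = nv ((m + n) * (m + n) + m)"
  by (simp add: pr_def)

text \<open>\<open>le j i\<close> makes the predecessor of a standard index standard; the bounds by
  \<open>B\<close> allow the closure clause of \<open>sing\<close> to be applied to the predecessor
  again.\<close>

definition step_ok :: "'a \<Rightarrow> 'a \<Rightarrow> 'a \<Rightarrow> 'a \<Rightarrow> 'a \<Rightarrow> bool" where
  "step_ok B a d i v \<longleftrightarrow> i = Z \<and> v = S (S Z) \<or>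
     (\<exists>j\<in>D. \<exists>t\<in>D. le j i \<and> le j B \<and> le t B \<and> i = S j \<and> v = tm t t \<and> mem (pr j t) a d)"

definition sing :: "'a \<Rightarrow> 'a \<Rightarrow> bool" where
  "sing x z \<longleftrightarrow> (\<exists>B\<in>D. \<exists>a\<in>D. \<exists>d\<in>D. le x B \<and> (\<exists>w\<in>D. le w B \<and> z = S w \<and> mem (pr x w) a d) \<and>
     (\<forall>i\<in>D. \<forall>v\<in>D. le i B \<longrightarrow> le v B \<longrightarrow> mem (pr i v) a d \<longrightarrow> step_ok B a d i v))"

lemma rsat_sing: "rsat D M e sing_fm \<longleftrightarrow> sing (e 0) (e 1)"
  unfolding sing_fm_def sing_def step_ok_def pr_def pair_tm_def
  by (simp only: rsat_unfold rsat_mem)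

text \<open>Even if \<open>B\<close>, \<open>a\<close>, \<open>d\<close> are nonstandard, a pair
  \<open>(n, v)\<close> in the set forces \<open>v = tower n\<close> by induction on
  \<open>n\<close>: the predecessor index is a numeral, its value is a numeral by the induction
  hypothesis, and R computes the square.\<close>

lemma sing_sound:
  assumes "sing (nv n) z"
  shows "z = nv (fermat n)"
proof -
  obtain B a d w where B: "B \<in> D" and w: "le (nv n) B" "w \<in> D" "le w B" "z = S w" "mem (pr (nv n) w) a d"
    and ok: "\<And>i v. i \<in> D \<Longrightarrow> v \<in> D \<Longrightarrow> le i B \<Longrightarrow> le v B \<Longrightarrow> mem (pr i v) a d \<Longrightarrow> step_ok B a d i v"
    using assms unfolding sing_def by blast
  have "v = nv (tower n)" if "v \<in> D" "le (nv n) B" "le v B" "mem (pr (nv n) v) a d" for v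
    using that
  proof (induction n arbitrary: v rule: less_induct)
    case (less n)
    have "step_ok B a d (nv n) v"
      using ok[of "nv n" v] less.prems by simp
    then consider "nv n = Z" "v = S (S Z)"
      | j t where "j \<in> D" "t \<in> D" "le j (nv n)" "le j B" "le t B" "nv n = S j" "v = tm t t" "mem (pr j t) a d"
      unfolding step_ok_def by blast
    then show ?case
    proof cases
      case 1
      then have "n = 0" "v = nv 2"
        using nv_eq_iff[of n 0] by (auto simp: numeral_2_eq_2)
      then show ?thesis by simp
    next
      case 2
      from 2(1,3) obtain j' where j': "j = nv j'" by (auto simp: le_nv)
      then have "n = Suc j'"
        using 2 nv_eq_iff[of n "Suc j'"] by simp
      then show ?thesis
        using less.IH[of j' t] 2 j' by (simp add: tower_Suc)
    qed
  qed
  then have "w = nv (tower n)" using w by blast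
  then show ?thesis using w by (simp add: fermat_def)
qed

lemma sing_complete: "sing (nv n) (nv (fermat n))"
proof -
  \<comment> \<open>\<open>B\<close> bounds all indices and values of the computation. The code has
    to be right at every pair below it, hence the range up to \<open>p B B\<close>.\<close>
  define B where "B = n + tower n"
  define p where "p = (\<lambda>i v :: nat. (i + v) * (i + v) + i)"
  define F where "F = {p i (tower i) | i. i \<le> n}"
  obtain a d where ad: "\<And>u. u \<le> p B B \<Longrightarrow> Suc (Suc u * d) dvd a \<longleftrightarrow> u \<in> F"
    using finite_set_code[of "p B B" F] by blast
  have le_p: "p i v \<le> p B B" if "i \<le> B" "v \<le> B" for i v
    unfolding p_def using that by (intro add_mono mult_mono) auto
  have mem: "mem (pr (nv i) (nv v)) (nv a) (nv d) \<longleftrightarrow> i \<le> n \<and> v = tower i"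
    if "i \<le> B" "v \<le> B" for i v
  proof -
    have "mem (pr (nv i) (nv v)) (nv a) (nv d) \<longleftrightarrow> p i v \<in> F"
      using ad[OF le_p[OF that]] unfolding p_def pr_nv mem_nv .
    also have "\<dots> \<longleftrightarrow> i \<le> n \<and> v = tower i"
      unfolding F_def p_def using pair_inj by blast
    finally show ?thesis .
  qed
  have tower_le: "tower i \<le> B" if "i \<le> n" for i
    using that unfolding B_def tower_def by (simp add: trans_le_add2)
  have "step_ok (nv B) (nv a) (nv d) (nv i) (nv v)" if iv: "i \<le> n" "v = tower i" for i v
  proof (cases i)
    case 0
    then show ?thesis using iv by (simp add: step_ok_def numeral_2_eq_2)
  next
    case (Suc j)
    have "j \<le> B" "tower j \<le> B"
      using Suc iv tower_le[of j] by (auto simp: B_def)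
    moreover from this have "mem (pr (nv j) (nv (tower j))) (nv a) (nv d)"
      using mem[of j "tower j"] Suc iv by simp
    ultimately have "\<exists>j\<in>D. \<exists>t\<in>D. le j (nv i) \<and> le j (nv B) \<and> le t (nv B) \<and> nv i = S j \<and>
        nv v = tm t t \<and> mem (pr j t) (nv a) (nv d)"
      by - (rule bexI[of _ "nv j"], rule bexI[of _ "nv (tower j)"],
        use Suc iv le_nv_nv[of j "Suc j"] in \<open>auto simp: tower_Suc simp del: pr_nv mem_nv\<close>)
    then show ?thesis
      unfolding step_ok_def by (rule disjI2)
  qed
  then have "\<forall>i\<in>D. \<forall>v\<in>D. le i (nv B) \<longrightarrow> le v (nv B) \<longrightarrow> mem (pr i v) (nv a) (nv d) \<longrightarrow>
      step_ok (nv B) (nv a) (nv d) i v"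
    using mem by (auto simp: le_nv simp del: pr_nv mem_nv)
  moreover have "mem (pr (nv n) (nv (tower n))) (nv a) (nv d)"
    using mem[of n "tower n"] tower_le[of n] by (simp add: B_def del: pr_nv mem_nv)
  ultimately show ?thesis
    unfolding sing_def fermat_def using tower_le[of n]
    by - (rule bexI[of _ "nv B"], rule bexI[of _ "nv a"], rule bexI[of _ "nv d"],
        intro conjI bexI[of _ "nv (tower n)"],
        auto simp: B_def simp del: pr_nv mem_nv)
qed

lemma sing_nv: "sing (nv n) z \<longleftrightarrow> z = nv (fermat n)"
  using sing_sound sing_complete by blast

text \<open>The last conjuncts express that \<open>u\<close> is an element of \<open>v\<close>. The
  bounds on \<open>w\<close> and \<open>q\<close> keep both standard when \<open>v\<close>
  is.\<close>

definition chain_ok :: "'a \<Rightarrow> 'a \<Rightarrow> 'a \<Rightarrow> 'a \<Rightarrow> bool" where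
  "chain_ok y a d u \<longleftrightarrow> u = y \<or> (\<exists>v\<in>D. \<exists>w\<in>D. \<exists>q\<in>D.
     le v y \<and> mem v a d \<and> le w v \<and> le q v \<and> sing u w \<and> tm w q = v)"

definition sub :: "'a \<Rightarrow> 'a \<Rightarrow> bool" where
  "sub x y \<longleftrightarrow> le x y \<and> (\<exists>a\<in>D. \<exists>d\<in>D. mem x a d \<and>
     (\<forall>u\<in>D. le u y \<longrightarrow> mem u a d \<longrightarrow> chain_ok y a d u))"

lemma rsat_app_sing [simp]:
  "rsat D M e (app_fm sing_fm [s, t]) \<longleftrightarrow> sing (eval_tm M e s) (eval_tm M e t)"
  by (simp add: rsat_app_fm rsat_sing)

lemma rsat_sub: "rsat D M e sub_fm \<longleftrightarrow> sub (e 0) (e 1)"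
  unfolding sub_fm_def sub_def chain_ok_def
  by (simp only: rsat_unfold rsat_mem rsat_app_sing)

lemma chain_ok_nv:
  "chain_ok (nv y) a d (nv u) \<longleftrightarrow>
     u = y \<or> (\<exists>v\<le>y. mem (nv v) a d \<and> 0 < v \<and> fermat u dvd v)"
proof -
  have "chain_ok (nv y) a d (nv u) \<longleftrightarrow>
      u = y \<or> (\<exists>v\<le>y. mem (nv v) a d \<and> (\<exists>w\<le>v. \<exists>q\<le>v. w = fermat u \<and> w * q = v))"
  proof -
    have "(\<exists>v\<in>D. \<exists>w\<in>D. \<exists>q\<in>D.
          le v (nv y) \<and> mem v a d \<and> le w v \<and> le q v \<and> sing (nv u) w \<and> tm w q = v) \<longleftrightarrow>
        (\<exists>v\<in>D. le v (nv y) \<and> mem v a d \<and>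
          (\<exists>w\<in>D. le w v \<and> (\<exists>q\<in>D. le q v \<and> sing (nv u) w \<and> tm w q = v)))"
      by blast
    also have "\<dots> \<longleftrightarrow> (\<exists>v\<le>y. mem (nv v) a d \<and> (\<exists>w\<le>v. \<exists>q\<le>v. w = fermat u \<and> w * q = v))"
      by (simp only: ex_le_nv sing_nv nv_times nv_eq_iff)
    finally show ?thesis
      by (simp only: chain_ok_def nv_eq_iff)
  qed
  moreover have "(\<exists>w\<le>v. \<exists>q\<le>v. w = fermat u \<and> w * q = v) \<longleftrightarrow> 0 < v \<and> fermat u dvd v" for v
  proof
    assume "\<exists>w\<le>v. \<exists>q\<le>v. w = fermat u \<and> w * q = v"
    then obtain q where "fermat u \<le> v" "fermat u * q = v" by blast
    then show "0 < v \<and> fermat u dvd v" using fermat_gt_1[of u] by auto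
  next
    assume *: "0 < v \<and> fermat u dvd v"
    then obtain q where "v = fermat u * q" by blast
    moreover have "fermat u \<le> v"
      using * by (intro dvd_imp_le) auto
    moreover have "q \<le> v"
      using fermat_gt_1[of u] \<open>v = fermat u * q\<close> by simp
    ultimately show "\<exists>w\<le>v. \<exists>q\<le>v. w = fermat u \<and> w * q = v" by blast
  qed
  ultimately show ?thesis by simp
qed

text \<open>The first conjunct of \<open>sub\<close> makes \<open>x\<close> a numeral, so the
  equivalence covers nonstandard \<open>x\<close> too, as the quantifier in W2 requires.\<close>

lemma sub_nv:
  assumes "x \<in> D"
  shows "sub x (nv (code m)) \<longleftrightarrow> (\<exists>s. hsub s m \<and> x = nv (code s))"
proof
  let ?y = "code m"
  assume "sub x (nv ?y)"
  then obtain a d x' where ad: "a \<in> D" "d \<in> D" and x': "x = nv x'" "x' \<le> ?y" "mem (nv x') a d"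
    and ok: "\<And>u. u \<le> ?y \<Longrightarrow> mem (nv u) a d \<Longrightarrow> chain_ok (nv ?y) a d (nv u)"
    using assms unfolding sub_def by (auto simp: le_nv)
  \<comment> \<open>Chains go upward, \<open>u < v \<le> code m\<close>, so the distance to
    \<open>code m\<close> decreases; the code \<open>a\<close>, \<open>d\<close> need not be
    standard.\<close>
  have "\<exists>s. hsub s m \<and> u = code s" if "u \<le> ?y" "mem (nv u) a d" for u
    using that
  proof (induction u rule: measure_induct_rule[where f = "\<lambda>u. ?y - u"])
    case (less u)
    then consider "u = ?y" | v where "v \<le> ?y" "mem (nv v) a d" "0 < v" "fermat u dvd v"
      using ok[of u] by (auto simp: chain_ok_nv)
    then show ?case
    proof cases
      case 2
      then have "u < v" using fermat_dvd_imp_less by blast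
      then have "?y - v < ?y - u" using 2(1) by simp
      from less.IH[OF this 2(1,2)] obtain s where s: "hsub s m" "v = code s" by blast
      then obtain r where "r \<in># elems s" "u = code r"
        using 2(4) by (auto simp: fermat_dvd_code)
      then show ?thesis
        using s(1) hsub_elem by blast
    qed (use hsub_refl in blast)
  qed
  then show "\<exists>s. hsub s m \<and> x = nv (code s)"
    using x' by blast
next
  let ?y = "code m"
  assume "\<exists>s. hsub s m \<and> x = nv (code s)"
  then obtain s where s: "hsub s m" "x = nv (code s)" by blast
  \<comment> \<open>The coded set consists of the codes of all subterms of \<open>m\<close>; each is
    \<open>m\<close> itself or an element of a further one.\<close>
  obtain a d where ad: "\<And>u. u \<le> ?y \<Longrightarrow> Suc (Suc u * d) dvd a \<longleftrightarrow> u \<in> code ` {r. hsub r m}"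
    using finite_set_code[of ?y "code ` {r. hsub r m}"] by blast
  have "chain_ok (nv ?y) (nv a) (nv d) (nv u)" if "u \<le> ?y" "mem (nv u) (nv a) (nv d)" for u
  proof -
    have "u \<in> code ` {r. hsub r m}"
      using that ad by simp
    then obtain r where r: "u = code r" "hsub r m" by blast
    from hsub_cases_top[OF r(2)] show ?thesis
    proof
      assume "\<exists>t. r \<in># elems t \<and> hsub t m"
      then obtain t where t: "r \<in># elems t" "hsub t m" by blast
      then show ?thesis
        unfolding chain_ok_nv using r code_mono[OF t(2)] code_pos[of t] ad[of "code t"]
        by (intro disjI2 exI[of _ "code t"]) (auto simp: fermat_dvd_code)
    qed (use r in \<open>simp add: chain_ok_nv\<close>)
  qed
  moreover have "mem x (nv a) (nv d)"
    using s ad[OF code_mono[OF s(1)]] by auto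
  ultimately show "sub x (nv ?y)"
    unfolding sub_def using s code_mono[OF s(1)]
    by - (intro conjI, force simp: le_nv, rule bexI[of _ "nv a"], rule bexI[of _ "nv d"],
      auto simp: le_nv)
qed

text \<open>Closed terms take codes as values, so \<open>Sing\<close> matters only at numerals;
  \<open>Uplus\<close> must be controlled on the whole domain because F1 to F3 are
  universal.\<close>

lemma WF_minus_valid:
  fixes N :: "('a, hfun, hrel) struct"
  assumes "inj rk" "p \<in> WF_minus rk"
    and empty: "fint N Empty [] = nv 1"
    and sing: "\<And>n. fint N Sing [nv n] = nv (fermat n)"
    and uplus: "\<And>x y. x \<in> bounded \<Longrightarrow> y \<in> bounded \<Longrightarrow> fint N Uplus [x, y] = trunc x y"
    and sub: "\<And>x y. rint N Sub [x, y] \<longleftrightarrow> sub x y"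
  shows "rsat bounded N e p"
proof -
  have eval: "eval_tm N e (tm_of t) = nv (code (hval t))" for e t
    by (induction t) (simp_all add: empty sing uplus del: nv.simps)
  from \<open>p \<in> WF_minus rk\<close> consider "p = F1" | "p = F2" | "p = F3"
    | s t where "p = W1 s t" "nf rk s \<noteq> nf rk t" | t where "p = W2 rk t"
    by (auto simp: WF_minus_def)
  then show ?thesis
  proof cases
    case 1
    then show ?thesis
      by (simp add: F1_def AllN_def numeral_3_eq_3 numeral_2_eq_2 uplus trunc_assoc)
  next
    case 2
    then show ?thesis
      by (simp add: F2_def AllN_def numeral_2_eq_2 uplus trunc_comm)
  next
    case 3
    then show ?thesis
      using nv_bounded[of 1] by (simp add: F3_def empty uplus trunc_unit)
  next
    case (4 s t)
    then have "hval s \<noteq> hval t"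
      using nf_eq_iff[OF \<open>inj rk\<close>] by blast
    then show ?thesis
      using 4 code_inj by (auto simp: W1_def eval)
  next
    case (5 t)
    have "sub x (nv (code (hval t))) \<longleftrightarrow> (\<exists>s\<in>hull rk t. x = nv (code (hval s)))" if "x \<in> bounded" for x
    proof -
      have "x \<in> D" using that by (simp add: bounded_def)
      then have "sub x (nv (code (hval t))) \<longleftrightarrow> (\<exists>s\<in>hval ` hull rk t. x = nv (code s))"
        by (auto simp: sub_nv hval_hull)
      then show ?thesis by blast
    qed
    then show ?thesis
      using 5 by (auto simp: W2_def sub eval set_hull_list[OF \<open>inj rk\<close>])
  qed
qed

end

text \<open>For \<open>Uplus\<close> the plain product is given: where it leaves the domain the
  graph has no value, and the default \<open>Zero\<close> of the totalization performs the
  truncation.\<close>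

definition graph_R :: "hfun \<Rightarrow> (rfun, rrel) fm" where
  "graph_R f = (case f of
     Empty \<Rightarrow> Eq (Var 0) (rS r0)
   | Sing \<Rightarrow> sing_fm
   | Uplus \<Rightarrow> Eq (Var 2) (rtimes (Var 0) (Var 1)))"

theorem WF_minus_in_R:
  assumes "inj rk"
  shows "interpretable L_hfm (WF_minus rk) L_R theory_R"
proof (rule interpretable_totalI[where k = Zero and \<delta> = dom_R and F = graph_R and R = "\<lambda>_. sub_fm"])
  show "wf_fm L_R (graph_R f)" for f
    by (cases f) (auto simp: graph_R_def, auto simp: L_R_def)
  show "fv_fm (graph_R f) \<subseteq> {..farity L_hfm f}" for f
    using fv_sing_fm by (cases f) (auto simp: graph_R_def L_hfm_def)
next
  fix D and M :: "(rfun tm set, rfun, rrel) struct"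
  assume "is_model L_R theory_R D M"
  then interpret R_model D M by unfold_locales
  show "Z \<in> {a \<in> D. rsat D M (\<lambda>_. a) dom_R}"
    by (simp only: rsat_dom_R Z_bounded)
next
  fix D E and M :: "(rfun tm set, rfun, rrel) struct" and N :: "(rfun tm set, hfun, hrel) struct" and p e
  assume "is_model L_R theory_R D M"
  then interpret R_model D M by unfold_locales
  assume E: "E = {a \<in> D. rsat D M (\<lambda>_. a) dom_R}"
    and fint: "\<And>f as. length as = farity L_hfm f \<Longrightarrow> set as \<subseteq> E \<Longrightarrow> fint N f as =
         (if \<exists>!b. b \<in> E \<and> rsat D M ((!) (as @ [b])) (graph_R f)
          then THE b. b \<in> E \<and> rsat D M ((!) (as @ [b])) (graph_R f) else fint M Zero [])"
    and rint: "\<And>r as. rint N r as \<longleftrightarrow> rsat D M ((!) as) sub_fm"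
    and p: "p \<in> WF_minus rk"
  have E: "E = bounded"
    unfolding E by (rule rsat_dom_R)
  note fint = fint[unfolded E]
  have "fint N Empty [] = nv 1"
    by (subst fint, simp add: L_hfm_def, simp, rule if_ex1_eq) (auto simp: graph_R_def simp flip: nv.simps)
  moreover have "fint N Sing [nv n] = nv (fermat n)" for n
    by (subst fint, simp add: L_hfm_def, simp, rule if_ex1_eq) (auto simp: graph_R_def rsat_sing sing_nv)
  moreover have "fint N Uplus [x, y] = trunc x y" if "x \<in> bounded" "y \<in> bounded" for x y
  proof (cases "tm x y \<in> bounded")
    case True
    then show ?thesis using that
      by (subst fint, simp add: L_hfm_def, simp, intro if_ex1_eq) (auto simp: graph_R_def trunc_def)
  next
    case False
    then show ?thesis using that
      by (subst fint, simp add: L_hfm_def, simp, subst if_ex1_default) (auto simp: graph_R_def trunc_def)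
  qed
  moreover have "rint N Sub [x, y] \<longleftrightarrow> sub x y" for x y
    by (simp add: rint rsat_sub)
  ultimately show "rsat E N e p"
    unfolding E using WF_minus_valid[OF assms p] by blast
next
  show "fv_fm sub_fm \<subseteq> {..<rarity L_hfm r}" for r
    using fv_sub_fm by (simp add: L_hfm_def)
  show "farity L_R Zero = 0"
    by (simp add: L_R_def)
qed (auto simp: is_theory_R is_theory_WF_minus intro: fv_dom_R[THEN subsetD, THEN singletonD])


section \<open>Interpretation of arithmetic in multisets\<close>

primrec hnum :: "nat \<Rightarrow> hfm" where
  "hnum 0 = hempty"
| "hnum (Suc n) = hsing (hnum n)"

text \<open>An ordered triple: multiplicities 1, 2, 3 mark the positions, and its size 3
  distinguishes it from the numerals, whose size is at most 1.\<close>

definition htriple :: "hfm \<Rightarrow> hfm \<Rightarrow> hfm \<Rightarrow> hfm" where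
  "htriple x y z = HFM {#HFM {#x#}, HFM {#y, y#}, HFM {#z, z, z#}#}"

lemma hsub_hnum: "hsub x (hnum n) \<longleftrightarrow> (\<exists>i\<le>n. x = hnum i)"
proof (induction n)
  case 0
  then show ?case by (simp add: hempty_def hsub_HFM)
next
  case (Suc n)
  have "hsub x (hnum (Suc n)) \<longleftrightarrow> x = hnum (Suc n) \<or> hsub x (hnum n)"
    by (simp add: hsing_def hsub_HFM)
  then show ?case
    unfolding Suc by (auto simp: le_Suc_eq)
qed

lemma hnum_eq_iff [simp]: "hnum m = hnum n \<longleftrightarrow> m = n"
proof (induction m arbitrary: n)
  case 0
  show ?case by (cases n) (auto simp: hempty_def hsing_def)
next
  case (Suc m)
  show ?case by (cases n) (auto simp: hempty_def hsing_def Suc)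
qed

lemma size_hnum: "size (elems (hnum n)) \<le> 1"
  by (cases n) (auto simp: hempty_def hsing_def)

lemma size_htriple: "size (elems (htriple x y z)) = 3"
  by (simp add: htriple_def)

lemma htriple_inj:
  assumes "htriple x y z = htriple x' y' z'"
  shows "x = x' \<and> y = y' \<and> z = z'"
proof -
  have eq: "{#HFM {#x#}, HFM {#y, y#}, HFM {#z, z, z#}#} = {#HFM {#x'#}, HFM {#y', y'#}, HFM {#z', z', z'#}#}"
    using assms by (simp only: htriple_def hfm.inject)
  note filter_eq = arg_cong[OF eq, of "filter_mset (\<lambda>u. size (elems u) = k)" for k]
  have "x = x'" "{#y, y#} = {#y', y'#}" "{#z, z, z#} = {#z', z', z'#}"
    using filter_eq[of 1] filter_eq[of 2] filter_eq[of 3] by simp_all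
  then show ?thesis
    by (auto dest: arg_cong[of _ _ set_mset])
qed

lemma not_hsub_htriple_hnum: "\<not> hsub (htriple x y z) (hnum n)"
proof
  assume "hsub (htriple x y z) (hnum n)"
  then obtain i where "htriple x y z = hnum i" by (auto simp: hsub_hnum)
  then show False using size_hnum[of i] size_htriple[of x y z] by simp
qed

text \<open>No second triple hides inside: the numerals and the first two components are too small,
  and the third has three equal elements.\<close>

lemma hsub_htriple_htriple:
  "hsub (htriple x y z) (htriple (hnum i) (hnum j) (hnum k)) \<longleftrightarrow> x = hnum i \<and> y = hnum j \<and> z = hnum k"
proof
  assume "hsub (htriple x y z) (htriple (hnum i) (hnum j) (hnum k))"
  then consider "htriple x y z = htriple (hnum i) (hnum j) (hnum k)"
    | "htriple x y z = HFM {#hnum i#}" | "htriple x y z = HFM {#hnum j, hnum j#}"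
    | "htriple x y z = HFM {#hnum k, hnum k, hnum k#}"
    by (subst (asm) htriple_def[of "hnum i"]) (auto simp: hsub_HFM not_hsub_htriple_hnum htriple_def[of "hnum i"])
  then show "x = hnum i \<and> y = hnum j \<and> z = hnum k"
  proof cases
    case 1
    then show ?thesis by (rule htriple_inj)
  next
    case 4
    then have "{#HFM {#x#}, HFM {#y, y#}, HFM {#z, z, z#}#} = {#hnum k, hnum k, hnum k#}"
      by (simp only: htriple_def hfm.inject)
    from arg_cong[OF this, of set_mset] have "HFM {#x#} = HFM {#y, y#}" by auto
    then show ?thesis by simp
  qed (use size_htriple[of x y z] in simp_all)
qed simp

text \<open>The standard witness for \<open>prim_fm\<close>, with the parameter \<open>x\<close>
  stored in every triple.\<close>

definition hgraph :: "(nat \<Rightarrow> nat) \<Rightarrow> nat \<Rightarrow> nat \<Rightarrow> hfm" where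
  "hgraph f x y = HFM (mset (map (\<lambda>i. htriple (hnum x) (hnum i) (hnum (f i))) [0..<Suc y]))"

lemma hsub_hgraph:
  assumes "u = hnum x \<or> (\<exists>i\<le>y. u = hnum i \<or> u = hnum (f i))"
  shows "hsub u (hgraph f x y)"
proof -
  obtain i where i: "i \<le> y" "u = hnum x \<or> u = hnum i \<or> u = hnum (f i)"
    using assms by blast
  then have "hsub u (htriple (hnum x) (hnum i) (hnum (f i)))"
    by (auto simp: htriple_def hsub_HFM)
  then show ?thesis
    using i(1) by (auto simp: hgraph_def hsub_HFM simp del: upt_Suc)
qed

lemma hsub_htriple_hgraph:
  "hsub (htriple u v w) (hgraph f x y) \<longleftrightarrow> u = hnum x \<and> (\<exists>i\<le>y. v = hnum i \<and> w = hnum (f i))"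
proof -
  \<comment> \<open>A triple has an element of size 1, while all elements of the graph are triples,
    of size 3.\<close>
  have "htriple u v w \<noteq> hgraph f x y"
  proof
    assume "htriple u v w = hgraph f x y"
    then have "HFM {#u#} \<in># elems (hgraph f x y)"
      by (metis hfm.sel htriple_def union_single_eq_member add_mset_add_single multi_member_this)
    then obtain i where "HFM {#u#} = htriple (hnum x) (hnum i) (hnum (f i))"
      by (auto simp: hgraph_def simp del: upt_Suc)
    then show False
      using size_htriple[of "hnum x" "hnum i" "hnum (f i)"] by (metis hfm.sel size_single numeral_eq_one_iff num.distinct(3))
  qed
  then show ?thesis
    unfolding hgraph_def by (subst hsub_HFM) (auto simp: hsub_htriple_htriple less_Suc_eq_le simp del: upt_Suc)
qed

section \<open>Multiset formulas for the interpretation\<close>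

abbreviation "h0 \<equiv> Fn Empty []"
abbreviation "hS t \<equiv> Fn Sing [t]"
abbreviation "hU s t \<equiv> Fn Uplus [s, t]"
abbreviation "hle s t \<equiv> Rel Sub [s, t]"

definition triple_tm :: "hfun tm \<Rightarrow> hfun tm \<Rightarrow> hfun tm \<Rightarrow> hfun tm" where
  "triple_tm x y z = hU (hS (hS x)) (hU (hS (hU (hS y) (hS y))) (hS (hU (hS z) (hU (hS z) (hS z)))))"

text \<open>Linear order of the subterms; among the multisets only the numerals \<open>\<langle>...\<langle>\<emptyset>\<rangle>...\<rangle>\<close> satisfy it.\<close>

definition dom_H :: "(hfun, hrel) fm" where
  "dom_H = And (hle h0 (Var 0)) (All (Imp (hle (Var 0) (Var 1))
     (Or (Eq (Var 0) (Var 1)) (hle (hS (Var 0)) (Var 1)))))"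

text \<open>The components are required to be subterms as well, which makes them standard when the
  multiset is. A standard triple alone would not, as no axiom decomposes singletons and unions of
  arbitrary elements.\<close>

definition holds_fm :: "(hfun, hrel) fm" where
  "holds_fm = And (hle (Var 1) (Var 0)) (And (hle (Var 2) (Var 0)) (And (hle (Var 3) (Var 0))
     (hle (triple_tm (Var 1) (Var 2) (Var 3)) (Var 0))))"

text \<open>
  Graph of a function of \<open>x\<close> and \<open>y\<close> defined by primitive recursion on \<open>y\<close>.  The multiset witnessing
  the recursion consists of triples.
\<close>

definition prim_fm :: "(hfun, hrel) fm \<Rightarrow> (hfun, hrel) fm \<Rightarrow> (hfun, hrel) fm" where
  "prim_fm p q = Ex (And (app_fm holds_fm [Var 0, Var 1, Var 2, Var 3])
     (All (All (All (Imp (app_fm holds_fm [Var 3, Var 2, Var 1, Var 0])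
       (Or (And (Eq (Var 1) h0) (app_fm p [Var 2, Var 0]))
         (Ex (Ex (And (hle (Var 1) (Var 3)) (And (Eq (Var 3) (hS (Var 1)))
           (And (app_fm q [Var 4, Var 0, Var 2]) (app_fm holds_fm [Var 5, Var 4, Var 1, Var 0]))))))))))))"

definition plus_fm :: "(hfun, hrel) fm" where
  "plus_fm = prim_fm (Eq (Var 1) (Var 0)) (Eq (Var 2) (hS (Var 1)))"

definition times_fm :: "(hfun, hrel) fm" where
  "times_fm = prim_fm (Eq (Var 1) h0) (app_fm plus_fm [Var 1, Var 0, Var 2])"

lemma wf_holds_fm: "wf_fm L_hfm holds_fm"
  by (simp add: holds_fm_def triple_tm_def L_hfm_def)

lemma wf_prim_fm: "wf_fm L_hfm p \<Longrightarrow> wf_fm L_hfm q \<Longrightarrow> wf_fm L_hfm (prim_fm p q)"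
proof -
  have app: "wf_fm L_hfm (app_fm p ts)" if "wf_fm L_hfm p" "list_all (wf_tm L_hfm) ts" for p ts
    using that by (intro wf_app_fm) (auto simp: list_all_iff)
  assume "wf_fm L_hfm p" "wf_fm L_hfm q"
  then show ?thesis
    using app wf_holds_fm by (simp add: prim_fm_def) (simp add: L_hfm_def)
qed

lemma fv_holds_fm: "fv_fm holds_fm \<subseteq> {..<4}"
  by (auto simp: holds_fm_def triple_tm_def)

lemma fv_prim_fm: "fv_fm p \<subseteq> {..<2} \<Longrightarrow> fv_fm q \<subseteq> {..<3} \<Longrightarrow> fv_fm (prim_fm p q) \<subseteq> {..<3}"
proof -
  assume p: "fv_fm p \<subseteq> {..<2}" and q: "fv_fm q \<subseteq> {..<3}"
  have "x \<in> fv_tm s \<or> x \<in> fv_tm t" if "x \<in> fv_fm (app_fm p [s, t])" for x s t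
    using fv_app_fm[OF that] p by (auto simp: numeral_2_eq_2)
  moreover have "x \<in> fv_tm s \<or> x \<in> fv_tm t \<or> x \<in> fv_tm u" if "x \<in> fv_fm (app_fm q [s, t, u])" for x s t u
    using fv_app_fm[OF that] q by (auto simp: numeral_3_eq_3)
  moreover have "x \<in> fv_tm s \<or> x \<in> fv_tm t \<or> x \<in> fv_tm u \<or> x \<in> fv_tm v"
    if "x \<in> fv_fm (app_fm holds_fm [s, t, u, v])" for x s t u v
    using fv_app_fm[OF that] fv_holds_fm by (auto simp: eval_nat_numeral)
  ultimately show ?thesis
    by (auto simp: prim_fm_def) fastforce+
qed

section \<open>Models of WF^- and their standard multisets\<close>

locale WF_model =
  fixes D :: "'a set" and M :: "('a, hfun, hrel) struct" and rk :: "symb \<Rightarrow> nat"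
  assumes model: "is_model L_hfm (WF_minus rk) D M" and inj_rk: "inj rk"
begin

abbreviation "emp \<equiv> fint M Empty []"
abbreviation "sg x \<equiv> fint M Sing [x]"
abbreviation "un x y \<equiv> fint M Uplus [x, y]"
abbreviation "sb x y \<equiv> rint M Sub [x, y]"

lemma closed: "length as = hfun_arity f \<Longrightarrow> set as \<subseteq> D \<Longrightarrow> fint M f as \<in> D"
  using model by (simp add: is_model_def L_hfm_def)

lemma closed_simps [simp]:
  "emp \<in> D" "x \<in> D \<Longrightarrow> sg x \<in> D" "x \<in> D \<Longrightarrow> y \<in> D \<Longrightarrow> un x y \<in> D"
  using closed[of "[]" Empty] closed[of "[x]" Sing] closed[of "[x, y]" Uplus] by auto

lemma axiom: "p \<in> WF_minus rk \<Longrightarrow> rsat D M (\<lambda>_. emp) p"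
  using model by (auto simp: is_model_def)

lemma un_assoc: "x \<in> D \<Longrightarrow> y \<in> D \<Longrightarrow> z \<in> D \<Longrightarrow> un (un x y) z = un x (un y z)"
  using axiom[of F1] by (simp add: WF_minus_def F1_def AllN_def eval_nat_numeral)

lemma un_comm: "x \<in> D \<Longrightarrow> y \<in> D \<Longrightarrow> un x y = un y x"
  using axiom[of F2] unfolding WF_minus_def F2_def AllN_def by (simp only: rsat_unfold funpow.simps o_apply id_apply) auto

lemma un_emp: "x \<in> D \<Longrightarrow> un x emp = x"
  using axiom[of F3] by (simp add: WF_minus_def F3_def)

lemma emp_un: "x \<in> D \<Longrightarrow> un emp x = x"
  using un_emp[of x] un_comm[of x emp] by simp

definition val :: "cterm \<Rightarrow> 'a" where
  "val t = eval_tm M (\<lambda>_. emp) (tm_of t)"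

lemma val_simps [simp]:
  "val CEmpty = emp" "val (CSing t) = sg (val t)" "val (CUplus s t) = un (val s) (val t)"
  by (auto simp: val_def)

lemma eval_tm_of_val: "eval_tm M e (tm_of t) = val t"
  by (induction t) auto

lemma val_in [simp]: "val t \<in> D"
  by (induction t) auto

lemma val_build_Cons: "val (build (t # ts)) = un (sg (val t)) (val (build ts))"
  by (cases ts) (auto simp: un_emp)

lemma val_build_append: "val (build (ss @ ts)) = un (val (build ss)) (val (build ts))"
  by (induction ss) (auto simp: val_build_Cons un_assoc emp_un)

lemma un_left_comm: "x \<in> D \<Longrightarrow> y \<in> D \<Longrightarrow> z \<in> D \<Longrightarrow> un x (un y z) = un y (un x z)"
  using un_assoc[of x y z] un_assoc[of y x z] un_comm[of x y] by simp

lemma val_build_insort: "val (build (insort_key f t ts)) = val (build (t # ts))"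
proof (induction ts)
  case (Cons s ts)
  show ?case
  proof (cases "f t \<le> f s")
    case False
    then have "val (build (insort_key f t (s # ts))) = un (sg (val s)) (un (sg (val t)) (val (build ts)))"
      using Cons by (simp add: val_build_Cons)
    also have "\<dots> = val (build (t # s # ts))"
      by (simp only: val_build_Cons) (rule un_left_comm, auto)
    finally show ?thesis .
  qed simp
qed simp

lemma val_build_sort: "val (build (sort_key f ts)) = val (build ts)"
  by (induction ts) (auto simp: val_build_insort val_build_Cons)

lemma val_build_factors: "val (build (factors t)) = val t"
  by (induction t) (auto simp: val_build_append)

text \<open>F1 to F3 justify each normalization step: flattening, sorting and deleting empty
  factors.\<close>

lemma val_nf: "val (nf rk t) = val t"
  by (induction t) (auto simp: val_build_sort val_build_append val_build_factors)

text \<open>W1 separates different normal forms, so the closed terms form a copy of the hereditarily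
  finite multisets in every model.\<close>

lemma val_eq_iff: "val s = val t \<longleftrightarrow> hval s = hval t"
proof
  assume "hval s = hval t"
  then show "val s = val t"
    using nf_eq_iff[OF inj_rk, of s t] val_nf by metis
next
  assume "val s = val t"
  moreover have "val s \<noteq> val t" if "nf rk s \<noteq> nf rk t"
    using that axiom[of "W1 s t"] by (auto simp: WF_minus_def W1_def eval_tm_of_val)
  ultimately show "hval s = hval t"
    using nf_eq_iff[OF inj_rk] by blast
qed

definition emb :: "hfm \<Rightarrow> 'a" where
  "emb m = val (SOME t. hval t = m)"

lemma emb_hval: "emb (hval t) = val t"
proof -
  have "hval (SOME s. hval s = hval t) = hval t" by (rule someI) simp
  then show ?thesis by (simp add: emb_def val_eq_iff)
qed

lemma emb_in [simp]: "emb x \<in> D"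
  by (simp add: emb_def)

lemma emb_eq_iff [simp]: "emb x = emb y \<longleftrightarrow> x = y"
  using ex_hval[of x] ex_hval[of y] by (auto simp: emb_hval val_eq_iff)

lemma emb_simps:
  "emp = emb hempty" "sg (emb x) = emb (hsing x)" "un (emb x) (emb y) = emb (hplus x y)"
proof -
  obtain s t where [simp]: "x = hval s" "y = hval t" using ex_hval by metis
  show "emp = emb hempty" "sg (emb x) = emb (hsing x)" "un (emb x) (emb y) = emb (hplus x y)"
    using emb_hval[of CEmpty] emb_hval[of "CSing s"] emb_hval[of "CUplus s t"] by (auto simp: emb_hval)
qed

lemma sb_emb: "x \<in> D \<Longrightarrow> sb x (emb m) \<longleftrightarrow> (\<exists>s. hsub s m \<and> x = emb s)"
proof -
  assume x: "x \<in> D"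
  obtain t where t: "m = hval t" using ex_hval by metis
  have "sb x (val t) \<longleftrightarrow> (\<exists>s\<in>hull rk t. x = val s)"
    using axiom[of "W2 rk t"] x
    by (force simp: WF_minus_def W2_def eval_tm_of_val set_hull_list[OF inj_rk])
  also have "\<dots> \<longleftrightarrow> (\<exists>s\<in>hval ` hull rk t. x = emb s)"
    by (auto simp: emb_hval)
  finally show ?thesis
    by (simp add: t emb_hval hval_hull)
qed

lemma sb_emb_emb [simp]: "sb (emb x) (emb y) \<longleftrightarrow> hsub x y"
  by (simp add: sb_emb)

section \<open>Numerals and primitive recursion in models of WF^-\<close>

abbreviation "nm n \<equiv> emb (hnum n)"

lemma sb_nm: "x \<in> D \<Longrightarrow> sb x (nm n) \<longleftrightarrow> (\<exists>i\<le>n. x = nm i)"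
  by (auto simp: sb_emb hsub_hnum)

lemma nm_simps: "emp = nm 0" "sg (nm n) = nm (Suc n)"
  by (simp_all add: emb_simps)

definition numlike :: "'a \<Rightarrow> bool" where
  "numlike x \<longleftrightarrow> sb emp x \<and> (\<forall>y\<in>D. sb y x \<longrightarrow> y = x \<or> sb (sg y) x)"

lemma rsat_dom_H: "rsat D M e dom_H \<longleftrightarrow> numlike (e 0)"
  unfolding dom_H_def numlike_def by (simp only: rsat_unfold)

lemma numlike_nm: "numlike (nm n)"
  unfolding numlike_def
proof (intro conjI ballI impI)
  show "sb emp (nm n)" using sb_nm[of emp n] nm_simps by auto
  fix y assume "y \<in> D" "sb y (nm n)"
  then obtain i where "i \<le> n" "y = nm i" by (auto simp: sb_nm)
  then show "y = nm n \<or> sb (sg y) (nm n)"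
    by (cases "i = n") (auto simp: nm_simps(2) hsub_hnum simp del: hnum.simps)
qed

text \<open>Induction on \<open>n\<close> outside the model: if \<open>nm n\<close> is below
  \<open>x\<close>, it is \<open>x\<close> or its singleton is below \<open>x\<close>. This gives
  the comparability axiom of R, also for nonstandard \<open>x\<close>.\<close>

lemma numlike_linear: "x \<in> D \<Longrightarrow> numlike x \<Longrightarrow> sb x (nm n) \<or> sb (nm n) x"
proof -
  assume x: "x \<in> D" "numlike x"
  have "sb (nm n) x \<or> (\<exists>i<n. x = nm i)"
  proof (induction n)
    case 0
    then show ?case using x nm_simps(1) by (auto simp: numlike_def)
  next
    case (Suc n)
    then show ?case
    proof
      assume "sb (nm n) x"
      then have "nm n = x \<or> sb (sg (nm n)) x"
        using x(2) emb_in unfolding numlike_def by blast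
      then show ?thesis
        unfolding nm_simps(2) by auto
    qed (auto simp: less_Suc_eq)
  qed
  then show ?thesis by (auto simp: hsub_hnum intro: less_imp_le)
qed

definition tr :: "'a \<Rightarrow> 'a \<Rightarrow> 'a \<Rightarrow> 'a" where
  "tr x y z = un (sg (sg x)) (un (sg (un (sg y) (sg y))) (sg (un (sg z) (un (sg z) (sg z)))))"

lemma tr_emb: "tr (emb x) (emb y) (emb z) = emb (htriple x y z)"
  by (simp add: tr_def emb_simps hsing_def hplus_def htriple_def add_mset_commute)

definition holds :: "'a \<Rightarrow> 'a \<Rightarrow> 'a \<Rightarrow> 'a \<Rightarrow> bool" where
  "holds b x y z \<longleftrightarrow> sb x b \<and> sb y b \<and> sb z b \<and> sb (tr x y z) b"

lemma rsat_holds: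
  "rsat D M e (app_fm holds_fm [s, t, u, v]) \<longleftrightarrow>
     holds (eval_tm M e s) (eval_tm M e t) (eval_tm M e u) (eval_tm M e v)"
  by (simp add: rsat_app_fm holds_fm_def holds_def triple_tm_def tr_def eval_nat_numeral conj_ac)

lemma holds_hgraph:
  assumes "u \<in> D" "v \<in> D" "w \<in> D"
  shows "holds (emb (hgraph f x y)) u v w \<longleftrightarrow> u = nm x \<and> (\<exists>i\<le>y. v = nm i \<and> w = nm (f i))"
proof
  assume holds: "holds (emb (hgraph f x y)) u v w"
  then obtain u' v' w' where "u = emb u'" "v = emb v'" "w = emb w'"
    using assms by (auto simp: holds_def sb_emb)
  then show "u = nm x \<and> (\<exists>i\<le>y. v = nm i \<and> w = nm (f i))"
    using holds by (auto simp: holds_def tr_emb hsub_htriple_hgraph)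
next
  assume "u = nm x \<and> (\<exists>i\<le>y. v = nm i \<and> w = nm (f i))"
  then show "holds (emb (hgraph f x y)) u v w"
    by (auto simp: holds_def tr_emb hsub_htriple_hgraph intro!: hsub_hgraph)
qed

definition prim :: "('a \<Rightarrow> 'a \<Rightarrow> bool) \<Rightarrow> ('a \<Rightarrow> 'a \<Rightarrow> 'a \<Rightarrow> bool) \<Rightarrow> 'a \<Rightarrow> 'a \<Rightarrow> 'a \<Rightarrow> bool" where
  "prim P Q x y z \<longleftrightarrow> (\<exists>b\<in>D. holds b x y z \<and> (\<forall>u\<in>D. \<forall>v\<in>D. \<forall>w\<in>D. holds b u v w \<longrightarrow>
     v = emp \<and> P u w \<or> (\<exists>v'\<in>D. \<exists>w'\<in>D. sb v' v \<and> v = sg v' \<and> Q u w' w \<and> holds b u v' w')))"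

lemma rsat_prim:
  assumes "\<And>e. rsat D M e p \<longleftrightarrow> P (e 0) (e 1)" "\<And>e. rsat D M e q \<longleftrightarrow> Q (e 0) (e 1) (e 2)"
  shows "rsat D M e (prim_fm p q) \<longleftrightarrow> prim P Q (e 0) (e 1) (e 2)"
proof -
  have "rsat D M e (app_fm p [s, t]) \<longleftrightarrow> P (eval_tm M e s) (eval_tm M e t)" for e s t
    by (simp add: rsat_app_fm assms)
  moreover have "rsat D M e (app_fm q [s, t, u]) \<longleftrightarrow> Q (eval_tm M e s) (eval_tm M e t) (eval_tm M e u)" for e s t u
    by (simp add: rsat_app_fm assms numeral_2_eq_2)
  ultimately show ?thesis
    unfolding prim_fm_def prim_def by (simp only: rsat_unfold rsat_holds)
qed

text \<open>Even for a nonstandard witness, the triple at \<open>y\<close> forces a predecessor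
  whose index is below \<open>nm y\<close> and hence a numeral; induction fixes its value and
  \<open>Q\<close> the next one. So \<open>P\<close> and \<open>Q\<close> have to be known only at
  standard inputs.\<close>

lemma prim_nm:
  assumes P: "\<And>w. w \<in> D \<Longrightarrow> P (nm x) w \<longleftrightarrow> w = nm (f 0)"
    and Q: "\<And>i w. w \<in> D \<Longrightarrow> Q (nm x) (nm (f i)) w \<longleftrightarrow> w = nm (f (Suc i))"
    and "z \<in> D"
  shows "prim P Q (nm x) (nm y) z \<longleftrightarrow> z = nm (f y)"
proof
  assume "prim P Q (nm x) (nm y) z"
  then obtain b where "holds b (nm x) (nm y) z"
    and rec: "\<And>u v w. u \<in> D \<Longrightarrow> v \<in> D \<Longrightarrow> w \<in> D \<Longrightarrow> holds b u v w \<Longrightarrow>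
     v = emp \<and> P u w \<or> (\<exists>v'\<in>D. \<exists>w'\<in>D. sb v' v \<and> v = sg v' \<and> Q u w' w \<and> holds b u v' w')"
    unfolding prim_def by blast
  then show "z = nm (f y)"
    using \<open>z \<in> D\<close>
  proof (induction y arbitrary: z rule: less_induct)
    case (less y)
    from rec[OF emb_in emb_in less.prems(3,1)]
    consider "nm y = emp" "P (nm x) z"
      | v w where "v \<in> D" "w \<in> D" "sb v (nm y)" "nm y = sg v" "Q (nm x) w z" "holds b (nm x) v w"
      by blast
    then show ?case
    proof cases
      case 1
      then have "y = 0" by (simp only: nm_simps(1) emb_eq_iff hnum_eq_iff)
      then show ?thesis using 1 P less.prems(3) by simp
    next
      case 2
      from 2(1,3) obtain y' where y': "v = nm y'" by (auto simp: sb_nm)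
      then have y: "y = Suc y'"
        using 2(4) by (simp only: y' nm_simps(2) emb_eq_iff hnum_eq_iff)
      then have "w = nm (f y')"
        using less.IH[of y' w] less.prems(2) 2 y' rec by auto
      then show ?thesis
        using 2 Q less.prems(3) y by simp
    qed
  qed
next
  assume z: "z = nm (f y)"
  let ?b = "emb (hgraph f x y)"
  have "v = emp \<and> P u w \<or> (\<exists>v'\<in>D. \<exists>w'\<in>D. sb v' v \<and> v = sg v' \<and> Q u w' w \<and> holds ?b u v' w')"
    if "u \<in> D" "v \<in> D" "w \<in> D" "holds ?b u v w" for u v w
  proof -
    from that obtain i where i: "u = nm x" "i \<le> y" "v = nm i" "w = nm (f i)"
      by (auto simp: holds_hgraph)
    show ?thesis
    proof (cases i)
      case 0
      then show ?thesis using i P nm_simps(1) by simp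
    next
      case (Suc j)
      have "\<exists>v'\<in>D. \<exists>w'\<in>D. sb v' v \<and> v = sg v' \<and> Q u w' w \<and> holds ?b u v' w'"
        by (rule bexI[of _ "nm j"], rule bexI[of _ "nm (f j)"])
          (use i Suc Q in \<open>auto simp: holds_hgraph nm_simps(2) hsub_hnum simp del: hnum.simps\<close>)
      then show ?thesis ..
    qed
  qed
  moreover have "holds ?b (nm x) (nm y) z"
    using z by (auto simp: holds_hgraph)
  ultimately show "prim P Q (nm x) (nm y) z"
    unfolding prim_def by (intro bexI[of _ ?b] conjI ballI impI) auto
qed

definition plus :: "'a \<Rightarrow> 'a \<Rightarrow> 'a \<Rightarrow> bool" where
  "plus = prim (\<lambda>u w. w = u) (\<lambda>u w' w. w = sg w')"

definition times :: "'a \<Rightarrow> 'a \<Rightarrow> 'a \<Rightarrow> bool" where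
  "times = prim (\<lambda>u w. w = emp) (\<lambda>u w' w. plus w' u w)"

lemma rsat_plus: "rsat D M e plus_fm \<longleftrightarrow> plus (e 0) (e 1) (e 2)"
  unfolding plus_fm_def plus_def by (rule rsat_prim) auto

lemma rsat_times: "rsat D M e times_fm \<longleftrightarrow> times (e 0) (e 1) (e 2)"
  unfolding times_fm_def times_def
  by (rule rsat_prim) (auto simp: rsat_app_fm rsat_plus numeral_2_eq_2)

lemma plus_nm: "z \<in> D \<Longrightarrow> plus (nm x) (nm y) z \<longleftrightarrow> z = nm (x + y)"
  unfolding plus_def by (rule prim_nm[where f = "\<lambda>y. x + y"]) (auto simp: nm_simps(2))

lemma times_nm: "z \<in> D \<Longrightarrow> times (nm x) (nm y) z \<longleftrightarrow> z = nm (x * y)"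
  unfolding times_def
  by (rule prim_nm[where f = "\<lambda>y. x * y"]) (auto simp: nm_simps(1) plus_nm add.commute)

text \<open>Only the two order axioms quantify over the domain, and they contain no operation
  besides numerals; hence the operations need values at numerals only.\<close>

lemma theory_R_valid:
  fixes N :: "('a, rfun, rrel) struct"
  assumes "p \<in> theory_R"
    and zero: "fint N Zero [] = nm 0"
    and succ: "\<And>n. fint N Succ [nm n] = nm (Suc n)"
    and plus: "\<And>m n. fint N Plus [nm m, nm n] = nm (m + n)"
    and times: "\<And>m n. fint N Times [nm m, nm n] = nm (m * n)"
    and leq: "\<And>x y. rint N Leq [x, y] \<longleftrightarrow> sb x y"
  shows "rsat {x \<in> D. numlike x} N e p"
proof -
  have eval: "eval_tm N e (num n) = nm n" for e n
    by (induction n) (simp_all only: num.simps eval_tm.simps list.map zero succ)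
  from \<open>p \<in> theory_R\<close> consider m n where "p = Eq (Fn Plus [num n, num m]) (num (n + m))"
    | m n where "p = Eq (Fn Times [num n, num m]) (num (n * m))"
    | m n where "p = Neg (Eq (num n) (num m))" "n \<noteq> m"
    | n where "p = All (Iff (Rel Leq [Var 0, num n]) (Disj (map (\<lambda>i. Eq (Var 0) (num i)) [0..<Suc n])))"
    | n where "p = All (Or (Rel Leq [Var 0, num n]) (Rel Leq [num n, Var 0]))"
    unfolding theory_R_def by blast
  then show ?thesis
  proof cases
    case (4 n)
    then show ?thesis
      by (auto simp: eval leq sb_nm less_Suc_eq_le simp del: upt_Suc)
  next
    case (5 n)
    then show ?thesis
      using numlike_linear by (auto simp: eval leq)
  qed (simp_all add: eval plus times)
qed

end

definition graph_H :: "rfun \<Rightarrow> (hfun, hrel) fm" where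
  "graph_H f = (case f of
     Zero \<Rightarrow> Eq (Var 0) h0
   | Succ \<Rightarrow> Eq (Var 1) (hS (Var 0))
   | Plus \<Rightarrow> plus_fm
   | Times \<Rightarrow> times_fm)"

lemma wf_plus_fm: "wf_fm L_hfm plus_fm"
  unfolding plus_fm_def by (rule wf_prim_fm) (auto simp: L_hfm_def)

lemma wf_times_fm: "wf_fm L_hfm times_fm"
  unfolding times_fm_def by (intro wf_prim_fm wf_app_fm wf_plus_fm) (auto, auto simp: L_hfm_def)

lemma fv_plus_fm: "fv_fm plus_fm \<subseteq> {..<3}"
  unfolding plus_fm_def by (rule fv_prim_fm) auto

lemma fv_times_fm: "fv_fm times_fm \<subseteq> {..<3}"
  unfolding times_fm_def
proof (rule fv_prim_fm)
  show "fv_fm (app_fm plus_fm [Var 1, Var 0, Var 2]) \<subseteq> {..<3}"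
    using fv_plus_fm by (force dest!: fv_app_fm simp: numeral_3_eq_3)
qed auto

theorem R_in_WF_minus:
  assumes "inj rk"
  shows "interpretable L_R theory_R L_hfm (WF_minus rk)"
proof (rule interpretable_totalI[where k = Empty and \<delta> = dom_H and F = graph_H and R = "\<lambda>_. hle (Var 0) (Var 1)"])
  show "wf_fm L_hfm (graph_H f)" for f
    using wf_plus_fm wf_times_fm by (cases f) (auto simp: graph_H_def, auto simp: L_hfm_def)
  show "fv_fm (graph_H f) \<subseteq> {..farity L_R f}" for f
    using fv_plus_fm fv_times_fm by (cases f) (auto simp: graph_H_def L_R_def)
next
  fix D and M :: "(hfun tm set, hfun, hrel) struct"
  assume "is_model L_hfm (WF_minus rk) D M"
  then interpret WF_model D M rk using assms by unfold_locales
  show "emp \<in> {a \<in> D. rsat D M (\<lambda>_. a) dom_H}"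
    using numlike_nm[of 0] nm_simps(1) by (simp add: rsat_dom_H)
next
  fix D E and M :: "(hfun tm set, hfun, hrel) struct" and N :: "(hfun tm set, rfun, rrel) struct" and p e
  assume "is_model L_hfm (WF_minus rk) D M"
  then interpret WF_model D M rk using assms by unfold_locales
  assume E: "E = {a \<in> D. rsat D M (\<lambda>_. a) dom_H}"
    and fint: "\<And>f as. length as = farity L_R f \<Longrightarrow> set as \<subseteq> E \<Longrightarrow> fint N f as =
         (if \<exists>!b. b \<in> E \<and> rsat D M ((!) (as @ [b])) (graph_H f)
          then THE b. b \<in> E \<and> rsat D M ((!) (as @ [b])) (graph_H f) else fint M Empty [])"
    and rint: "\<And>r as. rint N r as \<longleftrightarrow> rsat D M ((!) as) (hle (Var 0) (Var 1))"
    and p: "p \<in> theory_R"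
  have E: "E = {x \<in> D. numlike x}"
    unfolding E by (simp add: rsat_dom_H)
  have nm: "nm n \<in> E" for n
    by (simp add: E numlike_nm)
  have in_D: "x \<in> D" if "x \<in> E" for x
    using that by (simp add: E)
  have "fint N Zero [] = nm 0"
    by (subst fint, simp add: L_R_def, simp, rule if_ex1_eq) (auto simp: graph_H_def nm nm_simps(1) simp del: hnum.simps)
  moreover have "fint N Succ [nm n] = nm (Suc n)" for n
    by (subst fint, simp add: L_R_def, simp add: nm, rule if_ex1_eq)
      (auto simp: graph_H_def nm nm_simps(2) simp del: hnum.simps)
  moreover have "fint N Plus [nm m, nm n] = nm (m + n)" for m n
    by (subst fint, simp add: L_R_def, simp add: nm, rule if_ex1_eq)
      (auto simp: graph_H_def nm rsat_plus plus_nm in_D numeral_2_eq_2)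
  moreover have "fint N Times [nm m, nm n] = nm (m * n)" for m n
    by (subst fint, simp add: L_R_def, simp add: nm, rule if_ex1_eq)
      (auto simp: graph_H_def nm rsat_times times_nm in_D numeral_2_eq_2)
  moreover have "rint N Leq [x, y] \<longleftrightarrow> sb x y" for x y
    by (simp add: rint)
  ultimately show "rsat E N e p"
    unfolding E by (rule theory_R_valid[OF p])
next
  show "wf_fm L_hfm dom_H" "wf_fm L_hfm (hle (Var 0) (Var 1))" "farity L_hfm Empty = 0"
    by (auto simp: dom_H_def L_hfm_def)
  show "fv_fm dom_H \<subseteq> {0}" "fv_fm (hle (Var 0) (Var 1)) \<subseteq> {..<rarity L_R r}" for r
    by (auto simp: dom_H_def L_R_def)
qed (auto simp: is_theory_R is_theory_WF_minus)

theorem theoremA: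
  fixes rk :: "symb \<Rightarrow> nat"
  assumes "inj rk"
  shows "interpretable L_hfm (WF_minus rk) L_R theory_R \<and>
         interpretable L_R theory_R L_hfm (WF_minus rk)"
  using WF_minus_in_R[OF assms] R_in_WF_minus[OF assms] ..

end
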